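(* Let $m,a,b>0$ and $1<q<2$. Let $u\in C^1(\overline B_1\setminus\{0\})$ be a positive function satisfying $$-\Delta u+ae^{bu}-m|\nabla u|^q=0\quad\text{in } B_1\setminus\{0\}.$$ Then there exists $\gamma\in[0,\frac 2b]$ such that $$\lim_{x\to 0}\frac{u(x)}{-\ln|x|}=\gamma .$$ Furthermore $e^{bu}$ and $|\nabla u|^q$ are integrable in $B_1$, and $$-\Delta u+ae^{bu}-m|\nabla u|^q=2\pi\gamma\delta_0\quad\text{in }\mathcal D'(B_1).$$ If $\gamma=0$, then $u$ can be extended as a $C^1(\overline B_1)$ function.
   Context: $B_1$ is the open unit disk of $\mathbb R^2$ centered at $0$, $\delta_0$ is the Dirac mass at $0$, and $\mathcal D'(B_1)$ is the space of distributions on $B_1$. A $C^1$ function satisfying the equation in $B_1\setminus\{0\}$ is understood to satisfy it in the sense of distributions in $B_1\setminus\{0\}$. *)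

theory Defs
  imports "HOL-Analysis.Analysis"
begin

definition grad :: "('a::euclidean_space \<Rightarrow> real) \<Rightarrow> 'a \<Rightarrow> 'a" where
  "grad f x = (THE D. GDERIV f x :> D)"

text \<open>Meant for sets such as \<^term>\<open>cball 0 1\<close> and \<^term>\<open>cball 0 1 - {0}\<close>: every point lies in
  the closure of the interior and the set is locally convex up to the boundary, so differentiability
  within the set with a continuous gradient is the usual class \<open>C\<^sup>1\<close> up to the boundary.\<close>

definition C1_on :: "'a::euclidean_space set \<Rightarrow> ('a \<Rightarrow> real) \<Rightarrow> bool" where
  "C1_on S f \<longleftrightarrow>
     (\<exists>g. continuous_on S g \<and>
          (\<forall>x\<in>S. (f has_derivative (\<lambda>h. g x \<bullet> h)) (at x within S)))"

definition partial_deriv :: "'a::euclidean_space \<Rightarrow> ('a \<Rightarrow> real) \<Rightarrow> 'a \<Rightarrow> real" where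
  "partial_deriv i f x = frechet_derivative f (at x) i"

definition laplacian :: "('a::euclidean_space \<Rightarrow> real) \<Rightarrow> 'a \<Rightarrow> real" where
  "laplacian f x = (\<Sum>i\<in>Basis. partial_deriv i (partial_deriv i f) x)"

fun Ck :: "nat \<Rightarrow> ('a::euclidean_space \<Rightarrow> real) \<Rightarrow> bool" where
  "Ck 0 f \<longleftrightarrow> continuous_on UNIV f"
| "Ck (Suc k) f \<longleftrightarrow> (\<forall>x. f differentiable (at x)) \<and> (\<forall>i\<in>Basis. Ck k (partial_deriv i f))"

text \<open>\<open>C\<^sub>c\<^sup>\<infinity>(\<Omega>)\<close>, with each function extended by zero to the whole space.\<close>

definition test_functions :: "'a::euclidean_space set \<Rightarrow> ('a \<Rightarrow> real) set" where
  "test_functions \<Omega> =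
     {\<phi>. (\<forall>k. Ck k \<phi>) \<and> compact (closure {x. \<phi> x \<noteq> 0}) \<and> closure {x. \<phi> x \<noteq> 0} \<subseteq> \<Omega>}"

definition locally_integrable_on :: "('a::euclidean_space \<Rightarrow> real) \<Rightarrow> 'a set \<Rightarrow> bool"
    (infix "locally'_integrable'_on" 50) where
  "f locally_integrable_on \<Omega> \<longleftrightarrow> (\<forall>K. compact K \<longrightarrow> K \<subseteq> \<Omega> \<longrightarrow> set_integrable lborel K f)"

text \<open>Distributions on \<open>\<Omega>\<close> are represented by functionals of which only the values on
  \<^term>\<open>test_functions \<Omega>\<close> matter, hence the relativised equality \<open>eq_distr\<close>.  The functional
  \<open>distr_of \<Omega> f\<close> is the distribution of \<open>f\<close> when \<open>f\<close> is locally integrable on \<open>\<Omega>\<close>; otherwise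
  the integral may take its default value, so local integrability has to be stated separately
  wherever it is not evident.\<close>

type_synonym 'a distr = "('a \<Rightarrow> real) \<Rightarrow> real"

definition eq_distr :: "'a::euclidean_space set \<Rightarrow> 'a distr \<Rightarrow> 'a distr \<Rightarrow> bool" where
  "eq_distr \<Omega> S T \<longleftrightarrow> (\<forall>\<phi>\<in>test_functions \<Omega>. S \<phi> = T \<phi>)"

definition distr_of :: "'a::euclidean_space set \<Rightarrow> ('a \<Rightarrow> real) \<Rightarrow> 'a distr" where
  "distr_of \<Omega> f = (\<lambda>\<phi>. LINT x:\<Omega>|lborel. f x * \<phi> x)"

definition distr_laplacian :: "'a::euclidean_space distr \<Rightarrow> 'a distr" where
  "distr_laplacian T = (\<lambda>\<phi>. T (laplacian \<phi>))"

definition dirac :: "'a::euclidean_space \<Rightarrow> 'a distr" where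
  "dirac x = (\<lambda>\<phi>. \<phi> x)"

end

theory Submission
  imports Defs "HOL-Computational_Algebra.Polynomial"
begin

text \<open>
  Let \<open>\<chi>\<close> be a smooth cutoff, equal to \<open>1\<close> on \<open>s \<le> 1/4\<close> and to \<open>0\<close> on \<open>s \<ge> 1\<close>, and put
  \<open>\<chi>\<^sub>R y = \<chi> (\<bar>y\<bar>\<^sup>2 / R\<^sup>2)\<close>.  In the plane the averages \<open>A R\<close> of \<open>u\<close> around \<open>x\<close> with density
  \<open>- \<chi>' (\<bar>y - x\<bar>\<^sup>2 / R\<^sup>2) / (\<pi> R\<^sup>2)\<close> satisfy \<open>2 \<pi> R A' R = \<integral> u \<Delta> (\<chi>\<^sub>R (y - x)) dy\<close>, so for \<open>- \<Delta> u = f\<close>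
  one has \<open>2 \<pi> R A' R = - \<integral> f \<chi>\<^sub>R (y - x) dy\<close>; the averages of the gradient behave likewise.  This replaces
  potentials, Green representation and elliptic regularity: it yields the maximum principle and interior
  gradient estimates for solutions that are merely \<open>C\<^sup>1\<close>.

  Comparison with a boundary blow-up solution gives \<open>exp (b u) \<le> C \<bar>x\<bar> powr (- 2)\<close>.  Hence \<open>u\<close> grows at most
  logarithmically, and since \<open>q < 2\<close> a weighted interior estimate gives \<open>\<bar>\<nabla> u\<bar> \<le> C \<bar>x\<bar> powr (- p)\<close> for every
  \<open>p > 1\<close>, so \<open>\<bar>\<nabla> u\<bar> powr q\<close> is integrable.  If \<open>exp (b u)\<close> were not, the flux \<open>R A' R\<close> around \<open>0\<close> would tend
  to \<open>- \<infinity>\<close>, contradicting the logarithmic bound.  So the flux converges, to \<open>- \<gamma>\<close> say, which is the Dirac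
  mass, and \<open>A' R \<approx> - \<gamma> / R\<close> for averages around \<open>x\<close> with \<open>R \<ge> 2 \<bar>x\<bar>\<close> gives the limit.  If \<open>\<gamma> = 0\<close>, then
  \<open>u\<close> is bounded, and a bound \<open>\<bar>\<nabla> u\<bar> \<le> C \<bar>x\<bar> powr (- p)\<close> improves to the exponent \<open>q p - 1 < p\<close> until the
  averages of the gradient converge uniformly near \<open>0\<close>.
\<close>

section \<open>Smooth functions and a cutoff\<close>

text \<open>The obstacle is that the equation is known only against test functions and only off the
  origin, while \<open>u\<close> has no second derivatives. The averages can still be differentiated
  in the radius because the identity is pointwise in the kernels: the \<open>R\<close>-derivatives
  of \<open>kern R\<close> and \<open>dkern i R\<close> are \<open>lap_cut R\<close> and
  \<open>lap_dcut i R\<close> over \<open>2 * pi * R\<close>, that is, multiples of Laplacians of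
  admissible test functions. Test functions not vanishing near 0 are multiplied by
  \<open>1 - cut s\<close>; of the terms this creates, all but \<open>\<phi> 0 * lap_cut s\<close>
  are of size \<open>1 / s\<close> on a ball of radius \<open>s\<close> and disappear because
  \<open>u\<close> has small mass there, and the exception is the flux. The condition
  \<open>q < 2\<close> acts in several places: it absorbs the gradient term in the comparison,
  leaves the positive power \<open>2 - q\<close> in the interior estimate, and yields a gain of
  \<open>2 - q\<close> in each bootstrap step. The gradient must be controlled before the
  exponential: the proof that the latter is integrable uses its sign and needs the other term of the
  source to be integrable already. The bound \<open>2 / b\<close> for \<open>\<gamma>\<close> is the
  logarithm of the inverse square rate of \<open>exp (b * u)\<close>.\<close>

lemma partial_derivI: "(f has_derivative D) (at x) \<Longrightarrow> partial_deriv i f x = D i"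
  unfolding partial_deriv_def by (metis frechet_derivative_at)

lemma Ck_SucI:
  assumes "\<And>x. (f has_derivative D x) (at x)" and "\<And>i. i \<in> Basis \<Longrightarrow> Ck k (\<lambda>x. D x i)"
  shows "Ck (Suc k) f"
proof -
  have "partial_deriv i f = (\<lambda>x. D x i)" for i
    using partial_derivI[OF assms(1)] by auto
  then show ?thesis
    using assms by (auto simp: differentiable_def)
qed

lemma Ck_SucD: "Ck (Suc k) f \<Longrightarrow> Ck k f"
proof (induction k arbitrary: f)
  case 0
  then show ?case
    by (auto intro!: continuous_at_imp_continuous_on differentiable_imp_continuous_within)
next
  case (Suc k)
  then show ?case by (metis Ck.simps(2))
qed

lemma Ck_frechet:
  assumes "Ck (Suc k) f"
  shows "(f has_derivative frechet_derivative f (at x)) (at x)"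
  using assms by (simp add: frechet_derivative_works)

lemma Ck_add: "Ck k f \<Longrightarrow> Ck k g \<Longrightarrow> Ck k (\<lambda>x. f x + g x)"
proof (induction k arbitrary: f g)
  case 0
  then show ?case by (auto intro: continuous_intros)
next
  case (Suc k)
  show ?case
  proof (rule Ck_SucI)
    fix x
    show "((\<lambda>x. f x + g x) has_derivative
        (\<lambda>h. frechet_derivative f (at x) h + frechet_derivative g (at x) h)) (at x)"
      using Suc.prems by (intro derivative_intros Ck_frechet)
  next
    fix i :: 'a assume "i \<in> Basis"
    then show "Ck k (\<lambda>x. frechet_derivative f (at x) i + frechet_derivative g (at x) i)"
      using Suc.IH[of "partial_deriv i f" "partial_deriv i g"] Suc.prems
      by (simp add: partial_deriv_def[abs_def])
  qed
qed

lemma Ck_mult: "Ck k f \<Longrightarrow> Ck k g \<Longrightarrow> Ck k (\<lambda>x. f x * g x)"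
proof (induction k arbitrary: f g)
  case 0
  then show ?case by (auto intro: continuous_intros)
next
  case (Suc k)
  show ?case
  proof (rule Ck_SucI)
    fix x
    show "((\<lambda>x. f x * g x) has_derivative
        (\<lambda>h. f x * frechet_derivative g (at x) h + frechet_derivative f (at x) h * g x)) (at x)"
      using Suc.prems by (intro derivative_intros Ck_frechet)
  next
    fix i :: 'a assume i: "i \<in> Basis"
    have "Ck k f" "Ck k g"
      using Suc.prems by (auto dest!: Ck_SucD simp del: Ck.simps)
    then have "Ck k (\<lambda>x. f x * partial_deriv i g x)" "Ck k (\<lambda>x. partial_deriv i f x * g x)"
      using Suc i by auto
    then show "Ck k (\<lambda>x. f x * frechet_derivative g (at x) i + frechet_derivative f (at x) i * g x)"
      unfolding partial_deriv_def by (rule Ck_add)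
  qed
qed

lemma Ck_const: "Ck k (\<lambda>x. c)"
proof (induction k arbitrary: c)
  case (Suc k)
  show ?case by (rule Ck_SucI[of _ "\<lambda>x h. 0"]) (auto simp: Suc)
qed auto

lemma Ck_inner: "Ck k (\<lambda>x. x \<bullet> v)"
proof (cases k)
  case (Suc k)
  show ?thesis unfolding Suc
    by (rule Ck_SucI[of _ "\<lambda>x h. h \<bullet> v"]) (auto simp: Ck_const intro!: derivative_eq_intros)
qed (auto intro: continuous_intros)

lemma Ck_diff: "Ck k f \<Longrightarrow> Ck k g \<Longrightarrow> Ck k (\<lambda>x. f x - g x)"
  using Ck_add[of k f "\<lambda>x. (-1) * g x"] Ck_mult[OF Ck_const, of k g "-1"] by simp

lemma Ck_sum: "(\<And>i. i \<in> I \<Longrightarrow> Ck k (f i)) \<Longrightarrow> Ck k (\<lambda>x. \<Sum>i\<in>I. f i x)"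
  by (induction I rule: infinite_finite_induct) (auto intro!: Ck_const Ck_add)

lemma Ck_real_SucI:
  fixes h :: "real \<Rightarrow> real"
  assumes "\<And>t. (h has_real_derivative h' t) (at t)" and "Ck k h'"
  shows "Ck (Suc k) h"
  using assms by (intro Ck_SucI[where D="\<lambda>t. (*) (h' t)"]) (auto simp: has_field_derivative_def)

lemma Ck_real_deriv:
  fixes h :: "real \<Rightarrow> real"
  assumes "Ck (Suc k) h"
  shows "(h has_real_derivative deriv h t) (at t)" and "Ck k (deriv h)"
proof -
  have *: "(h has_real_derivative deriv h t) (at t)" for t
    using assms by (simp add: DERIV_deriv_iff_real_differentiable)
  show "(h has_real_derivative deriv h t) (at t)" by (rule *)
  have "partial_deriv 1 h = deriv h"
    using partial_derivI[OF *[unfolded has_field_derivative_def], of 1] by auto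
  then show "Ck k (deriv h)" using assms by auto
qed

lemma Ck_compose:
  fixes h :: "real \<Rightarrow> real" and g :: "'a::euclidean_space \<Rightarrow> real"
  shows "Ck k h \<Longrightarrow> Ck k g \<Longrightarrow> Ck k (\<lambda>x. h (g x))"
proof (induction k arbitrary: h g)
  case 0
  then show ?case by (auto intro!: continuous_on_compose2[of UNIV h])
next
  case (Suc k)
  show ?case
  proof (rule Ck_SucI)
    fix x
    show "((\<lambda>x. h (g x)) has_derivative (\<lambda>v. deriv h (g x) * frechet_derivative g (at x) v)) (at x)"
      using has_derivative_compose[OF Ck_frechet[OF Suc.prems(2)]
          Ck_real_deriv(1)[OF Suc.prems(1), unfolded has_field_derivative_def]] .
  next
    fix i :: 'a assume i: "i \<in> Basis"
    have "Ck k (\<lambda>x. deriv h (g x))"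
      by (rule Suc.IH[OF Ck_real_deriv(2)[OF Suc.prems(1)] Ck_SucD[OF Suc.prems(2)]])
    moreover have "Ck k (partial_deriv i g)"
      using Suc.prems(2) i by simp
    ultimately have "Ck k (\<lambda>x. deriv h (g x) * partial_deriv i g x)"
      by (rule Ck_mult)
    then show "Ck k (\<lambda>x. deriv h (g x) * frechet_derivative g (at x) i)"
      unfolding partial_deriv_def .
  qed
qed

lemma Ck_continuous_on: "Ck k f \<Longrightarrow> continuous_on S f"
proof (induction k arbitrary: f)
  case 0
  then show ?case by (auto intro: continuous_on_subset)
next
  case (Suc k)
  then show ?case using Ck_SucD by blast
qed

text \<open>The functions p(1/t) exp(-1/t), extended by 0, form a family closed under
  differentiation, so smoothness of every order is a single induction. The polynomial is taken in
  \<open>inverse t\<close>.\<close>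

definition flat :: "real poly \<Rightarrow> real \<Rightarrow> real" where
  "flat p t = (if t > 0 then poly p (inverse t) * exp (- inverse t) else 0)"

lemma poly_exp_tendsto_0: "((\<lambda>x. poly p x * exp (- x)) \<longlongrightarrow> 0) at_top" for p :: "real poly"
proof -
  have "((\<lambda>x. \<Sum>i\<le>degree p. coeff p i * (x ^ i / exp x)) \<longlongrightarrow> (\<Sum>i\<le>degree p. coeff p i * 0)) at_top"
    by (intro tendsto_intros tendsto_power_div_exp_0)
  then show ?thesis
    by (simp add: poly_altdef sum_divide_distrib exp_minus field_simps)
qed

text \<open>With X = 1/t one has dX/dt = -X^2, so the derivative of p(X) exp(-X) is X^2 (p(X) -
  p'(X)) exp(-X); hence the factor \<open>monom 1 2\<close>.\<close>

lemma flat_has_derivative: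
  "(flat p has_real_derivative flat (monom 1 2 * (p - pderiv p)) t) (at t)"
proof -
  consider "t > 0" | "t < 0" | "t = 0" by linarith
  then show ?thesis
  proof cases
    case 1
    have "((\<lambda>t. poly p (inverse t) * exp (- inverse t)) has_real_derivative
        flat (monom 1 2 * (p - pderiv p)) t) (at t)"
      using 1 unfolding flat_def
      by (auto intro!: derivative_eq_intros DERIV_compose_FDERIV simp: poly_monom power2_eq_square algebra_simps)
    then show ?thesis
      by (rule has_field_derivative_transform_within_open[of _ _ _ "{0<..}"]) (use 1 in \<open>auto simp: flat_def\<close>)
  next
    case 2
    have "((\<lambda>t. 0) has_real_derivative flat (monom 1 2 * (p - pderiv p)) t) (at t)"
      using 2 by (auto simp: flat_def)
    then show ?thesis
      by (rule has_field_derivative_transform_within_open[of _ _ _ "{..<0}"]) (use 2 in \<open>auto simp: flat_def\<close>)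
  next
    case 3
    \<comment> \<open>At 0 the difference quotient carries an extra factor 1/t;
      \<open>pCons 0 p\<close> absorbs it as a multiplication by the variable
      \<open>inverse t\<close>.\<close>
    have "((\<lambda>t. poly (pCons 0 p) (inverse t) * exp (- inverse t)) \<longlongrightarrow> 0) (at_right 0)"
      using poly_exp_tendsto_0[of "pCons 0 p"] filterlim_inverse_at_top_right
      by (rule filterlim_compose)
    then have "((\<lambda>h. (flat p (0 + h) - flat p 0) / h) \<longlongrightarrow> 0) (at_right 0)"
      by (rule Lim_transform_eventually)
        (auto simp: flat_def eventually_at_right_less eventually_at_filter field_simps)
    moreover have "((\<lambda>h. (flat p (0 + h) - flat p 0) / h) \<longlongrightarrow> 0) (at_left 0)"
      by (rule Lim_transform_eventually[OF tendsto_const])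
        (auto simp: flat_def eventually_at_filter)
    ultimately have "((\<lambda>h. (flat p (0 + h) - flat p 0) / h) \<longlongrightarrow> 0) (at 0)"
      by (rule filterlim_split_at_real[rotated])
    then show ?thesis using 3 by (simp add: DERIV_def flat_def)
  qed
qed

lemma Ck_flat: "Ck k (flat p)"
proof (induction k arbitrary: p)
  case 0
  then show ?case
    by (auto intro!: continuous_at_imp_continuous_on DERIV_isCont[OF flat_has_derivative])
next
  case (Suc k)
  then show ?case using Ck_real_SucI[OF flat_has_derivative] by blast
qed

text \<open>Positive exactly on (1/4, 1). With \<open>s = y \<bullet> y / R\<^sup>2\<close> this is
  the annulus between the radii \<open>R / 2\<close> and \<open>R\<close>, the source of all
  conditions \<open>2 * norm y \<le> R\<close> below.\<close>

definition bump :: "real \<Rightarrow> real" where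
  "bump s = flat 1 ((s - 1/4) * (1 - s))"

lemma Ck_bump: "Ck k bump"
proof -
  have id: "Ck k (\<lambda>s::real. s)" using Ck_inner[of k "1::real"] by simp
  show ?thesis
    unfolding bump_def by (intro Ck_compose[OF Ck_flat] Ck_mult Ck_diff Ck_const id)
qed

lemma bump_nonneg: "bump s \<ge> 0"
  by (simp add: bump_def flat_def)

lemma bump_pos_iff: "bump s > 0 \<longleftrightarrow> 1/4 < s \<and> s < 1"
  by (auto simp: bump_def flat_def zero_less_mult_iff)

lemma bump_zero: "s \<le> 1/4 \<or> s \<ge> 1 \<Longrightarrow> bump s = 0"
  using bump_pos_iff[of s] bump_nonneg[of s] by force

lemma continuous_bump: "continuous_on S bump"
  using Ck_bump[of 0] by (auto intro: continuous_on_subset)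

lemma bump_integral_pos: "integral {0..1} bump > 0"
proof -
  have "integral {0..1} bump \<noteq> 0"
  proof
    assume "integral {0..1} bump = 0"
    then have "(bump has_integral 0) (cbox 0 1)"
      using integrable_integral[OF integrable_continuous_real[OF continuous_bump]]
      by (metis box_real(2))
    then have "bump (1/2) = 0"
      by (intro has_integral_0_cbox_imp_0[of 0 1 bump])
        (auto simp: continuous_bump bump_nonneg)
    then show False using bump_pos_iff[of "1/2"] by auto
  qed
  moreover have "integral {0..1} bump \<ge> 0"
    by (intro integral_nonneg integrable_continuous_real continuous_bump bump_nonneg)
  ultimately show ?thesis by simp
qed

text \<open>Normalised to integral -1, so that its primitive \<open>cutoff\<close> falls from 1 to
  0; this also makes \<open>kern\<close> a probability density.\<close>

definition cutoff' :: "real \<Rightarrow> real" where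
  "cutoff' s = - bump s / integral {0..1} bump"

definition cutoff :: "real \<Rightarrow> real" where
  "cutoff s = (if s \<le> 0 then 1 else 1 + integral {0..s} cutoff')"

lemma Ck_cutoff': "Ck k cutoff'"
  using Ck_mult[OF Ck_const[of k "- 1 / integral {0..1} bump"] Ck_bump]
  by (simp add: cutoff'_def[abs_def] field_simps)

lemma continuous_cutoff': "continuous_on S cutoff'"
  using Ck_cutoff'[of 0] by (auto intro: continuous_on_subset)

lemma cutoff'_zero: "s \<le> 1/4 \<or> s \<ge> 1 \<Longrightarrow> cutoff' s = 0"
  by (simp add: cutoff'_def bump_zero)

lemma cutoff'_nonpos: "cutoff' s \<le> 0"
  using bump_integral_pos bump_nonneg[of s] by (simp add: cutoff'_def)

lemma cutoff_1: "s \<le> 1/4 \<Longrightarrow> cutoff s = 1"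
  using integral_cong[of "{0..s}" cutoff' "\<lambda>_. 0"] by (auto simp: cutoff_def cutoff'_zero)

lemma integral_cutoff': "integral {0..1} cutoff' = -1"
  using bump_integral_pos
  by (simp add: cutoff'_def[abs_def] integral_divide)

lemma cutoff_0: assumes "s \<ge> 1" shows "cutoff s = 0"
proof -
  have "integral {0..1} cutoff' + integral {1..s} cutoff' = integral {0..s} cutoff'"
    using assms
    by (intro Henstock_Kurzweil_Integration.integral_combine integrable_continuous_real continuous_cutoff') auto
  moreover have "integral {1..s} cutoff' = 0"
    using integral_cong[of "{1..s}" cutoff' "\<lambda>_. 0"] by (auto simp: cutoff'_zero)
  ultimately show ?thesis using assms by (simp add: cutoff_def integral_cutoff')
qed

lemma cutoff_has_derivative: "(cutoff has_real_derivative cutoff' s) (at s)"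
proof (cases "s < 1/4")
  case True
  have "((\<lambda>s. 1) has_real_derivative cutoff' s) (at s)"
    using True by (simp add: cutoff'_zero)
  then show ?thesis
    by (rule has_field_derivative_transform_within_open[of _ _ _ "{..<1/4}"])
      (use True in \<open>auto simp: cutoff_1\<close>)
next
  case False
  have "((\<lambda>u. integral {0..u} cutoff') has_real_derivative cutoff' s) (at s within {0..s+1})"
    using False by (intro integral_has_real_derivative continuous_cutoff') auto
  then have "((\<lambda>u. integral {0..u} cutoff') has_real_derivative cutoff' s) (at s)"
    using False by (simp add: at_within_Icc_at)
  then have "((\<lambda>u. 1 + integral {0..u} cutoff') has_real_derivative cutoff' s) (at s)"
    by (auto intro!: derivative_eq_intros)
  then show ?thesis
    by (rule has_field_derivative_transform_within_open[of _ _ _ "{0<..}"])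
      (use False in \<open>auto simp: cutoff_def\<close>)
qed

lemma Ck_cutoff: "Ck k cutoff"
  using Ck_SucD[OF Ck_real_SucI[OF cutoff_has_derivative Ck_cutoff']] .

lemma continuous_cutoff: "continuous_on S cutoff"
  using Ck_cutoff[of 0] by (auto intro: continuous_on_subset)

lemma cutoff_antimono: "s \<le> t \<Longrightarrow> cutoff t \<le> cutoff s"
  by (rule DERIV_nonpos_imp_nonincreasing) (use cutoff_has_derivative cutoff'_nonpos in blast)+

lemma cutoff_bounds: "0 \<le> cutoff s" "cutoff s \<le> 1"
  using cutoff_antimono[of s "max s 1"] cutoff_antimono[of "min s 0" s]
  by (auto simp: cutoff_0 cutoff_1)

definition cutoff'' :: "real \<Rightarrow> real" where "cutoff'' = deriv cutoff'"
definition cutoff''' :: "real \<Rightarrow> real" where "cutoff''' = deriv cutoff''"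

lemma Ck_cutoff'': "Ck k cutoff''" unfolding cutoff''_def by (rule Ck_real_deriv(2)[OF Ck_cutoff'])
lemma Ck_cutoff''': "Ck k cutoff'''" unfolding cutoff'''_def by (rule Ck_real_deriv(2)[OF Ck_cutoff''])

lemma cutoff'_has_derivative: "(cutoff' has_real_derivative cutoff'' s) (at s)"
  unfolding cutoff''_def by (rule Ck_real_deriv(1)[OF Ck_cutoff'])

lemma cutoff''_has_derivative: "(cutoff'' has_real_derivative cutoff''' s) (at s)"
  unfolding cutoff'''_def by (rule Ck_real_deriv(1)[OF Ck_cutoff''])

text \<open>Uniqueness of derivatives only reaches the open set where \<open>s < 1/4\<close> or
  \<open>s > 1\<close>; the endpoints follow from the continuity of \<open>h'\<close> on the
  closure.\<close>

lemma deriv_zero_outside: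
  fixes h :: "real \<Rightarrow> real"
  assumes "\<And>s. s \<le> 1/4 \<or> s \<ge> 1 \<Longrightarrow> h s = 0" and "\<And>s. (h has_real_derivative h' s) (at s)"
    and "continuous_on UNIV h'" and "s \<le> 1/4 \<or> s \<ge> 1"
  shows "h' s = 0"
proof -
  have *: "h' t = 0" if "t \<in> {..<1/4} \<union> {1<..}" for t
  proof -
    have "((\<lambda>s. 0) has_real_derivative h' t) (at t)"
      by (rule has_field_derivative_transform_within_open[OF assms(2), of "{..<1/4} \<union> {1<..}"])
        (use that assms(1) in auto)
    then show ?thesis using DERIV_unique[OF _ DERIV_const] by blast
  qed
  have "closure ({..<1/4::real} \<union> {1<..}) = {..1/4} \<union> {1..}"
    by (simp add: closure_Un)
  then have "s \<in> closure ({..<1/4} \<union> {1<..})" using assms(4) by auto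
  then show ?thesis
    using continuous_constant_on_closure[of "{..<1/4} \<union> {1<..}" h' 0 s] * assms(3)
    by (meson continuous_on_subset top_greatest)
qed

lemma continuous_cutoff'': "continuous_on S cutoff''"
  using Ck_cutoff''[of 0] by (auto intro: continuous_on_subset)
lemma continuous_cutoff''': "continuous_on S cutoff'''"
  using Ck_cutoff'''[of 0] by (auto intro: continuous_on_subset)

lemma cutoff''_zero: "s \<le> 1/4 \<or> s \<ge> 1 \<Longrightarrow> cutoff'' s = 0"
  by (rule deriv_zero_outside[OF cutoff'_zero cutoff'_has_derivative continuous_cutoff''])
lemma cutoff'''_zero: "s \<le> 1/4 \<or> s \<ge> 1 \<Longrightarrow> cutoff''' s = 0"
  by (rule deriv_zero_outside[OF cutoff''_zero cutoff''_has_derivative continuous_cutoff'''])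

lemma cutoff_derivs_bounded:
  obtains B where "B > 0" "\<And>s. \<bar>cutoff' s\<bar> \<le> B" "\<And>s. \<bar>cutoff'' s\<bar> \<le> B" "\<And>s. \<bar>cutoff''' s\<bar> \<le> B"
proof -
  have *: "\<exists>B. \<forall>s. \<bar>h s\<bar> \<le> B" if "continuous_on UNIV h" "\<And>s. s \<le> 1/4 \<or> s \<ge> 1 \<Longrightarrow> h s = 0"
    for h :: "real \<Rightarrow> real"
  proof -
    have "bounded (h ` {0..1})"
      by (intro compact_imp_bounded compact_continuous_image continuous_on_subset[OF that(1)]) auto
    then obtain B where "\<forall>s\<in>{0..1}. \<bar>h s\<bar> \<le> B" unfolding bounded_real by auto
    moreover have "\<bar>h s\<bar> \<le> max B 0" if "s \<notin> {0..1}" for s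
      using that \<open>\<And>s. s \<le> 1/4 \<or> s \<ge> 1 \<Longrightarrow> h s = 0\<close>[of s] by auto
    ultimately show ?thesis by (intro exI[of _ "max B 0"]) (metis max.coboundedI1)
  qed
  obtain B1 B2 B3 where "\<And>s. \<bar>cutoff' s\<bar> \<le> B1" "\<And>s. \<bar>cutoff'' s\<bar> \<le> B2" "\<And>s. \<bar>cutoff''' s\<bar> \<le> B3"
    using *[OF continuous_cutoff' cutoff'_zero] *[OF continuous_cutoff'' cutoff''_zero]
      *[OF continuous_cutoff''' cutoff'''_zero] by metis
  then show thesis
    by (intro that[of "max 1 (max B1 (max B2 B3))"]) (auto simp: le_max_iff_disj)
qed

section \<open>Radial kernels\<close>

lemma Ck_norm_square: "Ck k (\<lambda>y::'a::euclidean_space. (y - x) \<bullet> (y - x))"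
proof -
  have "Ck k (\<lambda>y::'a. \<Sum>i\<in>Basis. (y \<bullet> i - x \<bullet> i) * (y \<bullet> i - x \<bullet> i))"
    by (intro Ck_sum Ck_mult Ck_diff Ck_inner Ck_const)
  moreover have "(y - x) \<bullet> (y - x) = (\<Sum>i\<in>Basis. (y \<bullet> i - x \<bullet> i) * (y \<bullet> i - x \<bullet> i))" for y
    by (subst euclidean_inner) (simp add: inner_diff_left)
  ultimately show ?thesis by simp
qed

definition cut :: "real \<Rightarrow> 'a::euclidean_space \<Rightarrow> real" where
  "cut R y = cutoff (y \<bullet> y / R\<^sup>2)"

definition dcut :: "'a::euclidean_space \<Rightarrow> real \<Rightarrow> 'a \<Rightarrow> real" where
  "dcut i R y = 2 * (y \<bullet> i) / R\<^sup>2 * cutoff' (y \<bullet> y / R\<^sup>2)"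

definition lap_cut :: "real \<Rightarrow> real^2 \<Rightarrow> real" where
  "lap_cut R y = 4 / R\<^sup>2 * (y \<bullet> y / R\<^sup>2 * cutoff'' (y \<bullet> y / R\<^sup>2) + cutoff' (y \<bullet> y / R\<^sup>2))"

definition lap_dcut :: "real^2 \<Rightarrow> real \<Rightarrow> real^2 \<Rightarrow> real" where
  "lap_dcut i R y = 8 * (y \<bullet> i) / R ^ 4 * (y \<bullet> y / R\<^sup>2 * cutoff''' (y \<bullet> y / R\<^sup>2) + 2 * cutoff'' (y \<bullet> y / R\<^sup>2))"

text \<open>A probability density (\<open>integral_kern\<close>) carried by the annulus between the
  radii \<open>R / 2\<close> and \<open>R\<close>: a smoothed circular mean.\<close>

definition kern :: "real \<Rightarrow> real^2 \<Rightarrow> real" where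
  "kern R y = - cutoff' (y \<bullet> y / R\<^sup>2) / (pi * R\<^sup>2)"

text \<open>The derivative of \<open>kern R\<close> in direction \<open>i\<close>
  (\<open>kern_has_derivative_space\<close>); it stands to \<open>dcut i\<close> as
  \<open>kern\<close> stands to \<open>cut\<close>.\<close>

definition dkern :: "real^2 \<Rightarrow> real \<Rightarrow> real^2 \<Rightarrow> real" where
  "dkern i R y = - 2 * (y \<bullet> i) / (pi * R ^ 4) * cutoff'' (y \<bullet> y / R\<^sup>2)"

lemma has_derivative_radial:
  fixes h :: "real \<Rightarrow> real"
  assumes "\<And>s. (h has_real_derivative h' s) (at s)"
  shows "((\<lambda>y::'a::euclidean_space. h ((y - x) \<bullet> (y - x) / R\<^sup>2)) has_derivative
    (\<lambda>v. 2 * ((y - x) \<bullet> v) / R\<^sup>2 * h' ((y - x) \<bullet> (y - x) / R\<^sup>2))) (at y)"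
proof -
  have "((\<lambda>y::'a. (y - x) \<bullet> (y - x)) has_derivative (\<lambda>v. 2 * ((y - x) \<bullet> v))) (at y)"
    by (auto intro!: derivative_eq_intros simp: inner_commute)
  from has_derivative_mult_right[OF this, of "1 / R\<^sup>2"]
  have "((\<lambda>y::'a. (y - x) \<bullet> (y - x) / R\<^sup>2) has_derivative (\<lambda>v. 2 * ((y - x) \<bullet> v) / R\<^sup>2)) (at y)"
    by simp
  from has_derivative_compose[OF this assms[unfolded has_field_derivative_def]]
  show ?thesis by (simp add: mult_ac)
qed

lemma cut_has_derivative: "((\<lambda>y. cut R (y - x)) has_derivative (\<lambda>v. dcut v R (y - x))) (at y)"
  using has_derivative_radial[OF cutoff_has_derivative] by (simp add: cut_def dcut_def)

lemma partial_deriv_cut: "partial_deriv i (\<lambda>y. cut R (y - x)) = (\<lambda>y. dcut i R (y - x))"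
  by (rule ext) (rule partial_derivI[OF cut_has_derivative])

text \<open>The Hessian of \<open>cut R\<close> in the directions \<open>i\<close> and
  \<open>j\<close>; its trace in the plane is \<open>lap_cut\<close>
  (\<open>sum_d2cut\<close>).\<close>

definition d2cut :: "'a::euclidean_space \<Rightarrow> 'a \<Rightarrow> real \<Rightarrow> 'a \<Rightarrow> real" where
  "d2cut i j R y = 2 * (i \<bullet> j) / R\<^sup>2 * cutoff' (y \<bullet> y / R\<^sup>2)
     + 4 * (y \<bullet> i) * (y \<bullet> j) / R ^ 4 * cutoff'' (y \<bullet> y / R\<^sup>2)"

lemma dcut_has_derivative:
  "((\<lambda>y. dcut i R (y - x)) has_derivative (\<lambda>v. d2cut i v R (y - x))) (at y)"
\<comment> \<open>For \<open>R = 0\<close> division by zero sends both sides to 0.\<close>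
proof (cases "R = 0")
  case False
  have "((\<lambda>y. (y - x) \<bullet> i) has_derivative (\<lambda>v. v \<bullet> i)) (at y)"
    by (auto intro!: derivative_eq_intros)
  note * = has_derivative_mult_right[OF has_derivative_mult[OF this
        has_derivative_radial[OF cutoff'_has_derivative]], of "2 / R\<^sup>2" x R]
  have eq: "(\<lambda>y. dcut i R (y - x)) =
      (\<lambda>y. 2 / R\<^sup>2 * (((y - x) \<bullet> i) * cutoff' ((y - x) \<bullet> (y - x) / R\<^sup>2)))"
    by (simp add: dcut_def mult.assoc)
  define z where "z = y - x"
  show ?thesis
    unfolding eq d2cut_def
    by (rule has_derivative_eq_rhs[OF *], unfold z_def[symmetric])
      (use False in \<open>simp add: fun_eq_iff inner_commute[of i] field_simps eval_nat_numeral\<close>)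
qed (simp add: dcut_def d2cut_def)

lemma partial_deriv_dcut: "partial_deriv j (\<lambda>y. dcut i R (y - x)) = (\<lambda>y. d2cut i j R (y - x))"
  by (rule ext) (rule partial_derivI[OF dcut_has_derivative])

lemma sum_Basis_inner: "(\<Sum>j\<in>Basis. (a \<bullet> j) * (b \<bullet> j)) = a \<bullet> b"
  by (simp add: euclidean_inner[of a b])

lemma sum_d2cut: "(\<Sum>j\<in>Basis. d2cut j j R z) = lap_cut R z"
proof -
  have "(\<Sum>j\<in>Basis. d2cut j j R z) = (\<Sum>j\<in>(Basis::(real^2) set). 2 / R\<^sup>2 * cutoff' (z \<bullet> z / R\<^sup>2))
     + 4 / R ^ 4 * cutoff'' (z \<bullet> z / R\<^sup>2) * (\<Sum>j\<in>Basis. (z \<bullet> j) * (z \<bullet> j))"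
    unfolding sum_distrib_left sum.distrib[symmetric]
    by (intro sum.cong refl) (simp add: d2cut_def mult.assoc)
  also have "\<dots> = lap_cut R z"
    unfolding sum_Basis_inner lap_cut_def by (cases "R = 0") (simp_all add: field_simps eval_nat_numeral)
  finally show ?thesis .
qed

lemma laplacian_cut: "laplacian (\<lambda>y::real^2. cut R (y - x)) = (\<lambda>y. lap_cut R (y - x))"
  by (rule ext) (simp add: laplacian_def partial_deriv_cut partial_deriv_dcut sum_d2cut)

lemma laplacian_dcut:
  "laplacian (\<lambda>y::real^2. dcut i R (y - x)) = (\<lambda>y. lap_dcut i R (y - x))"
proof
  fix y :: "real^2"
  define z where "z = y - x"
  let ?s = "z \<bullet> z / R\<^sup>2"
  have *: "partial_deriv j (partial_deriv j (\<lambda>y. dcut i R (y - x))) y =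
     4 * (i \<bullet> j) * (z \<bullet> j) / R ^ 4 * cutoff'' ?s
     + (4 * (i \<bullet> j) * (z \<bullet> j) + 4 * (z \<bullet> i) * (j \<bullet> j)) / R ^ 4 * cutoff'' ?s
     + 8 * (z \<bullet> i) * (z \<bullet> j) * (z \<bullet> j) / R ^ 6 * cutoff''' ?s" for j
    unfolding partial_deriv_dcut d2cut_def
  proof (rule partial_derivI[THEN trans])
    show "((\<lambda>y. 2 * (i \<bullet> j) / R\<^sup>2 * cutoff' ((y - x) \<bullet> (y - x) / R\<^sup>2)
     + 4 * ((y - x) \<bullet> i) * ((y - x) \<bullet> j) / R ^ 4 * cutoff'' ((y - x) \<bullet> (y - x) / R\<^sup>2)) has_derivative
     (\<lambda>v. 4 * (i \<bullet> j) * (z \<bullet> v) / R ^ 4 * cutoff'' ?s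
     + (4 * (v \<bullet> i) * (z \<bullet> j) + 4 * (z \<bullet> i) * (v \<bullet> j)) / R ^ 4 * cutoff'' ?s
     + 8 * (z \<bullet> i) * (z \<bullet> j) * (z \<bullet> v) / R ^ 6 * cutoff''' ?s)) (at y)"
    proof (cases "R = 0")
      case False
      have 1: "((\<lambda>y. (y - x) \<bullet> i) has_derivative (\<lambda>v. v \<bullet> i)) (at y)" for i
        by (auto intro!: derivative_eq_intros)
      note 2 = has_derivative_mult_right[OF has_derivative_radial[OF cutoff'_has_derivative],
          of "2 * (i \<bullet> j) / R\<^sup>2" x R y]
      note 3 = has_derivative_mult_right[OF has_derivative_mult[OF has_derivative_mult[OF 1[of i] 1[of j]]
          has_derivative_radial[OF cutoff''_has_derivative]], of "4 / R ^ 4" x R]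
      have eq: "(\<lambda>y. 2 * (i \<bullet> j) / R\<^sup>2 * cutoff' ((y - x) \<bullet> (y - x) / R\<^sup>2)
          + 4 * ((y - x) \<bullet> i) * ((y - x) \<bullet> j) / R ^ 4 * cutoff'' ((y - x) \<bullet> (y - x) / R\<^sup>2)) =
        (\<lambda>y. 2 * (i \<bullet> j) / R\<^sup>2 * cutoff' ((y - x) \<bullet> (y - x) / R\<^sup>2)
          + 4 / R ^ 4 * ((y - x) \<bullet> i * ((y - x) \<bullet> j) * cutoff'' ((y - x) \<bullet> (y - x) / R\<^sup>2)))"
        by (simp add: mult.assoc)
      show ?thesis
        unfolding eq
        by (rule has_derivative_eq_rhs[OF has_derivative_add[OF 2 3]], unfold z_def[symmetric])
          (use False in \<open>simp add: fun_eq_iff field_simps eval_nat_numeral\<close>)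
    qed simp
  qed (simp add: inner_commute)
  have "laplacian (\<lambda>y. dcut i R (y - x)) y =
     (\<Sum>j\<in>Basis. (8 / R ^ 4 * cutoff'' ?s) * ((i \<bullet> j) * (z \<bullet> j))
       + (8 * (z \<bullet> i) / R ^ 6 * cutoff''' ?s) * ((z \<bullet> j) * (z \<bullet> j)) + 4 * (z \<bullet> i) / R ^ 4 * cutoff'' ?s)"
    unfolding laplacian_def *
  proof (intro sum.cong refl)
    fix j :: "real^2" assume j: "j \<in> Basis"
    have "(8::real) = 4 + 4" by simp
    then show "4 * (i \<bullet> j) * (z \<bullet> j) / R ^ 4 * cutoff'' ?s
     + (4 * (i \<bullet> j) * (z \<bullet> j) + 4 * (z \<bullet> i) * (j \<bullet> j)) / R ^ 4 * cutoff'' ?s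
     + 8 * (z \<bullet> i) * (z \<bullet> j) * (z \<bullet> j) / R ^ 6 * cutoff''' ?s =
     (8 / R ^ 4 * cutoff'' ?s) * ((i \<bullet> j) * (z \<bullet> j))
       + (8 * (z \<bullet> i) / R ^ 6 * cutoff''' ?s) * ((z \<bullet> j) * (z \<bullet> j)) + 4 * (z \<bullet> i) / R ^ 4 * cutoff'' ?s"
      using j by (cases "R = 0") (simp_all add: field_simps)
  qed
  \<comment> \<open>The last summand is the same for each \<open>j\<close>, and the plane has two
    basis vectors: hence the factor 2, and the \<open>cutoff''\<close> terms add up to 8 +
    8.\<close>
  also have "\<dots> = (8 / R ^ 4 * cutoff'' ?s) * (i \<bullet> z) + (8 * (z \<bullet> i) / R ^ 6 * cutoff''' ?s) * (z \<bullet> z)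
       + 2 * (4 * (z \<bullet> i) / R ^ 4 * cutoff'' ?s)"
    unfolding sum.distrib sum_distrib_left[symmetric] sum_Basis_inner by simp
  also have "\<dots> = lap_dcut i R z"
    unfolding lap_dcut_def
    by (cases "R = 0") (simp_all add: inner_commute[of i z] field_simps eval_nat_numeral)
  finally show "laplacian (\<lambda>y. dcut i R (y - x)) y = lap_dcut i R (y - x)" by (simp add: z_def)
qed

lemma norm_square_quotient_ge1: "R > 0 \<Longrightarrow> norm y \<ge> R \<Longrightarrow> y \<bullet> y / R\<^sup>2 \<ge> 1"
  by (simp add: dot_square_norm abs_le_square_iff[symmetric])

lemma norm_square_quotient_le1: "R > 0 \<Longrightarrow> norm y \<le> R \<Longrightarrow> y \<bullet> y / R\<^sup>2 \<le> 1"
  by (simp add: dot_square_norm abs_le_square_iff[symmetric])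

lemma norm_square_quotient_le_quarter: "R > 0 \<Longrightarrow> 2 * norm y \<le> R \<Longrightarrow> y \<bullet> y / R\<^sup>2 \<le> 1/4"
  using power_mono[of "2 * norm y" R 2] by (simp add: dot_square_norm power_mult_distrib)

lemma
  assumes "R > 0" "norm y \<ge> R"
  shows cut_outside: "cut R y = 0" and dcut_outside: "dcut i R y = 0" and d2cut_outside: "d2cut i j R y = 0"
  using norm_square_quotient_ge1[OF assms]
  by (auto simp: cut_def dcut_def d2cut_def cutoff_0 cutoff'_zero cutoff''_zero)

lemma
  assumes "R > 0" "norm y \<ge> R"
  shows lap_cut_outside: "lap_cut R y = 0" and lap_dcut_outside: "lap_dcut i R y = 0"
    and kern_outside: "kern R y = 0" and dkern_outside: "dkern i R y = 0"
  using norm_square_quotient_ge1[OF assms]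
  by (auto simp: lap_cut_def lap_dcut_def kern_def dkern_def cutoff'_zero cutoff''_zero cutoff'''_zero)

lemma
  assumes "R > 0" "2 * norm y \<le> R"
  shows cut_inside: "cut R y = 1" and dcut_inside: "dcut i R y = 0"
  using norm_square_quotient_le_quarter[OF assms]
  by (auto simp: cut_def dcut_def cutoff_1 cutoff'_zero)

lemma
  assumes "R > 0" "2 * norm y \<le> R"
  shows kern_inside: "kern R y = 0" and lap_cut_inside: "lap_cut R y = 0"
  using norm_square_quotient_le_quarter[OF assms]
  by (auto simp: kern_def lap_cut_def cutoff'_zero cutoff''_zero)

lemma cut_bounds: "0 \<le> cut R y" "cut R y \<le> 1"
  by (simp_all add: cut_def cutoff_bounds)

lemma kern_nonneg: "R > 0 \<Longrightarrow> 0 \<le> kern R y"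
  using cutoff'_nonpos by (simp add: kern_def divide_nonpos_pos)

text \<open>Scaling dictates the powers of \<open>R\<close>: on the support
  \<open>y \<bullet> y / R\<^sup>2 \<le> 1\<close> and
  \<open>\<bar>y \<bullet> i\<bar> \<le> R\<close>, and the derivatives of \<open>cutoff\<close> are
  bounded.\<close>

lemma kernel_bounds:
  obtains B where "B > 0" "\<And>R y::real^2. R > 0 \<Longrightarrow> kern R y \<le> B / R\<^sup>2"
    "\<And>R y i::real^2. R > 0 \<Longrightarrow> i \<in> Basis \<Longrightarrow> \<bar>dkern i R y\<bar> \<le> B / R ^ 3"
    "\<And>R y i::real^2. R > 0 \<Longrightarrow> i \<in> Basis \<Longrightarrow> \<bar>dcut i R y\<bar> \<le> B / R"
    "\<And>R y. R > 0 \<Longrightarrow> \<bar>lap_cut R y\<bar> \<le> B / R\<^sup>2"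
    "\<And>R y i. R > 0 \<Longrightarrow> i \<in> Basis \<Longrightarrow> \<bar>lap_dcut i R y\<bar> \<le> B / R ^ 3"
proof -
  obtain B where B: "B > 0" "\<And>s. \<bar>cutoff' s\<bar> \<le> B" "\<And>s. \<bar>cutoff'' s\<bar> \<le> B" "\<And>s. \<bar>cutoff''' s\<bar> \<le> B"
    using cutoff_derivs_bounded by blast
  have pi1: "pi \<ge> 1" using pi_ge_two by linarith
  have s_mult: "\<bar>y \<bullet> y / R\<^sup>2 * h (y \<bullet> y / R\<^sup>2)\<bar> \<le> B"
    if "R > 0" "norm y < R" "\<And>s. \<bar>h s\<bar> \<le> B" for h and R :: real and y :: "real^2"
  proof -
    have "\<bar>y \<bullet> y / R\<^sup>2\<bar> * \<bar>h (y \<bullet> y / R\<^sup>2)\<bar> \<le> 1 * B"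
      by (intro mult_mono) (use that norm_square_quotient_le1[of R y] in auto)
    then show ?thesis by (simp add: abs_mult)
  qed
  have inner_R: "\<bar>y \<bullet> i\<bar> \<le> R" if "norm y < R" "i \<in> Basis" for R and y i :: "real^2"
    using Basis_le_norm[OF that(2), of y] that by linarith
  show thesis
  \<comment> \<open>The largest constant is that of \<open>lap_dcut\<close>: 8 * (1 + 2) =
    24.\<close>
  proof (rule that[of "24 * B"])
    show "24 * B > 0" using B by simp
    fix R :: real and y :: "real^2" assume R: "R > 0"
    have "kern R y \<le> B / (pi * R\<^sup>2)"
      unfolding kern_def using B(2)[of "y \<bullet> y / R\<^sup>2"] R by (intro divide_right_mono) auto
    also have "\<dots> \<le> 24 * B / R\<^sup>2"
      using R B pi1 by (intro frac_le) auto
    finally show "kern R y \<le> 24 * B / R\<^sup>2" .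
    show "\<bar>lap_cut R y\<bar> \<le> 24 * B / R\<^sup>2"
    proof (cases "norm y < R")
      case True
      have "\<bar>y \<bullet> y / R\<^sup>2 * cutoff'' (y \<bullet> y / R\<^sup>2) + cutoff' (y \<bullet> y / R\<^sup>2)\<bar> \<le> B + B"
        by (rule order_trans[OF abs_triangle_ineq add_mono[OF s_mult[OF R True B(3)] B(2)]])
      then have "\<bar>lap_cut R y\<bar> \<le> 4 / R\<^sup>2 * (B + B)"
        unfolding lap_cut_def abs_mult by (intro mult_mono) auto
      also have "\<dots> \<le> 24 * B / R\<^sup>2" using B R by (simp add: field_simps)
      finally show ?thesis .
    qed (use lap_cut_outside[OF R, of y] R B in auto)
    fix i :: "real^2" assume i: "i \<in> Basis"
    show "\<bar>dkern i R y\<bar> \<le> 24 * B / R ^ 3"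
    proof (cases "norm y < R")
      case True
      have "\<bar>dkern i R y\<bar> = 2 * \<bar>y \<bullet> i\<bar> * \<bar>cutoff'' (y \<bullet> y / R\<^sup>2)\<bar> / (pi * R ^ 4)"
        using R by (simp add: dkern_def abs_mult)
      also have "\<dots> \<le> 2 * R * B / (1 * R ^ 4)"
        using R B inner_R[OF True i] pi1
        by (intro frac_le mult_mono mult_right_mono) (auto intro: mult_nonneg_nonneg)
      also have "\<dots> \<le> 24 * B / R ^ 3" using B R by (simp add: field_simps eval_nat_numeral)
      finally show ?thesis .
    qed (use dkern_outside[OF R, of y i] R B in auto)
    show "\<bar>dcut i R y\<bar> \<le> 24 * B / R"
    proof (cases "norm y < R")
      case True
      have "\<bar>dcut i R y\<bar> = 2 * \<bar>y \<bullet> i\<bar> * \<bar>cutoff' (y \<bullet> y / R\<^sup>2)\<bar> / R\<^sup>2"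
        using R by (simp add: dcut_def abs_mult)
      also have "\<dots> \<le> 2 * R * B / R\<^sup>2"
        using R B inner_R[OF True i] by (intro frac_le mult_mono mult_right_mono) auto
      also have "\<dots> \<le> 24 * B / R" using B R by (simp add: field_simps eval_nat_numeral)
      finally show ?thesis .
    qed (use dcut_outside[OF R, of y i] R B in auto)
    show "\<bar>lap_dcut i R y\<bar> \<le> 24 * B / R ^ 3"
    proof (cases "norm y < R")
      case True
      have "\<bar>2 * cutoff'' (y \<bullet> y / R\<^sup>2)\<bar> \<le> 2 * B" using B(3)[of "y \<bullet> y / R\<^sup>2"] by (simp add: abs_mult)
      then have *: "\<bar>y \<bullet> y / R\<^sup>2 * cutoff''' (y \<bullet> y / R\<^sup>2) + 2 * cutoff'' (y \<bullet> y / R\<^sup>2)\<bar> \<le> B + 2 * B"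
        by (rule order_trans[OF abs_triangle_ineq add_mono[OF s_mult[OF R True B(4)]]])
      have "\<bar>lap_dcut i R y\<bar> = 8 * \<bar>y \<bullet> i\<bar> / R ^ 4 *
          \<bar>y \<bullet> y / R\<^sup>2 * cutoff''' (y \<bullet> y / R\<^sup>2) + 2 * cutoff'' (y \<bullet> y / R\<^sup>2)\<bar>"
        using R by (simp add: lap_dcut_def abs_mult)
      also have "\<dots> \<le> 8 * R / R ^ 4 * (B + 2 * B)"
        using R B inner_R[OF True i] by (intro mult_mono divide_right_mono *) auto
      also have "\<dots> \<le> 24 * B / R ^ 3" using B R by (simp add: field_simps eval_nat_numeral)
      finally show ?thesis .
    qed (use lap_dcut_outside[OF R, of y i] R B in auto)
  qed
qed

lemmas continuous_on_cutoffs =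
  continuous_on_compose2[OF continuous_cutoff _ subset_UNIV]
  continuous_on_compose2[OF continuous_cutoff' _ subset_UNIV]
  continuous_on_compose2[OF continuous_cutoff'' _ subset_UNIV]
  continuous_on_compose2[OF continuous_cutoff''' _ subset_UNIV]

lemma continuous_cut: "continuous_on S (cut R)"
  unfolding cut_def[abs_def] divide_inverse by (intro continuous_intros continuous_on_cutoffs)

lemma continuous_dcut: "continuous_on S (dcut i R)"
  unfolding dcut_def[abs_def] divide_inverse by (intro continuous_intros continuous_on_cutoffs)

lemma continuous_d2cut: "continuous_on S (d2cut i j R)"
  unfolding d2cut_def[abs_def] divide_inverse by (intro continuous_intros continuous_on_cutoffs)

lemma continuous_lap_cut: "continuous_on S (lap_cut R)"
  unfolding lap_cut_def[abs_def] divide_inverse by (intro continuous_intros continuous_on_cutoffs)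

lemma continuous_lap_dcut: "continuous_on S (lap_dcut i R)"
  unfolding lap_dcut_def[abs_def] divide_inverse by (intro continuous_intros continuous_on_cutoffs)

lemma continuous_kern: "continuous_on S (kern R)"
  unfolding kern_def[abs_def] divide_inverse by (intro continuous_intros continuous_on_cutoffs)

lemma continuous_dkern: "continuous_on S (dkern i R)"
  unfolding dkern_def[abs_def] divide_inverse by (intro continuous_intros continuous_on_cutoffs)

lemma cut_test_function:
  fixes x :: "'a::euclidean_space"
  assumes "R > 0" "cball x R \<subseteq> \<Omega>"
  shows "(\<lambda>y. cut R (y - x)) \<in> test_functions \<Omega>"
    and "i \<in> Basis \<Longrightarrow> (\<lambda>y. dcut i R (y - x)) \<in> test_functions \<Omega>"
proof -
  have Ck1: "Ck k (\<lambda>y. h ((y - x) \<bullet> (y - x) / R\<^sup>2))" if "Ck k h" for k h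
    using Ck_compose[OF that Ck_mult[OF Ck_const[of k "inverse (R\<^sup>2)"] Ck_norm_square]]
    by (simp add: field_simps)
  have supp: "compact (closure {y. \<phi> y \<noteq> 0}) \<and> closure {y. \<phi> y \<noteq> 0} \<subseteq> \<Omega>"
    if "\<And>y. norm (y - x) \<ge> R \<Longrightarrow> \<phi> y = 0" for \<phi> :: "'a \<Rightarrow> real"
  proof -
    have sub: "{y. \<phi> y \<noteq> 0} \<subseteq> cball x R"
    proof
      fix y assume "y \<in> {y. \<phi> y \<noteq> 0}"
      then have "\<not> R \<le> norm (y - x)" using that[of y] by blast
      then show "y \<in> cball x R" by (simp add: dist_norm norm_minus_commute)
    qed
    then have "closure {y. \<phi> y \<noteq> 0} \<subseteq> \<Omega>"
      using closure_minimal[OF sub closed_cball] assms(2) by blast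
    then show ?thesis
      using bounded_subset[OF bounded_cball sub] by simp
  qed
  show "(\<lambda>y. cut R (y - x)) \<in> test_functions \<Omega>"
    using supp[of "\<lambda>y. cut R (y - x)"] cut_outside[OF assms(1)] Ck1[OF Ck_cutoff]
    by (auto simp: test_functions_def cut_def)
  have Ck2: "Ck k (\<lambda>y. ((2 / R\<^sup>2) * (y \<bullet> i - x \<bullet> i)) * cutoff' ((y - x) \<bullet> (y - x) / R\<^sup>2))" for k i
    by (intro Ck_mult Ck_const Ck_diff Ck_inner Ck1 Ck_cutoff')
  have eq: "(\<lambda>y. dcut i R (y - x)) = (\<lambda>y. ((2 / R\<^sup>2) * (y \<bullet> i - x \<bullet> i)) * cutoff' ((y - x) \<bullet> (y - x) / R\<^sup>2))"
    by (simp add: dcut_def inner_diff_left)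
  have "\<forall>k. Ck k (\<lambda>y. dcut i R (y - x))"
    unfolding eq using Ck2 by blast
  moreover have "compact (closure {y. dcut i R (y - x) \<noteq> 0}) \<and> closure {y. dcut i R (y - x) \<noteq> 0} \<subseteq> \<Omega>"
    by (rule supp) (rule dcut_outside[OF assms(1)])
  ultimately show "(\<lambda>y. dcut i R (y - x)) \<in> test_functions \<Omega>" if "i \<in> Basis"
    unfolding test_functions_def by blast
qed

text \<open>The key identity. With \<open>s = y \<bullet> y / R\<^sup>2\<close> one has ds/dR = -2 s
  / R, so differentiating \<open>- cutoff' s / (pi * R\<^sup>2)\<close> gives
  \<open>2 * (s * cutoff'' s + cutoff' s) / (pi * R ^ 3)\<close>, which is the planar Laplacian of
  \<open>cut R\<close> divided by \<open>2 * pi * R\<close>.\<close>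

lemma kern_has_derivative:
  assumes "R > 0"
  shows "((\<lambda>R. kern R y) has_real_derivative lap_cut R y / (2 * pi * R)) (at R)"
  unfolding kern_def[abs_def] lap_cut_def
  using assms
  by (auto intro!: derivative_eq_intros DERIV_chain'[where g=cutoff'] cutoff'_has_derivative
      simp: field_simps eval_nat_numeral)

lemma dkern_has_derivative:
  assumes "R > 0"
  shows "((\<lambda>R. dkern i R y) has_real_derivative lap_dcut i R y / (2 * pi * R)) (at R)"
  unfolding dkern_def[abs_def] lap_dcut_def
  using assms
  by (auto intro!: derivative_eq_intros DERIV_chain'[where g=cutoff''] cutoff''_has_derivative
      simp: field_simps eval_nat_numeral)

lemma kern_has_derivative_space:
  "((\<lambda>y. kern R (y - x)) has_derivative (\<lambda>v. dkern v R (y - x))) (at y)"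
proof -
  have "((\<lambda>y. (-1 / (pi * R\<^sup>2)) * cutoff' ((y - x) \<bullet> (y - x) / R\<^sup>2)) has_derivative
    (\<lambda>v. (-1 / (pi * R\<^sup>2)) * (2 * ((y - x) \<bullet> v) / R\<^sup>2 * cutoff'' ((y - x) \<bullet> (y - x) / R\<^sup>2)))) (at y)"
    by (intro has_derivative_mult_right has_derivative_radial cutoff'_has_derivative)
  then show ?thesis by (simp add: kern_def dkern_def field_simps eval_nat_numeral)
qed

section \<open>Integration in the plane\<close>

lemma integrable_mult_bounded:
  fixes f g :: "'a \<Rightarrow> real"
  assumes "integrable M f" "g \<in> borel_measurable M" "\<And>x. \<bar>g x\<bar> \<le> B"
  shows "integrable M (\<lambda>x. f x * g x)"
proof (rule Bochner_Integration.integrable_bound)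
  show "integrable M (\<lambda>x. B * \<bar>f x\<bar>)" using assms(1) by auto
  have "\<bar>f x\<bar> * \<bar>g x\<bar> \<le> \<bar>f x\<bar> * \<bar>B\<bar>" for x
    using assms(3)[of x] by (intro mult_left_mono) auto
  then show "AE x in M. norm (f x * g x) \<le> norm (B * \<bar>f x\<bar>)"
    by (auto simp: abs_mult mult_ac)
qed (use assms in auto)

text \<open>The parameter space is first countable, so the limit may be tested along sequences,
  where dominated convergence applies.\<close>

lemma integral_tendsto_at_within:
  fixes s :: "'p::first_countable_topology \<Rightarrow> 'a \<Rightarrow> real"
  assumes "\<And>t. s t \<in> borel_measurable M" "f \<in> borel_measurable M" "integrable M w"
    and lim: "AE x in M. ((\<lambda>t. s t x) \<longlongrightarrow> f x) (at a within S)"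
    and bound: "\<And>t x. t \<in> S \<Longrightarrow> t \<noteq> a \<Longrightarrow> \<bar>s t x\<bar> \<le> w x"
  shows "((\<lambda>t. integral\<^sup>L M (s t)) \<longlongrightarrow> integral\<^sup>L M f) (at a within S)"
  unfolding tendsto_at_iff_sequentially comp_def
proof (intro allI impI)
  fix X assume X: "\<forall>i. X i \<in> S - {a}" "X \<longlonglongrightarrow> a"
  have X': "filterlim X (at a within S) sequentially"
    using X by (auto simp: filterlim_at)
  show "(\<lambda>n. integral\<^sup>L M (s (X n))) \<longlonglongrightarrow> integral\<^sup>L M f"
  proof (rule integral_dominated_convergence[where w=w])
    show "AE x in M. (\<lambda>n. s (X n) x) \<longlonglongrightarrow> f x"
      using lim by eventually_elim (rule filterlim_compose[OF _ X'])
  qed (use assms X in auto)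
qed

text \<open>Differentiation under the integral sign: the bound on \<open>k'\<close> makes
  \<open>k\<close> Lipschitz in the parameter, so the difference quotients are dominated by
  \<open>B\<close> times the modulus of \<open>U\<close>.\<close>

lemma has_derivative_integral:
  fixes U :: "'a::euclidean_space \<Rightarrow> real" and k k' :: "real \<Rightarrow> 'a \<Rightarrow> real"
  assumes U: "integrable lborel U" and t: "a < t"
    and meas: "\<And>s. k s \<in> borel_measurable borel" "k' t \<in> borel_measurable borel"
    and deriv: "\<And>s y. a < s \<Longrightarrow> ((\<lambda>s. k s y) has_real_derivative k' s y) (at s)"
    and bound: "\<And>s y. a < s \<Longrightarrow> \<bar>k s y\<bar> \<le> B" "\<And>s y. a < s \<Longrightarrow> \<bar>k' s y\<bar> \<le> B"
  shows "((\<lambda>s. LBINT y. U y * k s y) has_real_derivative (LBINT y. U y * k' t y)) (at t)"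
proof -
  have int: "integrable lborel (\<lambda>y. U y * k s y)" if "a < s" for s
    using integrable_mult_bounded[OF U, of "k s" B] meas bound that by auto
  have "((\<lambda>s. LBINT y. U y * ((k s y - k t y) / (s - t))) \<longlongrightarrow> (LBINT y. U y * k' t y))
      (at t within {a<..})"
  proof (rule integral_tendsto_at_within[where w="\<lambda>y. \<bar>U y\<bar> * B"])
    show "(\<lambda>y. U y * ((k s y - k t y) / (s - t))) \<in> borel_measurable lborel" for s
      using U meas(1)[measurable] by measurable
    show "(\<lambda>y. U y * k' t y) \<in> borel_measurable lborel"
      using U meas(2) by measurable
    show "integrable lborel (\<lambda>y. \<bar>U y\<bar> * B)" using U by auto
    have "((\<lambda>s. U y * ((k s y - k t y) / (s - t))) \<longlongrightarrow> U y * k' t y) (at t within {a<..})" for y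
      by (rule tendsto_mult_left) (use DERIV_subset[OF deriv[OF t, of y], of "{a<..}"] in \<open>auto simp: has_field_derivative_iff\<close>)
    then show "AE y in lborel. ((\<lambda>s. U y * ((k s y - k t y) / (s - t))) \<longlongrightarrow> U y * k' t y) (at t within {a<..})"
      by simp
    fix s y assume s: "s \<in> {a<..}" "s \<noteq> t"
    have "norm (k s y - k t y) \<le> B * norm (s - t)"
      by (rule field_differentiable_bound[of "{a<..}" "\<lambda>s. k s y" "\<lambda>s. k' s y"])
        (use s t deriv bound in \<open>auto intro: DERIV_subset\<close>)
    then have "\<bar>(k s y - k t y) / (s - t)\<bar> \<le> B"
      using s by (simp add: divide_le_eq)
    then show "\<bar>U y * ((k s y - k t y) / (s - t))\<bar> \<le> \<bar>U y\<bar> * B"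
      unfolding abs_mult by (intro mult_left_mono) auto
  qed
  then have "((\<lambda>s. ((LBINT y. U y * k s y) - (LBINT y. U y * k t y)) / (s - t)) \<longlongrightarrow>
      (LBINT y. U y * k' t y)) (at t within {a<..})"
  proof (rule Lim_transform_eventually)
    show "\<forall>\<^sub>F s in at t within {a<..}. (LBINT y. U y * ((k s y - k t y) / (s - t))) =
        ((LBINT y. U y * k s y) - (LBINT y. U y * k t y)) / (s - t)"
      unfolding eventually_at_filter
      by (rule always_eventually) (auto simp: right_diff_distrib int t
          simp flip: Bochner_Integration.integral_diff)
  qed
  then show ?thesis
    using t at_within_open[of t "{a<..}"] by (simp add: has_field_derivative_iff)
qed

section \<open>Integration by parts and radial integration\<close>

lemma integrable_compact_support:
  fixes F :: "'a::euclidean_space \<Rightarrow> real"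
  assumes "continuous_on UNIV F" "compact K" "\<And>x. x \<notin> K \<Longrightarrow> F x = 0"
  shows "integrable lborel F"
proof -
  have "integrable lborel (\<lambda>x. indicator K x *\<^sub>R F x)"
    by (rule borel_integrable_compact[OF assms(2) continuous_on_subset[OF assms(1)]]) auto
  also have "(\<lambda>x. indicator K x *\<^sub>R F x) = F"
    using assms(3) by (intro ext) (simp split: split_indicator)
  finally show ?thesis .
qed

lemma integral_lborel_translate:
  fixes F :: "'a::euclidean_space \<Rightarrow> real"
  assumes "F \<in> borel_measurable borel"
  shows "(LBINT x. F (c + x)) = integral\<^sup>L lborel F"
  using integral_distr[of "(+) c" lborel borel F] assms by (simp add: lborel_distr_plus)

text \<open>By translation invariance of Lebesgue measure every difference quotient of
  \<open>F\<close> in direction \<open>v\<close> has integral 0, and the quotients converge to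
  \<open>G\<close> under a common majorant. This stands in for the divergence theorem.\<close>

lemma integral_derivative_compact_support:
  fixes F G :: "'a::euclidean_space \<Rightarrow> real"
  assumes K: "compact K" "K \<subseteq> S" and S: "open S"
    and deriv: "\<And>x. x \<in> S \<Longrightarrow> (F has_derivative F' x) (at x)"
    and G: "\<And>x. x \<in> S \<Longrightarrow> F' x v = G x" "continuous_on S G"
    and zero: "\<And>x. x \<notin> K \<Longrightarrow> F x = 0" "\<And>x. x \<notin> K \<Longrightarrow> G x = 0"
  shows "integral\<^sup>L lborel G = 0"
proof -
  have cover: "S \<union> - K = UNIV" using K(2) by auto
  have K': "open (- K)" using K(1) compact_imp_closed by auto
  have cG: "continuous_on UNIV G"
    unfolding cover[symmetric]
    by (rule continuous_on_open_Un[OF S K' G(2)]) (rule continuous_on_eq[OF continuous_on_const[of _ 0]], simp add: zero(2))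
  define D where "D x = (if x \<in> S then F' x else (\<lambda>_. 0))" for x
  have D: "(F has_derivative D x) (at x)" for x
  proof (cases "x \<in> S")
    case False
    then have "x \<in> - K" using K by auto
    have "(F has_derivative (\<lambda>_. 0)) (at x)"
      by (rule has_derivative_transform_within_open[of "\<lambda>_. 0" _ _ _ "- K"])
        (use \<open>x \<in> - K\<close> K' zero in auto)
    then show ?thesis using False by (simp add: D_def)
  qed (simp add: D_def deriv)
  have DG: "D x v = G x" for x
    using G(1) zero(2) K(2) by (auto simp: D_def)
  have cF: "continuous_on UNIV F"
    by (intro continuous_at_imp_continuous_on ballI has_derivative_continuous[OF D])
  have Fb: "F \<in> borel_measurable borel"
    using cF by (rule borel_measurable_continuous_onI)
  have Gb: "G \<in> borel_measurable borel"
    using cG by (rule borel_measurable_continuous_onI)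
  have intF: "integrable lborel F"
    using integrable_compact_support[OF cF K(1) zero(1)] .
  have intFt: "integrable lborel (\<lambda>x. F (c + x))" for c
    using integrable_distr_eq[of "(+) c" lborel borel F] Fb intF by (simp add: lborel_distr_plus)
  obtain r where "\<forall>x\<in>K. norm x \<le> r"
    using compact_imp_bounded[OF K(1)] unfolding bounded_iff by blast
  then have r: "K \<subseteq> cball 0 r" by auto
  have "bounded (G ` cball 0 (r + 2 * norm v))"
    by (intro compact_imp_bounded compact_continuous_image continuous_on_subset[OF cG]) auto
  then obtain M where "\<forall>x\<in>cball 0 (r + 2 * norm v). \<bar>G x\<bar> \<le> M"
    unfolding bounded_real by blast
  then have M: "\<bar>G x\<bar> \<le> M" if "norm x \<le> r + 2 * norm v" for x
    using that by simp
  have line: "((\<lambda>t. F (t *\<^sub>R v + x)) has_derivative (\<lambda>h. D (s *\<^sub>R v + x) (h *\<^sub>R v))) (at s within T)" for x s T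
  proof -
    have "((\<lambda>t. t *\<^sub>R v + x) has_derivative (\<lambda>h. h *\<^sub>R v)) (at s within T)"
      by (auto intro!: derivative_eq_intros)
    from has_derivative_compose[OF this D] show ?thesis .
  qed
  have "((\<lambda>t. LBINT x. (F (t *\<^sub>R v + x) - F x) / t) \<longlongrightarrow> integral\<^sup>L lborel G) (at 0 within {0<..<1})"
  \<comment> \<open>For \<open>0 < t < 1\<close> the translated support of \<open>F\<close> stays
    within radius \<open>r + norm v\<close>; the mean value point is displaced by up to another
    \<open>norm v\<close>, hence the larger radius in the bound \<open>M\<close>.\<close>
  proof (rule integral_tendsto_at_within[where w="\<lambda>x. \<bar>M\<bar> * indicator (cball 0 (r + norm v)) x"])
    show "(\<lambda>x. (F (t *\<^sub>R v + x) - F x) / t) \<in> borel_measurable lborel" for t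
      using Fb by measurable
    show "integrable lborel (\<lambda>x. \<bar>M\<bar> * indicator (cball 0 (r + norm v)) x)"
      by (intro integrable_mult_right integrable_real_indicator emeasure_lborel_cball_finite) auto
    have "((\<lambda>t. (F (t *\<^sub>R v + x) - F x) / t) \<longlongrightarrow> G x) (at 0)" for x
    proof -
      have "((\<lambda>t. F (t *\<^sub>R v + x)) has_derivative (\<lambda>h. D x (h *\<^sub>R v))) (at 0)"
        using line[of x 0 UNIV] by simp
      moreover have "D x (h *\<^sub>R v) = G x * h" for h
        using linear_scale[OF has_derivative_linear[OF D], of x h v] DG by simp
      ultimately have "((\<lambda>t. F (t *\<^sub>R v + x)) has_real_derivative G x) (at 0)"
        by (simp add: has_field_derivative_def)
      then show ?thesis by (simp add: DERIV_def)
    qed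
    then show "AE x in lborel. ((\<lambda>t. (F (t *\<^sub>R v + x) - F x) / t) \<longlongrightarrow> G x) (at 0 within {0<..<1})"
      by (auto intro: tendsto_within_subset)
    fix t :: real and x :: 'a assume t: "t \<in> {0<..<1}" "t \<noteq> 0"
    have tv: "norm (s *\<^sub>R v) \<le> norm v" if "0 \<le> s" "s \<le> t" for s
    proof -
      have "s * norm v \<le> 1 * norm v" using that t by (intro mult_right_mono) auto
      then show ?thesis using that by simp
    qed
    show "\<bar>(F (t *\<^sub>R v + x) - F x) / t\<bar> \<le> \<bar>M\<bar> * indicator (cball 0 (r + norm v)) x"
    proof (cases "norm x \<le> r + norm v")
      case True
      have "\<exists>s\<in>{0<..<t}. F (t *\<^sub>R v + x) - F (0 *\<^sub>R v + x) = D (s *\<^sub>R v + x) ((t - 0) *\<^sub>R v)"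
        by (rule mvt_simple[of 0 t "\<lambda>t. F (t *\<^sub>R v + x)" "\<lambda>s h. D (s *\<^sub>R v + x) (h *\<^sub>R v)"])
          (use t line in auto)
      then obtain s where s: "s \<in> {0<..<t}" "F (t *\<^sub>R v + x) - F x = D (s *\<^sub>R v + x) (t *\<^sub>R v)" by auto
      then have "(F (t *\<^sub>R v + x) - F x) / t = G (s *\<^sub>R v + x)"
        using linear_scale[OF has_derivative_linear[OF D], of _ t v] DG t by simp
      moreover have "\<bar>G (s *\<^sub>R v + x)\<bar> \<le> M"
        using True tv[of s] s norm_triangle_ineq[of "s *\<^sub>R v" x] by (intro M) auto
      ultimately show ?thesis using True by auto
    next
      case False
      have "norm (t *\<^sub>R v + x) > r"
        using False tv[of t] t norm_triangle_ineq4[of "t *\<^sub>R v + x" "t *\<^sub>R v"] by auto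
      moreover have "norm x > r" using False norm_ge_zero[of v] by linarith
      ultimately have "t *\<^sub>R v + x \<notin> K" "x \<notin> K"
        using r by auto
      then have "F (t *\<^sub>R v + x) = 0" "F x = 0"
        using zero(1) by blast+
      then show ?thesis by simp
    qed
  qed (use Gb in auto)
  moreover have "(LBINT x. (F (t *\<^sub>R v + x) - F x) / t) = 0" for t
    using intF intFt[of "t *\<^sub>R v"] integral_lborel_translate[OF Fb, of "t *\<^sub>R v"] by simp
  ultimately have "((\<lambda>t::real. 0) \<longlongrightarrow> integral\<^sup>L lborel G) (at 0 within {0<..<1})"
    by (simp only:)
  moreover have "at (0::real) within {0<..<1} \<noteq> bot"
    by (simp add: trivial_limit_within islimpt_greaterThanLessThan1)
  ultimately show ?thesis
    using tendsto_unique tendsto_const by metis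
qed

text \<open>Polar coordinates with the angle integrated out: a disc of squared radius
  \<open>a\<close> has area \<open>pi * a\<close>, and half-lines generate the Borel sets of the
  line.\<close>

lemma distr_norm_square:
  "distr lborel borel (\<lambda>y::real^2. y \<bullet> y) = density lborel (\<lambda>s. ennreal pi * indicator {0<..} s)"
  (is "?M = ?N")
proof -
  have M: "emeasure ?M {..a} = ennreal (pi * max a 0)" for a
  proof -
    have "emeasure ?M {..a} = emeasure lborel {y::real^2. y \<bullet> y \<le> a}"
      by (subst emeasure_distr) (auto simp: vimage_def)
    also have "\<dots> = ennreal (pi * max a 0)"
    proof (cases "a \<ge> 0")
      case True
      have "{y::real^2. y \<bullet> y \<le> a} = cball 0 (sqrt a)"
        by (auto simp: norm_eq_sqrt_inner)
      then show ?thesis using True by (simp add: emeasure_cball unit_ball_vol_2 mult.commute)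
    next
      case False
      have "y \<bullet> y > a" for y :: "real^2"
        using False inner_ge_zero[of y] by linarith
      then have "{y::real^2. y \<bullet> y \<le> a} = {}"
        by (simp add: not_le)
      then show ?thesis using False by (simp add: max_def)
    qed
    finally show ?thesis .
  qed
  have N: "emeasure ?N {..a} = ennreal (pi * max a 0)" for a
  proof -
    have "emeasure ?N {..a} = (\<integral>\<^sup>+s. ennreal pi * indicator {0<..a} s \<partial>lborel)"
      by (subst emeasure_density) (auto simp: indicator_def intro!: nn_integral_cong)
    also have "\<dots> = ennreal (pi * max a 0)"
      by (cases "a \<ge> 0") (simp_all add: nn_integral_cmult ennreal_mult)
    finally show ?thesis .
  qed
  have borel: "sets (borel :: real measure) = sigma_sets UNIV (range (\<lambda>a::real. {..a}))"
    unfolding borel_eq_atMost by (simp add: sets_measure_of)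
  show ?thesis
  proof (rule measure_eqI_generator_eq[where E="range (\<lambda>a::real. {..a})" and \<Omega>=UNIV and A="\<lambda>n. {..real n}"])
    show "Int_stable (range (\<lambda>a::real. {..a}))"
      unfolding Int_stable_def by auto
    show "emeasure ?M X = emeasure ?N X" if "X \<in> range (\<lambda>a::real. {..a})" for X
      using that M N by auto
    show "emeasure ?M {..real n} \<noteq> \<infinity>" for n
      unfolding M by simp
    show "(\<Union>n. {..real n}) = UNIV"
      using real_arch_simple by auto
    show "sets ?M = sigma_sets UNIV (range (\<lambda>a::real. {..a}))"
      "sets ?N = sigma_sets UNIV (range (\<lambda>a::real. {..a}))"
      using borel by simp_all
  qed auto
qed

lemma nn_integral_radial:
  fixes h :: "real \<Rightarrow> ennreal"
  assumes [measurable]: "h \<in> borel_measurable borel"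
  shows "(\<integral>\<^sup>+y. h ((y::real^2) \<bullet> y) \<partial>lborel) = ennreal pi * (\<integral>\<^sup>+s. h s * indicator {0<..} s \<partial>lborel)"
proof -
  have "(\<integral>\<^sup>+y. h ((y::real^2) \<bullet> y) \<partial>lborel) = (\<integral>\<^sup>+s. h s \<partial>distr lborel borel (\<lambda>y::real^2. y \<bullet> y))"
    by (subst nn_integral_distr) auto
  also have "\<dots> = (\<integral>\<^sup>+s. ennreal pi * (h s * indicator {0<..} s) \<partial>lborel)"
    unfolding distr_norm_square by (subst nn_integral_density) (auto simp: mult_ac)
  also have "\<dots> = ennreal pi * (\<integral>\<^sup>+s. h s * indicator {0<..} s \<partial>lborel)"
    by (rule nn_integral_cmult) auto
  finally show ?thesis .
qed

lemma nn_integral_lborel_translate: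
  fixes F :: "'a::euclidean_space \<Rightarrow> ennreal"
  assumes "F \<in> borel_measurable borel"
  shows "(\<integral>\<^sup>+x. F (x - c) \<partial>lborel) = integral\<^sup>N lborel F"
  using nn_integral_distr[of "(+) (- c)" lborel borel F] assms by (simp add: lborel_distr_plus)

lemma measurable_kernels [measurable]:
  "kern R \<in> borel_measurable borel" "dkern i R \<in> borel_measurable borel"
  "lap_cut R \<in> borel_measurable borel" "lap_dcut i R \<in> borel_measurable borel"
  "cut R \<in> borel_measurable borel" "dcut j R \<in> borel_measurable borel"
  by (rule borel_measurable_continuous_onI, rule continuous_kern continuous_dkern continuous_lap_cut
      continuous_lap_dcut continuous_cut continuous_dcut)+

text \<open>By \<open>nn_integral_radial\<close> this is the integral of \<open>- cutoff'\<close>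
  over the half-line, which the fundamental theorem evaluates as \<open>cutoff 0\<close> minus the
  limit 0 at infinity.\<close>

lemma nn_integral_kern:
  assumes "R > 0"
  shows "(\<integral>\<^sup>+y. ennreal (kern R (y - x)) \<partial>lborel) = 1"
proof -
  let ?h = "\<lambda>s. - cutoff' (s / R\<^sup>2) / (pi * R\<^sup>2)"
  have meas: "?h \<in> borel_measurable borel"
    by (rule borel_measurable_continuous_onI) (use assms in \<open>auto intro!: continuous_intros continuous_on_cutoffs\<close>)
  have "(\<integral>\<^sup>+y. ennreal (kern R (y - x)) \<partial>lborel) = (\<integral>\<^sup>+y. ennreal (kern R y) \<partial>lborel)"
    by (rule nn_integral_lborel_translate) measurable
  also have "\<dots> = ennreal pi * (\<integral>\<^sup>+s. ennreal (?h s) * indicator {0<..} s \<partial>lborel)"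
    unfolding kern_def by (rule nn_integral_radial) (use meas in measurable)
  also have "(\<integral>\<^sup>+s. ennreal (?h s) * indicator {0<..} s \<partial>lborel) =
      (\<integral>\<^sup>+s. ennreal (?h s) * indicator {0..} s \<partial>lborel)"
    by (intro nn_integral_cong) (auto simp: indicator_def cutoff'_zero)
  also have "\<dots> = ennreal (0 - (- cutoff (0 / R\<^sup>2) / pi))"
  proof (rule nn_integral_FTC_atLeast[where F="\<lambda>s. - cutoff (s / R\<^sup>2) / pi"])
    show "((\<lambda>s. - cutoff (s / R\<^sup>2) / pi) has_real_derivative ?h s) (at s)" for s
      using assms by (auto intro!: derivative_eq_intros DERIV_chain'[where g=cutoff] cutoff_has_derivative
          simp: field_simps)
    have "eventually (\<lambda>s. - cutoff (s / R\<^sup>2) / pi = 0) at_top"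
      using eventually_ge_at_top[of "R\<^sup>2"] by eventually_elim (use assms in \<open>simp add: cutoff_0\<close>)
    then show "((\<lambda>s. - cutoff (s / R\<^sup>2) / pi) \<longlongrightarrow> 0) at_top"
      by (rule tendsto_eventually)
  qed (use meas cutoff'_nonpos in \<open>auto simp: divide_nonpos_nonneg\<close>)
  also have "ennreal pi * \<dots> = 1"
    by (simp add: cutoff_1 flip: ennreal_mult)
  finally show ?thesis .
qed

lemma integral_kern:
  assumes "R > 0"
  shows "integrable lborel (\<lambda>y. kern R (y - x))" "(LBINT y. kern R (y - x)) = 1"
proof -
  show "integrable lborel (\<lambda>y. kern R (y - x))"
    by (rule integrableI_nn_integral_finite[where x=1]) (use assms nn_integral_kern kern_nonneg in auto)
  show "(LBINT y. kern R (y - x)) = 1"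
    by (subst integral_eq_nn_integral) (use assms nn_integral_kern kern_nonneg in auto)
qed

section \<open>Smoothed circular averages\<close>

text \<open>Both \<open>h - f\<close> and \<open>h + f\<close> are nondecreasing. This turns a bound
  on the radial derivative of an average into a bound on its increment, with an explicit primitive
  \<open>h\<close> in place of an integral.\<close>

lemma increment_le:
  fixes f h :: "real \<Rightarrow> real"
  assumes "a \<le> b" and "\<And>t. a \<le> t \<Longrightarrow> t \<le> b \<Longrightarrow> (f has_real_derivative f' t) (at t)"
    and "\<And>t. a \<le> t \<Longrightarrow> t \<le> b \<Longrightarrow> (h has_real_derivative h' t) (at t)"
    and "\<And>t. a \<le> t \<Longrightarrow> t \<le> b \<Longrightarrow> \<bar>f' t\<bar> \<le> h' t"
  shows "\<bar>f b - f a\<bar> \<le> h b - h a"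
proof -
  have "(\<lambda>t. h t - f t) a \<le> (\<lambda>t. h t - f t) b"
  proof (rule DERIV_nonneg_imp_nondecreasing[OF assms(1)])
    fix t assume "a \<le> t" "t \<le> b"
    then show "\<exists>y. ((\<lambda>t. h t - f t) has_real_derivative y) (at t) \<and> 0 \<le> y"
      using assms(2-4)[of t] by (intro exI[of _ "h' t - f' t"]) (auto intro!: derivative_eq_intros)
  qed
  moreover have "(\<lambda>t. h t + f t) a \<le> (\<lambda>t. h t + f t) b"
  proof (rule DERIV_nonneg_imp_nondecreasing[OF assms(1)])
    fix t assume "a \<le> t" "t \<le> b"
    then show "\<exists>y. ((\<lambda>t. h t + f t) has_real_derivative y) (at t) \<and> 0 \<le> y"
      using assms(2-4)[of t] by (intro exI[of _ "h' t + f' t"]) (auto intro!: derivative_eq_intros)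
  qed
  ultimately show ?thesis by simp
qed

section \<open>Powers of the norm on discs\<close>

lemma nn_integral_norm_powr_ball_0:
  assumes "R > 0" "\<beta> < 2"
  shows "(\<integral>\<^sup>+y. ennreal (norm (y::real^2) powr (-\<beta>)) * indicator (ball 0 R) y \<partial>lborel) =
    ennreal (2 * pi / (2 - \<beta>) * R powr (2 - \<beta>))"
proof -
  let ?h = "\<lambda>s::real. ennreal (s powr (-\<beta>/2)) * indicator {..<R\<^sup>2} s"
  have "(\<integral>\<^sup>+y. ennreal (norm (y::real^2) powr (-\<beta>)) * indicator (ball 0 R) y \<partial>lborel) =
      (\<integral>\<^sup>+y. ?h ((y::real^2) \<bullet> y) \<partial>lborel)"
  proof (intro nn_integral_cong)
    fix y :: "real^2"
    have "norm y powr (-\<beta>) = (y \<bullet> y) powr (-\<beta>/2)"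
    proof (cases "y = 0")
      case False
      then have "y \<bullet> y = norm y powr 2"
        by (simp add: dot_square_norm)
      then show ?thesis by (simp only: powr_powr) simp
    qed simp
    moreover have "y \<in> ball 0 R \<longleftrightarrow> y \<bullet> y < R\<^sup>2"
      using assms(1) norm_lt_square[of y R] by simp
    ultimately show "ennreal (norm y powr (-\<beta>)) * indicator (ball 0 R) y = ?h (y \<bullet> y)"
      by (simp add: indicator_def)
  qed
  also have "\<dots> = ennreal pi * (\<integral>\<^sup>+s. ?h s * indicator {0<..} s \<partial>lborel)"
    by (rule nn_integral_radial) measurable
  \<comment> \<open>The integrands can differ only at \<open>R\<^sup>2\<close>: at 0 they agree
    because \<open>0 powr c = 0\<close>.\<close>
  also have "(\<integral>\<^sup>+s. ?h s * indicator {0<..} s \<partial>lborel) =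
      (\<integral>\<^sup>+s. ennreal (if s \<in> {0..R\<^sup>2} then s powr (-\<beta>/2) else 0) \<partial>lborel)"
    using AE_lborel_singleton[of "R\<^sup>2"]
    by (intro nn_integral_cong_AE) (auto elim!: eventually_mono simp: indicator_def)
  also have "\<dots> = ennreal ((R\<^sup>2) powr (-\<beta>/2 + 1) / (-\<beta>/2 + 1))"
  proof (rule nn_integral_has_integral_lborel)
    show "((\<lambda>s. if s \<in> {0..R\<^sup>2} then s powr (-\<beta>/2) else 0) has_integral (R\<^sup>2) powr (-\<beta>/2 + 1) / (-\<beta>/2 + 1)) UNIV"
      unfolding has_integral_restrict_UNIV using assms by (intro has_integral_powr_from_0) auto
  qed auto
  also have "(R\<^sup>2) powr (-\<beta>/2 + 1) / (-\<beta>/2 + 1) = 2 / (2 - \<beta>) * R powr (2 - \<beta>)"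
  proof -
    have "R\<^sup>2 = R powr 2" using assms(1) by simp
    then have "(R\<^sup>2) powr (-\<beta>/2 + 1) = R powr (2 - \<beta>)"
      by (simp only: powr_powr) (simp add: algebra_simps)
    then show ?thesis using assms by (simp add: field_simps)
  qed
  also have "ennreal pi * ennreal (2 / (2 - \<beta>) * R powr (2 - \<beta>)) = ennreal (2 * pi / (2 - \<beta>) * R powr (2 - \<beta>))"
    using assms by (subst ennreal_mult[symmetric]) (auto simp: mult_ac)
  finally show ?thesis .
qed

text \<open>Uniform in the centre: where \<open>norm y \<ge> R\<close> the integrand is at most
  \<open>R powr (- \<beta>)\<close>, and the remaining points lie in the ball about 0. The two
  summands of the constant are these two contributions.\<close>

lemma norm_powr_ball:
  fixes x :: "real^2"
  assumes "R > 0" "0 \<le> \<beta>" "\<beta> < 2"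
  shows "set_integrable lborel (ball x R) (\<lambda>y. norm y powr (-\<beta>))"
    and "(LBINT y:ball x R. norm y powr (-\<beta>)) \<le> (pi + 2 * pi / (2 - \<beta>)) * R powr (2 - \<beta>)"
proof -
  have "(\<integral>\<^sup>+y. ennreal (indicator (ball x R) y * norm y powr (-\<beta>)) \<partial>lborel) \<le>
      (\<integral>\<^sup>+y. ennreal (R powr (-\<beta>)) * indicator (ball x R) y
        + ennreal (norm y powr (-\<beta>)) * indicator (ball 0 R) y \<partial>lborel)"
  proof (intro nn_integral_mono)
    fix y :: "real^2"
    show "ennreal (indicator (ball x R) y * norm y powr (-\<beta>)) \<le> ennreal (R powr (-\<beta>)) * indicator (ball x R) y
        + ennreal (norm y powr (-\<beta>)) * indicator (ball 0 R) y"
    proof (cases "norm y < R")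
      case False
      then have "norm y powr (-\<beta>) \<le> R powr (-\<beta>)"
        using assms by (intro powr_mono2') auto
      then show ?thesis using False by (auto simp: indicator_def)
    qed (auto simp: indicator_def)
  qed
  also have "\<dots> = (\<integral>\<^sup>+y. ennreal (R powr (-\<beta>)) * indicator (ball x R) y \<partial>lborel)
      + (\<integral>\<^sup>+y. ennreal (norm y powr (-\<beta>)) * indicator (ball (0::real^2) R) y \<partial>lborel)"
    by (rule nn_integral_add; intro borel_measurable_times_ennreal borel_measurable_indicator; simp)
  also have "\<dots> = ennreal (R powr (-\<beta>)) * emeasure lborel (ball x R)
      + ennreal (2 * pi / (2 - \<beta>) * R powr (2 - \<beta>))"
    using nn_integral_norm_powr_ball_0[OF assms(1,3)]
      nn_integral_cmult_indicator[of "ball x R" lborel "ennreal (R powr (-\<beta>))"] by simp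
  also have "\<dots> = ennreal ((pi + 2 * pi / (2 - \<beta>)) * R powr (2 - \<beta>))"
  proof -
    have "ennreal (R powr (-\<beta>)) * emeasure lborel (ball x R) = ennreal (R powr (-\<beta>) * (pi * R\<^sup>2))"
      using assms by (simp add: emeasure_ball unit_ball_vol_2 ennreal_mult)
    also have "R powr (-\<beta>) * (pi * R\<^sup>2) = pi * R powr (2 - \<beta>)"
      using assms by (simp add: powr_diff powr_minus field_simps)
    finally have "ennreal (R powr (-\<beta>)) * emeasure lborel (ball x R) = ennreal (pi * R powr (2 - \<beta>))" .
    then show ?thesis
      using assms by (simp add: algebra_simps flip: ennreal_plus)
  qed
  finally have *: "(\<integral>\<^sup>+y. ennreal (indicator (ball x R) y * norm y powr (-\<beta>)) \<partial>lborel) \<le>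
      ennreal ((pi + 2 * pi / (2 - \<beta>)) * R powr (2 - \<beta>))" .
  have meas: "(\<lambda>y. indicator (ball x R) y * norm y powr (-\<beta>)) \<in> borel_measurable lborel"
    by (intro borel_measurable_times borel_measurable_indicator; simp)
  have int: "integrable lborel (\<lambda>y. indicator (ball x R) y * norm y powr (-\<beta>))"
    by (rule integrableI_nonneg[OF meas]) (use * in \<open>auto simp: top.not_eq_extremum intro: le_less_trans\<close>)
  then show "set_integrable lborel (ball x R) (\<lambda>y. norm y powr (-\<beta>))"
    by (simp add: set_integrable_def)
  show "(LBINT y:ball x R. norm y powr (-\<beta>)) \<le> (pi + 2 * pi / (2 - \<beta>)) * R powr (2 - \<beta>)"
    using * assms nn_integral_eq_integral[OF int]
    by (simp add: set_lebesgue_integral_def ennreal_le_iff)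
qed

definition avg :: "(real^2 \<Rightarrow> real) \<Rightarrow> real^2 \<Rightarrow> real \<Rightarrow> real" where
  "avg U x R = (LBINT y. U y * kern R (y - x))"

text \<open>The sign comes from integration by parts: for a continuously differentiable function
  this is the average of the \<open>i\<close>-th partial derivative
  (\<open>davg_eq_avg_derivative\<close>), yet only \<open>U\<close> itself enters.\<close>

definition davg :: "real^2 \<Rightarrow> (real^2 \<Rightarrow> real) \<Rightarrow> real^2 \<Rightarrow> real \<Rightarrow> real" where
  "davg i U x R = - (LBINT y. U y * dkern i R (y - x))"

lemma integrable_kern_mult:
  assumes "integrable lborel U" "R > 0"
  shows "integrable lborel (\<lambda>y. U y * kern R (y - x))"
proof -
  obtain B where "\<And>R y. R > 0 \<Longrightarrow> kern R y \<le> B / R\<^sup>2" by (rule kernel_bounds) blast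
  then show ?thesis
    by (intro integrable_mult_bounded[of _ _ _ "B / R\<^sup>2"]) (use assms kern_nonneg in auto)
qed

lemma integrable_dkern_mult:
  assumes "integrable lborel U" "R > 0" "i \<in> Basis"
  shows "integrable lborel (\<lambda>y. U y * dkern i R (y - x))"
proof -
  obtain B where "\<And>R y i. R > 0 \<Longrightarrow> i \<in> Basis \<Longrightarrow> \<bar>dkern i R y\<bar> \<le> B / R ^ 3"
    by (rule kernel_bounds) blast
  then show ?thesis
    by (intro integrable_mult_bounded[of _ _ _ "B / R ^ 3"]) (use assms in auto)
qed

lemma integrable_cut_mult:
  fixes x :: "real^2"
  assumes "integrable lborel U" "R > 0"
  shows "integrable lborel (\<lambda>y. U y * cut R (y - x))"
    and "i \<in> Basis \<Longrightarrow> integrable lborel (\<lambda>y. U y * dcut i R (y - x))"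
proof -
  obtain B where "\<And>R y i::real^2. R > 0 \<Longrightarrow> i \<in> Basis \<Longrightarrow> \<bar>dcut i R y\<bar> \<le> B / R"
    by (rule kernel_bounds) blast
  then show "i \<in> Basis \<Longrightarrow> integrable lborel (\<lambda>y. U y * dcut i R (y - x))"
    by (intro integrable_mult_bounded[of _ _ _ "B / R"]) (use assms in auto)
  show "integrable lborel (\<lambda>y. U y * cut R (y - x))"
    by (rule integrable_mult_bounded[of _ _ _ 1]) (use assms in \<open>auto simp: abs_le_iff cut_bounds intro: order_trans[OF _ cut_bounds(1)]\<close>)
qed

lemma integrable_lap_cut_mult:
  assumes "integrable lborel U" "R > 0"
  shows "integrable lborel (\<lambda>y. U y * lap_cut R (y - x))"
proof -
  obtain B where "\<And>R y. R > 0 \<Longrightarrow> \<bar>lap_cut R y\<bar> \<le> B / R\<^sup>2" by (rule kernel_bounds) blast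
  then show ?thesis
    by (intro integrable_mult_bounded[of _ _ _ "B / R\<^sup>2"]) (use assms in auto)
qed

lemma avg_has_derivative:
  assumes U: "integrable lborel U" and R: "R > 0"
  shows "((\<lambda>R. avg U x R) has_real_derivative (LBINT y. U y * lap_cut R (y - x)) / (2 * pi * R)) (at R)"
proof -
  obtain B where B: "B > 0" "\<And>R y. R > 0 \<Longrightarrow> kern R y \<le> B / R\<^sup>2" "\<And>R y. R > 0 \<Longrightarrow> \<bar>lap_cut R y\<bar> \<le> B / R\<^sup>2"
    by (rule kernel_bounds) blast
  have R2: "B / S\<^sup>2 \<le> B / (R/2)\<^sup>2" if "R/2 < S" for S
    using that R B(1) by (intro divide_left_mono power_mono) auto
  have "((\<lambda>R. avg U x R) has_real_derivative (LBINT y. U y * (lap_cut R (y - x) / (2 * pi * R)))) (at R)"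
    unfolding avg_def
  \<comment> \<open>Radii above \<open>R / 2\<close> stay away from the blow-up of the kernels at
    radius 0, so one bound serves for all of them.\<close>
  proof (rule has_derivative_integral[OF U, of "R/2" R _ "\<lambda>R y. lap_cut R (y - x) / (2 * pi * R)"
        "B / (R/2)\<^sup>2 + B / (R/2)\<^sup>2 / (pi * R)"])
    fix S :: real and y :: "real^2" assume S: "R/2 < S"
    show "((\<lambda>s. kern s (y - x)) has_real_derivative lap_cut S (y - x) / (2 * pi * S)) (at S)"
      using kern_has_derivative[of S "y - x"] R S by auto
    have nn: "0 \<le> B / (R/2)\<^sup>2" "0 \<le> B / (R/2)\<^sup>2 / (pi * R)" using B R by auto
    have "\<bar>kern S (y - x)\<bar> \<le> B / (R/2)\<^sup>2"
      using B(2)[of S "y - x"] R2[OF S] kern_nonneg[of S "y - x"] S R by auto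
    then show "\<bar>kern S (y - x)\<bar> \<le> B / (R/2)\<^sup>2 + B / (R/2)\<^sup>2 / (pi * R)" using nn by linarith
    have "\<bar>lap_cut S (y - x) / (2 * pi * S)\<bar> = \<bar>lap_cut S (y - x)\<bar> / (2 * pi * S)"
      using S R by (simp add: abs_mult)
    also have "\<dots> \<le> B / (R/2)\<^sup>2 / (pi * R)"
      using B(3)[of S "y - x"] R2[OF S] S R by (intro frac_le) auto
    finally show "\<bar>lap_cut S (y - x) / (2 * pi * S)\<bar> \<le> B / (R/2)\<^sup>2 + B / (R/2)\<^sup>2 / (pi * R)"
      using nn by linarith
  next
    show "R / 2 < R" using R by simp
    show "(\<lambda>y. kern s (y - x)) \<in> borel_measurable borel" for s by measurable
    show "(\<lambda>y. lap_cut R (y - x) / (2 * pi * R)) \<in> borel_measurable borel" by measurable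
  qed
  then show ?thesis by simp
qed

lemma davg_has_derivative:
  assumes U: "integrable lborel U" and R: "R > 0" and i: "i \<in> Basis"
  shows "((\<lambda>R. davg i U x R) has_real_derivative - (LBINT y. U y * lap_dcut i R (y - x)) / (2 * pi * R)) (at R)"
proof -
  obtain B where B0: "B > 0" "\<And>R y i. R > 0 \<Longrightarrow> i \<in> Basis \<Longrightarrow> \<bar>dkern i R y\<bar> \<le> B / R ^ 3"
    "\<And>R y i. R > 0 \<Longrightarrow> i \<in> Basis \<Longrightarrow> \<bar>lap_dcut i R y\<bar> \<le> B / R ^ 3"
    by (rule kernel_bounds) blast
  note B = B0(1) B0(2)[OF _ i] B0(3)[OF _ i]
  have R2: "B / S ^ 3 \<le> B / (R/2) ^ 3" if "R/2 < S" for S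
    using that R B(1) by (intro divide_left_mono power_mono) auto
  have "((\<lambda>R. LBINT y. U y * dkern i R (y - x)) has_real_derivative (LBINT y. U y * (lap_dcut i R (y - x) / (2 * pi * R)))) (at R)"
  proof (rule has_derivative_integral[OF U, of "R/2" R _ "\<lambda>R y. lap_dcut i R (y - x) / (2 * pi * R)"
        "B / (R/2) ^ 3 + B / (R/2) ^ 3 / (pi * R)"])
    fix S :: real and y :: "real^2" assume S: "R/2 < S"
    show "((\<lambda>s. dkern i s (y - x)) has_real_derivative lap_dcut i S (y - x) / (2 * pi * S)) (at S)"
      using dkern_has_derivative[of S i "y - x"] R S by auto
    have nn: "0 \<le> B / (R/2) ^ 3" "0 \<le> B / (R/2) ^ 3 / (pi * R)" using B R by auto
    have "\<bar>dkern i S (y - x)\<bar> \<le> B / (R/2) ^ 3"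
      using B(2)[of S "y - x"] R2[OF S] S R by auto
    then show "\<bar>dkern i S (y - x)\<bar> \<le> B / (R/2) ^ 3 + B / (R/2) ^ 3 / (pi * R)" using nn by linarith
    have "\<bar>lap_dcut i S (y - x) / (2 * pi * S)\<bar> = \<bar>lap_dcut i S (y - x)\<bar> / (2 * pi * S)"
      using S R by (simp add: abs_mult)
    also have "\<dots> \<le> B / (R/2) ^ 3 / (pi * R)"
      using B(3)[of S "y - x"] R2[OF S] S R by (intro frac_le) auto
    finally show "\<bar>lap_dcut i S (y - x) / (2 * pi * S)\<bar> \<le> B / (R/2) ^ 3 + B / (R/2) ^ 3 / (pi * R)"
      using nn by linarith
  next
    show "R / 2 < R" using R by simp
    show "(\<lambda>y. dkern i s (y - x)) \<in> borel_measurable borel" for s by measurable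
    show "(\<lambda>y. lap_dcut i R (y - x) / (2 * pi * R)) \<in> borel_measurable borel" by measurable
  qed
  from DERIV_minus[OF this] show ?thesis unfolding davg_def by simp
qed

text \<open>\<open>kern R\<close> lives on \<open>R / 2 \<le> norm (y - x) \<le> R\<close>, so
  nothing is asked of \<open>U\<close> near the centre; this makes averages about the singular point
  usable.\<close>

lemma avg_le_annulus:
  assumes U: "integrable lborel U" and R: "R > 0"
    and L: "\<And>y. R \<le> 2 * norm (y - x) \<Longrightarrow> norm (y - x) \<le> R \<Longrightarrow> U y \<le> L"
  shows "avg U x R \<le> L"
proof -
  have "avg U x R \<le> (LBINT y. L * kern R (y - x))"
    unfolding avg_def
  proof (rule integral_mono[OF integrable_kern_mult[OF U R]])
    show "integrable lborel (\<lambda>y. L * kern R (y - x))"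
      by (intro integrable_mult_right integral_kern R)
    fix y
    show "U y * kern R (y - x) \<le> L * kern R (y - x)"
      using L[of y] kern_nonneg[OF R, of "y - x"] kern_outside[OF R, of "y - x"] kern_inside[OF R, of "y - x"]
      by (cases "R \<le> 2 * norm (y - x) \<and> norm (y - x) < R") (auto intro: mult_right_mono)
  qed
  then show ?thesis using integral_kern(2)[OF R] by simp
qed

lemma avg_le:
  assumes U: "integrable lborel U" and R: "R > 0" and L: "\<And>y. y \<in> cball x R \<Longrightarrow> U y \<le> L"
  shows "avg U x R \<le> L"
  using L by (intro avg_le_annulus[OF U R]) (auto simp: dist_norm norm_minus_commute)

lemma avg_ge:
  assumes U: "integrable lborel U" and R: "R > 0" and L: "\<And>y. y \<in> cball x R \<Longrightarrow> L \<le> U y"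
  shows "L \<le> avg U x R"
  using avg_le[of "\<lambda>y. - U y" R x "- L"] assms by (simp add: avg_def)

lemma avg_cong:
  assumes "R > 0" "\<And>y. y \<in> ball x R \<Longrightarrow> U y = V y"
  shows "avg U x R = avg V x R"
  unfolding avg_def
proof (intro Bochner_Integration.integral_cong refl)
  fix y
  show "U y * kern R (y - x) = V y * kern R (y - x)"
    using assms(2)[of y] kern_outside[OF assms(1), of "y - x"]
    by (cases "dist x y < R") (auto simp: dist_norm norm_minus_commute)
qed

lemma avg_tendsto:
  assumes U: "integrable lborel U" and cont: "isCont U x"
  shows "((\<lambda>R. avg U x R) \<longlongrightarrow> U x) (at_right 0)"
proof (rule tendstoI)
  fix e :: real assume "e > 0"
  then obtain d where d: "d > 0" "\<And>y. dist y x < d \<Longrightarrow> dist (U y) (U x) < e / 2"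
    using cont unfolding continuous_at_eps_delta by (meson half_gt_zero)
  have "dist (avg U x R) (U x) < e" if R: "0 < R" "R < d" for R
  proof -
    have "\<bar>U y - U x\<bar> < e / 2" if "y \<in> cball x R" for y
      using d(2)[of y] that R by (auto simp: dist_commute[of x] dist_real_def)
    then have "U y \<le> U x + e / 2 \<and> U x - e / 2 \<le> U y" if "y \<in> cball x R" for y
      using that by (smt (verit, best) field_sum_of_halves)
    then have "avg U x R \<le> U x + e / 2" "U x - e / 2 \<le> avg U x R"
      using avg_le[OF U R(1)] avg_ge[OF U R(1)] by blast+
    then show ?thesis using \<open>e > 0\<close> by (auto simp: dist_real_def abs_le_iff)
  qed
  then show "\<forall>\<^sub>F R in at_right 0. dist (avg U x R) (U x) < e"
    unfolding eventually_at_right_field using d(1) by blast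
qed

lemma integral_ball_le:
  fixes F \<phi> :: "real^2 \<Rightarrow> real"
  assumes F: "set_integrable lborel (ball x R) F" and meas: "\<phi> \<in> borel_measurable borel" and "c \<ge> 0"
    and bound: "\<And>y. y \<in> ball x R \<Longrightarrow> \<bar>\<phi> y\<bar> \<le> c" "\<And>y. y \<notin> ball x R \<Longrightarrow> \<phi> y = 0"
  shows "\<bar>LBINT y. F y * \<phi> y\<bar> \<le> c * (LBINT y:ball x R. \<bar>F y\<bar>)"
proof -
  have F': "set_integrable lborel (ball x R) (\<lambda>y. \<bar>F y\<bar>)"
    using F by (rule set_integrable_abs)
  have "norm (LBINT y. F y * \<phi> y) \<le> (LBINT y. c * (indicator (ball x R) y * \<bar>F y\<bar>))"
  proof (rule Bochner_Integration.integral_norm_bound_integral)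
    have "integrable lborel (\<lambda>y. (indicator (ball x R) y * F y) * \<phi> y)"
    proof (rule integrable_mult_bounded[where B=c])
      show "\<bar>\<phi> y\<bar> \<le> c" for y using bound[of y] \<open>c \<ge> 0\<close> by (cases "y \<in> ball x R") auto
    qed (use F meas in \<open>auto simp: set_integrable_def\<close>)
    also have "(\<lambda>y. (indicator (ball x R) y * F y) * \<phi> y) = (\<lambda>y. F y * \<phi> y)"
      using bound(2) by (auto simp: fun_eq_iff split: split_indicator)
    finally show "integrable lborel (\<lambda>y. F y * \<phi> y)" .
    show "integrable lborel (\<lambda>y. c * (indicator (ball x R) y * \<bar>F y\<bar>))"
      using F' by (auto simp: set_integrable_def)
    fix y
    show "norm (F y * \<phi> y) \<le> c * (indicator (ball x R) y * \<bar>F y\<bar>)"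
      using bound[of y] by (cases "y \<in> ball x R") (auto simp: abs_mult mult.commute[of c] intro: mult_left_mono)
  qed
  then show ?thesis by (simp add: set_lebesgue_integral_def)
qed

lemma set_integrable_const_ball: "set_integrable lborel (ball x R) (\<lambda>y. c)"
  unfolding set_integrable_def by (intro integrable_scaleR_left integrable_real_indicator) (auto simp: emeasure_bounded_finite[unfolded infinity_ennreal_def])

lemma integral_ball_const_le:
  fixes F :: "real^2 \<Rightarrow> real"
  assumes F: "set_integrable lborel (ball x R) F" and "R > 0" and "\<And>y. y \<in> ball x R \<Longrightarrow> \<bar>F y\<bar> \<le> L"
  shows "(LBINT y:ball x R. \<bar>F y\<bar>) \<le> pi * R\<^sup>2 * L"
proof -
  have "(LBINT y:ball x R. \<bar>F y\<bar>) \<le> (LBINT y:ball x R. L)"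
    using assms by (intro set_integral_mono set_integrable_abs) (auto intro: set_integrable_const_ball)
  also have "\<dots> = pi * R\<^sup>2 * L"
    using assms(2) by (simp add: set_lebesgue_integral_def content_ball unit_ball_vol_2 mult_ac)
  finally show ?thesis .
qed

section \<open>Interior estimates for the Poisson equation\<close>

text \<open>The distributional form of \<open>- \<Delta> u = f\<close>, with both derivatives moved
  to the test function.\<close>

definition solves :: "(real^2) set \<Rightarrow> (real^2 \<Rightarrow> real) \<Rightarrow> (real^2 \<Rightarrow> real) \<Rightarrow> bool" where
  "solves \<Omega> u f \<longleftrightarrow> (\<forall>\<phi>\<in>test_functions \<Omega>.
     - (LBINT y:\<Omega>. u y * laplacian \<phi> y) = (LBINT y:\<Omega>. f y * \<phi> y))"

lemma set_integral_ball_cong: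
  fixes U u k :: "real^2 \<Rightarrow> real"
  assumes "\<And>y. y \<in> ball x R \<Longrightarrow> U y = u y" "\<And>y. y \<notin> ball x R \<Longrightarrow> k y = 0" "ball x R \<subseteq> \<Omega>"
  shows "(LBINT y:\<Omega>. u y * k y) = (LBINT y. U y * k y)"
  unfolding set_lebesgue_integral_def
proof (intro Bochner_Integration.integral_cong refl)
  fix y
  show "indicator \<Omega> y *\<^sub>R (u y * k y) = U y * k y"
    using assms(1,2)[of y] assms(3) by (cases "y \<in> ball x R") (auto simp: indicator_def)
qed

lemma outside_ball: "y \<notin> ball x R \<Longrightarrow> norm (y - x) \<ge> R"
  by (simp add: dist_norm norm_minus_commute)

text \<open>Averages need functions integrable on the whole plane, so \<open>u\<close> and
  \<open>f\<close> are exchanged for \<open>U\<close> and \<open>F\<close> that agree with them on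
  the ball carrying the kernels.\<close>

lemma
  assumes sol: "solves \<Omega> u f" and R: "R > 0" "cball x R \<subseteq> \<Omega>"
    and eq: "\<And>y. y \<in> ball x R \<Longrightarrow> U y = u y" "\<And>y. y \<in> ball x R \<Longrightarrow> F y = f y"
  shows solves_cut: "(LBINT y. U y * lap_cut R (y - x)) = - (LBINT y. F y * cut R (y - x))"
    and solves_dcut: "i \<in> Basis \<Longrightarrow>
      (LBINT y. U y * lap_dcut i R (y - x)) = - (LBINT y. F y * dcut i R (y - x))"
proof -
  have sub: "ball x R \<subseteq> \<Omega>" using R(2) ball_subset_cball by blast
  have "- (LBINT y:\<Omega>. u y * lap_cut R (y - x)) = (LBINT y:\<Omega>. f y * cut R (y - x))"
    using sol[unfolded solves_def, rule_format, OF cut_test_function(1)[OF R]] by (simp only: laplacian_cut)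
  then show "(LBINT y. U y * lap_cut R (y - x)) = - (LBINT y. F y * cut R (y - x))"
    using set_integral_ball_cong[OF eq(1) _ sub, where k="\<lambda>y. lap_cut R (y - x)"]
      set_integral_ball_cong[OF eq(2) _ sub, where k="\<lambda>y. cut R (y - x)"]
    by (simp add: lap_cut_outside[OF R(1) outside_ball] cut_outside[OF R(1) outside_ball])
  assume i: "i \<in> Basis"
  have "- (LBINT y:\<Omega>. u y * lap_dcut i R (y - x)) = (LBINT y:\<Omega>. f y * dcut i R (y - x))"
    using sol[unfolded solves_def, rule_format, OF cut_test_function(2)[OF R i]] by (simp only: laplacian_dcut)
  then show "(LBINT y. U y * lap_dcut i R (y - x)) = - (LBINT y. F y * dcut i R (y - x))"
    using set_integral_ball_cong[OF eq(1) _ sub, where k="\<lambda>y. lap_dcut i R (y - x)"]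
      set_integral_ball_cong[OF eq(2) _ sub, where k="\<lambda>y. dcut i R (y - x)"]
    by (simp add: lap_dcut_outside[OF R(1) outside_ball] dcut_outside[OF R(1) outside_ball])
qed

lemma integrable_truncate:
  fixes h :: "'a::euclidean_space \<Rightarrow> real"
  assumes "continuous_on K h" "compact K"
  shows "integrable lborel (\<lambda>y. indicator K y * h y)"
  using borel_integrable_compact[OF assms(2,1)] by simp

text \<open>Integration by parts against \<open>kern\<close>: the derivative of the compactly
  supported product of \<open>u\<close> and the kernel has integral 0.\<close>

lemma davg_eq_avg_derivative:
  assumes \<Omega>: "open \<Omega>" "cball x R \<subseteq> \<Omega>" and R: "R > 0" and i: "i \<in> Basis"
    and deriv: "\<And>y. y \<in> \<Omega> \<Longrightarrow> (u has_derivative (\<lambda>h. g y \<bullet> h)) (at y)" and g: "continuous_on \<Omega> g"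
    and eq: "\<And>y. y \<in> ball x R \<Longrightarrow> U y = u y" "\<And>y. y \<in> ball x R \<Longrightarrow> G y = g y \<bullet> i"
  shows "davg i U x R = avg G x R"
proof -
  let ?I = "\<lambda>h y. indicator (cball x R) y * h y"
  have cu: "continuous_on \<Omega> u"
    using deriv has_derivative_continuous \<Omega>(1) by (metis continuous_at_imp_continuous_on)
  have int: "integrable lborel (?I u)" "integrable lborel (?I (\<lambda>y. g y \<bullet> i))"
    by (auto intro!: integrable_truncate continuous_on_subset[OF _ \<Omega>(2)] continuous_intros cu g)
  define H where "H y = u y * dkern i R (y - x) + g y \<bullet> i * kern R (y - x)" for y
  have "integral\<^sup>L lborel H = 0"
  proof (rule integral_derivative_compact_support[OF compact_cball \<Omega>(2,1)])
    fix y
    show "((\<lambda>y. u y * kern R (y - x)) has_derivative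
        (\<lambda>h. u y * dkern h R (y - x) + g y \<bullet> h * kern R (y - x))) (at y)" if "y \<in> \<Omega>"
      by (rule has_derivative_mult[OF deriv[OF that] kern_has_derivative_space])
    show "u y * dkern i R (y - x) + g y \<bullet> i * kern R (y - x) = H y"
      by (simp add: H_def)
    assume "y \<notin> cball x R"
    then have "norm (y - x) \<ge> R" using outside_ball[of y x R] ball_subset_cball by blast
    then show "u y * kern R (y - x) = 0" "H y = 0"
      unfolding H_def by (simp_all add: kern_outside[OF R] dkern_outside[OF R])
  next
    show "continuous_on \<Omega> H"
      unfolding H_def
      by (intro continuous_intros cu g continuous_on_compose2[OF continuous_dkern[of UNIV]]
          continuous_on_compose2[OF continuous_kern[of UNIV]]) auto
  qed
  also have "H = (\<lambda>y. ?I u y * dkern i R (y - x) + ?I (\<lambda>y. g y \<bullet> i) y * kern R (y - x))"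
  proof
    fix y
    show "H y = ?I u y * dkern i R (y - x) + ?I (\<lambda>y. g y \<bullet> i) y * kern R (y - x)"
      using kern_outside[OF R outside_ball, of y x] dkern_outside[OF R outside_ball, of y x i] ball_subset_cball[of x R]
      by (cases "y \<in> ball x R") (auto simp: H_def indicator_def)
  qed
  also have "integral\<^sup>L lborel \<dots> = - davg i (?I u) x R + avg (?I (\<lambda>y. g y \<bullet> i)) x R"
    unfolding davg_def avg_def
    by (subst Bochner_Integration.integral_add) (use int R i in \<open>auto intro: integrable_kern_mult integrable_dkern_mult\<close>)
  also have "avg (?I (\<lambda>y. g y \<bullet> i)) x R = avg G x R"
    by (rule avg_cong) (use R eq in auto)
  also have "davg i (?I u) x R = davg i U x R"
    unfolding davg_def
  proof (intro arg_cong[of _ _ uminus] Bochner_Integration.integral_cong refl)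
    fix y
    show "?I u y * dkern i R (y - x) = U y * dkern i R (y - x)"
      using dkern_outside[OF R outside_ball, of y x i] eq(1)[of y] ball_subset_cball[of x R]
      by (cases "y \<in> ball x R") auto
  qed
  finally show ?thesis by simp
qed

lemma davg_bound:
  obtains B where "B > 0"
    "\<And>i U x R. i \<in> Basis \<Longrightarrow> R > 0 \<Longrightarrow> set_integrable lborel (ball x R) U \<Longrightarrow>
      \<bar>davg i U x R\<bar> \<le> B / R ^ 3 * (LBINT y:ball x R. \<bar>U y\<bar>)"
    "\<And>(i::real^2) F x R. i \<in> Basis \<Longrightarrow> R > 0 \<Longrightarrow> set_integrable lborel (ball x R) F \<Longrightarrow>
      \<bar>LBINT y. F y * dcut i R (y - x)\<bar> \<le> B / R * (LBINT y:ball x R. \<bar>F y\<bar>)"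
proof -
  obtain B where B: "B > 0" "\<And>R y i::real^2. R > 0 \<Longrightarrow> i \<in> Basis \<Longrightarrow> \<bar>dkern i R y\<bar> \<le> B / R ^ 3"
    "\<And>R y i::real^2. R > 0 \<Longrightarrow> i \<in> Basis \<Longrightarrow> \<bar>dcut i R y\<bar> \<le> B / R"
    by (rule kernel_bounds) blast
  show thesis
  proof (rule that[OF B(1)])
    fix i x :: "real^2" and U F :: "real^2 \<Rightarrow> real" and R :: real assume i: "i \<in> Basis" and R: "R > 0"
    show "\<bar>davg i U x R\<bar> \<le> B / R ^ 3 * (LBINT y:ball x R. \<bar>U y\<bar>)" if "set_integrable lborel (ball x R) U"
      unfolding davg_def abs_minus_cancel
      by (rule integral_ball_le[OF that]) (use B(2)[OF R i] B(1) R dkern_outside[OF R outside_ball] in auto)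
    show "\<bar>LBINT y. F y * dcut i R (y - x)\<bar> \<le> B / R * (LBINT y:ball x R. \<bar>F y\<bar>)"
      if "set_integrable lborel (ball x R) F"
      by (rule integral_ball_le[OF that]) (use B(3)[OF R i] B(1) R dcut_outside[OF R outside_ball] in auto)
  qed
qed

text \<open>The averages of a partial derivative tend to its value at the centre as the radius
  shrinks. At radius \<open>R\<close> they are \<open>O(L / R)\<close>, and by
  \<open>solves_dcut\<close> their radial derivative is \<open>O(F)\<close>, which adds
  \<open>O(R * F)\<close> on the way down.\<close>

lemma gradient_estimate:
  obtains C where "C > 0" "\<And>\<Omega> u g f x R L F. solves \<Omega> u f \<Longrightarrow> open \<Omega> \<Longrightarrow> R > 0 \<Longrightarrow> cball x R \<subseteq> \<Omega> \<Longrightarrow>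
    (\<And>y. y \<in> \<Omega> \<Longrightarrow> (u has_derivative (\<lambda>h. g y \<bullet> h)) (at y)) \<Longrightarrow> continuous_on \<Omega> g \<Longrightarrow> continuous_on \<Omega> f \<Longrightarrow>
    (\<And>y. y \<in> ball x R \<Longrightarrow> \<bar>u y\<bar> \<le> L) \<Longrightarrow> (\<And>y. y \<in> ball x R \<Longrightarrow> \<bar>f y\<bar> \<le> F) \<Longrightarrow>
    norm (g x) \<le> C * (L / R + R * F)"
proof -
  obtain B where B: "B > 0"
    "\<And>i U x R. i \<in> Basis \<Longrightarrow> R > 0 \<Longrightarrow> set_integrable lborel (ball x R) U \<Longrightarrow>
      \<bar>davg i U x R\<bar> \<le> B / R ^ 3 * (LBINT y:ball x R. \<bar>U y\<bar>)"
    "\<And>(i::real^2) F x R. i \<in> Basis \<Longrightarrow> R > 0 \<Longrightarrow> set_integrable lborel (ball x R) F \<Longrightarrow>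
      \<bar>LBINT y. F y * dcut i R (y - x)\<bar> \<le> B / R * (LBINT y:ball x R. \<bar>F y\<bar>)"
    by (rule davg_bound) blast
  show thesis
  \<comment> \<open>The factor 2 counts the coordinates summed in \<open>norm_le_l1\<close>.\<close>
  proof (rule that[of "2 * (pi * B)"])
    show "2 * (pi * B) > 0" using B(1) by simp
    fix \<Omega> u g f x R L F
    assume sol: "solves \<Omega> u f" and \<Omega>: "open \<Omega>" and R: "R > 0" and sub: "cball x R \<subseteq> \<Omega>"
      and deriv: "\<And>y. y \<in> \<Omega> \<Longrightarrow> (u has_derivative (\<lambda>h. g y \<bullet> h)) (at y)"
      and g: "continuous_on \<Omega> g" and f: "continuous_on \<Omega> f"
      and L: "\<And>y. y \<in> ball x R \<Longrightarrow> \<bar>u y\<bar> \<le> L" and F: "\<And>y. y \<in> ball x R \<Longrightarrow> \<bar>f y\<bar> \<le> F"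
    have cu: "continuous_on \<Omega> u"
      using deriv has_derivative_continuous \<Omega> by (metis continuous_at_imp_continuous_on)
    have x: "x \<in> ball x R" using R by simp
    have nonneg: "L \<ge> 0" "F \<ge> 0" using L[OF x] F[OF x] by linarith+
    have comp: "\<bar>g x \<bullet> i\<bar> \<le> pi * B * (L / R + R * F)" if i: "i \<in> Basis" for i
    proof -
      define U where "U y = indicator (cball x R) y * u y" for y
      define V where "V y = indicator (cball x R) y * f y" for y
      define G where "G y = indicator (cball x R) y * (g y \<bullet> i)" for y
      have int: "integrable lborel U" "integrable lborel V" "integrable lborel G"
        unfolding U_def V_def G_def
        by (auto intro!: integrable_truncate continuous_on_subset[OF _ sub] continuous_intros cu f g)
      have sint: "set_integrable lborel (ball y r) U" "set_integrable lborel (ball y r) V" for y r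
        unfolding set_integrable_def by (intro integrable_mult_indicator int; simp)+
      have inball: "y \<in> ball x R" if "y \<in> ball x r" "r \<le> R" for y r using that by simp
      have "\<bar>davg i U x R - davg i U x r\<bar> \<le> pi * B * R * F / 2" if r: "0 < r" "r < R" for r
      proof -
        have "\<bar>davg i U x R - davg i U x r\<bar> \<le> (\<lambda>t. t * (B * F / 2)) R - (\<lambda>t. t * (B * F / 2)) r"
        proof (rule increment_le)
          fix t assume t: "r \<le> t" "t \<le> R"
          then have t0: "t > 0" using r by linarith
          show "((\<lambda>R. davg i U x R) has_real_derivative - (LBINT y. U y * lap_dcut i t (y - x)) / (2 * pi * t)) (at t)"
            by (rule davg_has_derivative[OF int(1) t0 i])
          show "((\<lambda>t. t * (B * F / 2)) has_real_derivative B * F / 2) (at t)"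
            by (auto intro!: derivative_eq_intros)
          have "cball x t \<subseteq> \<Omega>" using sub t by auto
          then have "(LBINT y. U y * lap_dcut i t (y - x)) = - (LBINT y. V y * dcut i t (y - x))"
            using t inball[of _ t] by (intro solves_dcut[OF sol t0 _ _ _ i]) (auto simp: U_def V_def)
          then have "\<bar>- (LBINT y. U y * lap_dcut i t (y - x)) / (2 * pi * t)\<bar> =
              \<bar>LBINT y. V y * dcut i t (y - x)\<bar> / (2 * pi * t)"
            using t0 by (simp add: abs_mult)
          also have "\<dots> \<le> (B / t * (pi * t\<^sup>2 * F)) / (2 * pi * t)"
          proof (intro divide_right_mono order_trans[OF B(3)[OF i t0 sint(2)]] mult_left_mono integral_ball_const_le sint t0)
            show "\<bar>V y\<bar> \<le> F" if "y \<in> ball x t" for y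
              using F[OF inball[OF that t(2)]] nonneg(2) by (auto simp: V_def indicator_def)
          qed (use B(1) t0 in auto)
          also have "\<dots> = B * F / 2" using t0 by (simp add: field_simps power2_eq_square)
          finally show "\<bar>- (LBINT y. U y * lap_dcut i t (y - x)) / (2 * pi * t)\<bar> \<le> B * F / 2" .
        qed (use r in auto)
        also have "\<dots> \<le> R * (B * F / 2)" using r B(1) nonneg by simp
        also have "\<dots> \<le> pi * (R * (B * F / 2))"
          using pi_ge_two R B(1) nonneg by (intro mult_right_mono[of 1 pi, simplified]) auto
        finally show ?thesis by (simp add: mult_ac)
      qed
      moreover have "\<bar>davg i U x R\<bar> \<le> pi * B * (L / R)"
      proof -
        have "\<bar>davg i U x R\<bar> \<le> B / R ^ 3 * (pi * R\<^sup>2 * L)"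
        proof (intro order_trans[OF B(2)[OF i R sint(1)]] mult_left_mono integral_ball_const_le sint R)
          show "\<bar>U y\<bar> \<le> L" if "y \<in> ball x R" for y
            using L[OF that] nonneg(1) by (auto simp: U_def indicator_def)
        qed (use B(1) R in auto)
        also have "\<dots> = pi * B * (L / R)" using R by (simp add: field_simps eval_nat_numeral)
        finally show ?thesis .
      qed
      ultimately have "\<bar>davg i U x r\<bar> \<le> pi * B * (L / R) + pi * B * R * F / 2" if "0 < r" "r < R" for r
        using that by (smt (verit))
      moreover have "davg i U x r = avg G x r" if "0 < r" "r < R" for r
        by (rule davg_eq_avg_derivative[OF \<Omega> _ that(1) i deriv g])
          (use that sub in \<open>auto simp: U_def G_def indicator_def\<close>)
      ultimately have bound: "\<bar>avg G x r\<bar> \<le> pi * B * (L / R) + pi * B * R * F / 2" if "0 < r" "r < R" for r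
        using that by simp
      have "((\<lambda>r. avg G x r) \<longlongrightarrow> G x) (at_right 0)"
      proof (rule avg_tendsto[OF int(3)])
        have "continuous_on (ball x R) (\<lambda>y. g y \<bullet> i)"
          using sub by (intro continuous_intros continuous_on_subset[OF g]) auto
        then have "continuous_on (ball x R) G"
          by (rule continuous_on_eq) (auto simp: G_def)
        then show "isCont G x"
          using x by (simp add: continuous_on_eq_continuous_at)
      qed
      then have "((\<lambda>r. \<bar>avg G x r\<bar>) \<longlongrightarrow> \<bar>G x\<bar>) (at_right 0)" by (rule tendsto_rabs)
      moreover have "\<forall>\<^sub>F r in at_right 0. \<bar>avg G x r\<bar> \<le> pi * B * (L / R) + pi * B * R * F / 2"
        unfolding eventually_at_right_field using bound R by blast
      ultimately have "\<bar>G x\<bar> \<le> pi * B * (L / R) + pi * B * R * F / 2"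
        by (rule tendsto_upperbound) simp
      also have "\<dots> \<le> pi * B * (L / R + R * F)"
        using B(1) R nonneg by (simp add: field_simps)
      finally show ?thesis using R by (simp add: G_def)
    qed
    have "norm (g x) \<le> (\<Sum>i\<in>Basis. \<bar>g x \<bullet> i\<bar>)" by (rule norm_le_l1)
    also have "\<dots> \<le> (\<Sum>i\<in>(Basis::(real^2) set). pi * B * (L / R + R * F))"
      by (intro sum_mono comp)
    finally show "norm (g x) \<le> 2 * (pi * B) * (L / R + R * F)" by simp
  qed
qed

text \<open>Green's second identity for \<open>v\<close> and \<open>cut\<close>: the difference of
  the integrands is a sum of partial derivatives of
  \<open>v * dcut i - (dv \<bullet> i) * cut\<close>, each with integral 0.\<close>

lemma green_cut:
  fixes v :: "real^2 \<Rightarrow> real"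
  assumes R: "0 < R" "R < r"
    and dv: "\<And>y. y \<in> ball x r \<Longrightarrow> (v has_derivative (\<lambda>h. dv y \<bullet> h)) (at y)"
    and d2v: "\<And>y i. y \<in> ball x r \<Longrightarrow> i \<in> Basis \<Longrightarrow> ((\<lambda>y. dv y \<bullet> i) has_derivative d2v i y) (at y)"
    and cont: "\<And>i. i \<in> Basis \<Longrightarrow> continuous_on (ball x r) (\<lambda>y. d2v i y i)"
  shows "(LBINT y. (indicator (cball x R) y * v y) * lap_cut R (y - x)) =
    (LBINT y. (indicator (cball x R) y * (\<Sum>i\<in>Basis. d2v i y i)) * cut R (y - x))"
proof -
  have sub: "cball x R \<subseteq> ball x r" using R by auto
  have cv: "continuous_on (ball x r) v"
    using dv has_derivative_continuous by (metis continuous_at_imp_continuous_on)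
  have cdv: "continuous_on (ball x r) (\<lambda>y. dv y \<bullet> i)" if "i \<in> Basis" for i
    using d2v[OF _ that] has_derivative_continuous by (metis continuous_at_imp_continuous_on)
  have cc: "continuous_on S (\<lambda>y. cut R (y - x))" "continuous_on S (\<lambda>y. dcut i R (y - x))"
    "continuous_on S (\<lambda>y. d2cut i i R (y - x))" for S i
    by (auto intro!: continuous_on_compose2[OF continuous_cut[of UNIV]] continuous_on_compose2[OF continuous_dcut[of UNIV]]
        continuous_on_compose2[OF continuous_d2cut[of UNIV]] continuous_intros)
  define H where "H i y = v y * d2cut i i R (y - x) - d2v i y i * cut R (y - x)" for i y
  have outside: "cut R (y - x) = 0" "dcut i R (y - x) = 0" "d2cut i i R (y - x) = 0" "lap_cut R (y - x) = 0"
    if "y \<notin> cball x R" for y i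
  proof -
    have "norm (y - x) \<ge> R" using that by (simp add: dist_norm norm_minus_commute)
    then show "cut R (y - x) = 0" "dcut i R (y - x) = 0" "d2cut i i R (y - x) = 0" "lap_cut R (y - x) = 0"
      by (simp_all add: cut_outside[OF R(1)] dcut_outside[OF R(1)] d2cut_outside[OF R(1)] lap_cut_outside[OF R(1)])
  qed
  have cH: "continuous_on (ball x r) (H i)" if "i \<in> Basis" for i
    unfolding H_def using that by (intro continuous_intros cv cont cc)
  have H0: "integral\<^sup>L lborel (H i) = 0" if i: "i \<in> Basis" for i
  proof (rule integral_derivative_compact_support[OF compact_cball sub open_ball])
    fix y
    show "((\<lambda>y. v y * dcut i R (y - x) - dv y \<bullet> i * cut R (y - x)) has_derivative
      (\<lambda>h. (v y * d2cut i h R (y - x) + dv y \<bullet> h * dcut i R (y - x))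
         - (dv y \<bullet> i * dcut h R (y - x) + d2v i y h * cut R (y - x)))) (at y)" if "y \<in> ball x r"
      using dv[OF that] d2v[OF that i]
      by (intro has_derivative_diff has_derivative_mult dcut_has_derivative cut_has_derivative)
    show "(v y * d2cut i i R (y - x) + dv y \<bullet> i * dcut i R (y - x))
         - (dv y \<bullet> i * dcut i R (y - x) + d2v i y i * cut R (y - x)) = H i y"
      by (simp add: H_def)
    assume "y \<notin> cball x R"
    then show "v y * dcut i R (y - x) - dv y \<bullet> i * cut R (y - x) = 0" "H i y = 0"
      using outside(1)[of y] outside(2,3)[of y i] by (simp_all add: H_def)
  qed (rule cH[OF i])
  have intH: "integrable lborel (H i)" if "i \<in> Basis" for i
  proof -
    have "integrable lborel (\<lambda>y. indicator (cball x R) y * H i y)"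
      by (intro integrable_truncate continuous_on_subset[OF cH[OF that] sub] compact_cball)
    also have "(\<lambda>y. indicator (cball x R) y * H i y) = H i"
    proof
      fix y
      show "indicator (cball x R) y * H i y = H i y"
        using outside(1)[of y] outside(2,3)[of y i] by (cases "y \<in> cball x R") (auto simp: H_def)
    qed
    finally show ?thesis .
  qed
  have "(LBINT y. (indicator (cball x R) y * v y) * lap_cut R (y - x)) -
    (LBINT y. (indicator (cball x R) y * (\<Sum>i\<in>Basis. d2v i y i)) * cut R (y - x)) =
    (LBINT y. (indicator (cball x R) y * v y) * lap_cut R (y - x)
       - (indicator (cball x R) y * (\<Sum>i\<in>Basis. d2v i y i)) * cut R (y - x))"
  proof (rule Bochner_Integration.integral_diff[symmetric])
    show "integrable lborel (\<lambda>y. (indicator (cball x R) y * v y) * lap_cut R (y - x))"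
      by (intro integrable_lap_cut_mult integrable_truncate continuous_on_subset[OF cv sub] compact_cball R)
    show "integrable lborel (\<lambda>y. (indicator (cball x R) y * (\<Sum>i\<in>Basis. d2v i y i)) * cut R (y - x))"
      by (intro integrable_cut_mult integrable_truncate compact_cball R continuous_intros
          continuous_on_subset[OF cont sub])
  qed
  also have "\<dots> = (LBINT y. (\<Sum>i\<in>Basis. H i y))"
  proof (intro Bochner_Integration.integral_cong refl)
    fix y
    have "(\<Sum>i\<in>Basis. H i y) = v y * lap_cut R (y - x) - (\<Sum>i\<in>Basis. d2v i y i) * cut R (y - x)"
      unfolding H_def sum_subtractf sum_distrib_left[symmetric] sum_distrib_right[symmetric] sum_d2cut ..
    then show "(indicator (cball x R) y * v y) * lap_cut R (y - x)
       - (indicator (cball x R) y * (\<Sum>i\<in>Basis. d2v i y i)) * cut R (y - x) = (\<Sum>i\<in>Basis. H i y)"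
      using outside[of y] by (cases "y \<in> cball x R") auto
  qed
  also have "\<dots> = 0"
    by (subst Bochner_Integration.integral_sum) (use H0 intH in auto)
  finally show ?thesis by simp
qed

text \<open>Suppose the weak Laplacian \<open>l\<close> of \<open>u - v\<close> were positive at
  \<open>x\<close>, hence nearby. Then the averages of \<open>u - v\<close> about \<open>x\<close>
  strictly increase with the radius, although they start from the value at \<open>x\<close>, which
  is a maximum.\<close>

lemma maximum_principle:
  fixes u v f :: "real^2 \<Rightarrow> real"
  assumes sol: "solves \<Omega> u f" and r: "r > 0" "ball x r \<subseteq> \<Omega>"
    and cu: "continuous_on \<Omega> u" and cf: "continuous_on \<Omega> f"
    and dv: "\<And>y. y \<in> ball x r \<Longrightarrow> (v has_derivative (\<lambda>h. dv y \<bullet> h)) (at y)"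
    and d2v: "\<And>y i. y \<in> ball x r \<Longrightarrow> i \<in> Basis \<Longrightarrow> ((\<lambda>y. dv y \<bullet> i) has_derivative d2v i y) (at y)"
    and cont: "\<And>i. i \<in> Basis \<Longrightarrow> continuous_on (ball x r) (\<lambda>y. d2v i y i)"
    and max: "\<And>y. y \<in> ball x r \<Longrightarrow> u y - v y \<le> u x - v x"
  shows "- f x \<le> (\<Sum>i\<in>Basis. d2v i x i)"
proof (rule ccontr)
  define l where "l y = - f y - (\<Sum>i\<in>Basis. d2v i y i)" for y
  assume "\<not> - f x \<le> (\<Sum>i\<in>Basis. d2v i x i)"
  then have lx: "l x > 0" by (simp add: l_def)
  have cl: "continuous_on (ball x r) l"
    unfolding l_def using r by (intro continuous_intros cont continuous_on_subset[OF cf]) auto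
  have cv: "continuous_on (ball x r) v"
    using dv has_derivative_continuous by (metis continuous_at_imp_continuous_on)
  have "isCont l x"
    using cl r by (simp add: continuous_on_eq_continuous_at)
  then obtain d where d: "d > 0" "\<And>y. dist y x < d \<Longrightarrow> dist (l y) (l x) < l x"
    using lx unfolding continuous_at_eps_delta by meson
  have lpos: "l y > 0" if "y \<in> ball x d" for y
    using d(2)[of y] that by (auto simp: dist_commute[of x] dist_real_def)
  define R where "R = min d r / 2"
  have R: "R > 0" "R < r" "R < d" using d r by (auto simp: R_def)
  have sub: "cball x R \<subseteq> ball x r" using R by auto
  define W where "W y = indicator (cball x R) y * (u y - v y)" for y
  have intW: "integrable lborel W"
    unfolding W_def using r sub
    by (intro integrable_truncate continuous_intros continuous_on_subset[OF cu] continuous_on_subset[OF cv sub] compact_cball) auto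
  have pos: "(LBINT y. W y * lap_cut t (y - x)) > 0" if t: "0 < t" "t \<le> R" for t
  proof -
    have tsub: "cball x t \<subseteq> ball x r" "cball x t \<subseteq> \<Omega>" using t R r by auto
    define I :: "real^2 \<Rightarrow> real" where "I = indicator (cball x t)"
    have Iu: "integrable lborel (\<lambda>y. I y * u y)" "integrable lborel (\<lambda>y. I y * v y)"
      "integrable lborel (\<lambda>y. I y * f y)" "integrable lborel (\<lambda>y. I y * (\<Sum>i\<in>Basis. d2v i y i))"
      "integrable lborel (\<lambda>y. I y * l y)"
      unfolding I_def
      by (intro integrable_truncate compact_cball continuous_intros continuous_on_subset[OF cu tsub(2)]
          continuous_on_subset[OF cv tsub(1)] continuous_on_subset[OF cf tsub(2)]
          continuous_on_subset[OF cont tsub(1)] continuous_on_subset[OF cl tsub(1)]; assumption)+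
    have "(LBINT y. W y * lap_cut t (y - x)) =
        (LBINT y. (I y * u y) * lap_cut t (y - x) - (I y * v y) * lap_cut t (y - x))"
    proof (intro Bochner_Integration.integral_cong refl)
      fix y
      show "W y * lap_cut t (y - x) = (I y * u y) * lap_cut t (y - x) - (I y * v y) * lap_cut t (y - x)"
        using lap_cut_outside[OF t(1) outside_ball, of y x] t
        by (cases "y \<in> ball x t") (auto simp: W_def I_def indicator_def algebra_simps)
    qed
    also have "\<dots> = (LBINT y. (I y * u y) * lap_cut t (y - x)) - (LBINT y. (I y * v y) * lap_cut t (y - x))"
      by (intro Bochner_Integration.integral_diff integrable_lap_cut_mult Iu t)
    also have "(LBINT y. (I y * u y) * lap_cut t (y - x)) = - (LBINT y. (I y * f y) * cut t (y - x))"
      by (rule solves_cut[OF sol t(1) tsub(2)]) (auto simp: I_def)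
    also have "(LBINT y. (I y * v y) * lap_cut t (y - x)) =
        (LBINT y. (I y * (\<Sum>i\<in>Basis. d2v i y i)) * cut t (y - x))"
      unfolding I_def by (rule green_cut[OF t(1) _ dv d2v cont]) (use t R in auto)
    also have "- (LBINT y. (I y * f y) * cut t (y - x)) -
        (LBINT y. (I y * (\<Sum>i\<in>Basis. d2v i y i)) * cut t (y - x)) =
        (LBINT y. - ((I y * f y) * cut t (y - x)) - (I y * (\<Sum>i\<in>Basis. d2v i y i)) * cut t (y - x))"
      by (subst Bochner_Integration.integral_diff)
        (auto intro!: integrable_cut_mult Iu t)
    also have "\<dots> = (LBINT y. (I y * l y) * cut t (y - x))"
      by (intro Bochner_Integration.integral_cong refl) (simp add: l_def algebra_simps)
    finally have eq: "(LBINT y. W y * lap_cut t (y - x)) = (LBINT y. (I y * l y) * cut t (y - x))" .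
    have int: "integrable lborel (\<lambda>y. (I y * l y) * cut t (y - x))"
      by (intro integrable_cut_mult Iu t)
    have nn: "(I y * l y) * cut t (y - x) \<ge> 0" for y
    proof (cases "y \<in> cball x t")
      case True
      then have "l y > 0" using lpos t R by auto
      then show ?thesis by (simp add: I_def cut_bounds)
    qed (simp add: I_def)
    \<comment> \<open>Strict positivity: on the half ball \<open>cut t\<close> is 1 and
      \<open>l\<close> is positive, and that ball is not a null set.\<close>
    have "(LBINT y. (I y * l y) * cut t (y - x)) \<noteq> 0"
    proof
      assume "(LBINT y. (I y * l y) * cut t (y - x)) = 0"
      then have "AE y in lborel. (I y * l y) * cut t (y - x) = 0"
        using integral_nonneg_eq_0_iff_AE[OF int] nn by auto
      then have "AE y in lborel. y \<notin> ball x (t/2)"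
      proof eventually_elim
        case (elim y)
        show "y \<notin> ball x (t/2)"
        proof
          assume y: "y \<in> ball x (t/2)"
          then have "l y > 0" "I y = 1" using lpos t R by (auto simp: I_def)
          moreover have "cut t (y - x) = 1"
            using y by (intro cut_inside t) (auto simp: dist_norm norm_minus_commute)
          ultimately show False using elim by simp
        qed
      qed
      then have "emeasure lborel (ball x (t/2)) = 0"
        by (subst (asm) AE_iff_measurable[of "ball x (t/2)"]) auto
      then show False using t by (simp add: emeasure_ball unit_ball_vol_2)
    qed
    moreover have "(LBINT y. (I y * l y) * cut t (y - x)) \<ge> 0"
      by (rule Bochner_Integration.integral_nonneg[OF nn])
    ultimately show ?thesis using eq by simp
  qed
  have incr: "avg W x s < avg W x t" if "0 < s" "s < t" "t \<le> R" for s t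
  proof (rule DERIV_pos_imp_increasing[OF that(2)])
    fix p assume p: "s \<le> p" "p \<le> t"
    then have "p > 0" "p \<le> R" using that by auto
    then show "\<exists>y. ((\<lambda>R. avg W x R) has_real_derivative y) (at p) \<and> 0 < y"
      using avg_has_derivative[OF intW, of p x] pos[of p]
      by (intro exI[of _ "(LBINT y. W y * lap_cut p (y - x)) / (2 * pi * p)"]) auto
  qed
  have "isCont W x"
  proof -
    have "continuous_on (ball x R) (\<lambda>y. u y - v y)"
      using R r by (intro continuous_intros continuous_on_subset[OF cu] continuous_on_subset[OF cv]) auto
    then have "continuous_on (ball x R) W"
      by (rule continuous_on_eq) (auto simp: W_def)
    then show ?thesis using R by (simp add: continuous_on_eq_continuous_at)
  qed
  then have lim: "((\<lambda>t. avg W x t) \<longlongrightarrow> W x) (at_right 0)"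
    by (rule avg_tendsto[OF intW])
  have "\<forall>\<^sub>F t in at_right 0. avg W x t \<le> avg W x (R/2)"
    unfolding eventually_at_right_field using incr[of _ "R/2"] R
    by (intro exI[of _ "R/2"]) (auto intro: less_imp_le)
  \<comment> \<open>The limit at radius 0 only gives a weak inequality; the intermediate radius
    \<open>R / 2\<close> preserves strictness.\<close>
  then have "W x \<le> avg W x (R/2)"
    using tendsto_upperbound[OF lim] by simp
  also have "\<dots> < avg W x R" using incr[of "R/2" R] R by simp
  also have "avg W x R \<le> W x"
    by (rule avg_le[OF intW R(1)]) (use max R in \<open>auto simp: W_def\<close>)
  finally show False by simp
qed

section \<open>Solutions in the punctured disc\<close>

lemma partial_deriv_mult:
  assumes "Ck (Suc k) \<phi>" "Ck (Suc k) \<psi>"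
  shows "partial_deriv i (\<lambda>x. \<phi> x * \<psi> x) = (\<lambda>x. \<phi> x * partial_deriv i \<psi> x + partial_deriv i \<phi> x * \<psi> x)"
proof
  fix x
  show "partial_deriv i (\<lambda>x. \<phi> x * \<psi> x) x = \<phi> x * partial_deriv i \<psi> x + partial_deriv i \<phi> x * \<psi> x"
    using partial_derivI[OF has_derivative_mult[OF Ck_frechet[OF assms(1)] Ck_frechet[OF assms(2)]]]
    by (simp add: partial_deriv_def)
qed

lemma partial_deriv_add:
  assumes "Ck (Suc k) \<phi>" "Ck (Suc k) \<psi>"
  shows "partial_deriv i (\<lambda>x. \<phi> x + \<psi> x) = (\<lambda>x. partial_deriv i \<phi> x + partial_deriv i \<psi> x)"
proof
  fix x
  show "partial_deriv i (\<lambda>x. \<phi> x + \<psi> x) x = partial_deriv i \<phi> x + partial_deriv i \<psi> x"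
    using partial_derivI[OF has_derivative_add[OF Ck_frechet[OF assms(1)] Ck_frechet[OF assms(2)]]]
    by (simp add: partial_deriv_def)
qed

lemma Ck_partial_deriv: "Ck (Suc k) f \<Longrightarrow> i \<in> Basis \<Longrightarrow> Ck k (partial_deriv i f)"
  by simp

lemma laplacian_mult:
  assumes "Ck 2 \<phi>" "Ck 2 \<psi>"
  shows "laplacian (\<lambda>x. \<phi> x * \<psi> x) x =
    \<phi> x * laplacian \<psi> x + 2 * (\<Sum>i\<in>Basis. partial_deriv i \<phi> x * partial_deriv i \<psi> x) + \<psi> x * laplacian \<phi> x"
proof -
  have 2: "Ck (Suc (Suc 0)) \<phi>" "Ck (Suc (Suc 0)) \<psi>" using assms by (simp_all add: numeral_2_eq_2)
  have 1: "Ck (Suc 0) \<phi>" "Ck (Suc 0) \<psi>" using 2 by (auto intro: Ck_SucD simp del: Ck.simps)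
  have d: "Ck (Suc 0) (partial_deriv i \<phi>)" "Ck (Suc 0) (partial_deriv i \<psi>)" if "i \<in> Basis" for i
    by (rule Ck_partial_deriv[OF 2(1) that] Ck_partial_deriv[OF 2(2) that])+
  have "partial_deriv i (partial_deriv i (\<lambda>x. \<phi> x * \<psi> x)) x = \<phi> x * partial_deriv i (partial_deriv i \<psi>) x
      + 2 * (partial_deriv i \<phi> x * partial_deriv i \<psi> x) + \<psi> x * partial_deriv i (partial_deriv i \<phi>) x"
    if i: "i \<in> Basis" for i
    unfolding partial_deriv_mult[OF 1] partial_deriv_add[OF Ck_mult[OF 1(1) d(2)[OF i]] Ck_mult[OF d(1)[OF i] 1(2)]]
      partial_deriv_mult[OF 1(1) d(2)[OF i]] partial_deriv_mult[OF d(1)[OF i] 1(2)]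
    by simp
  then show ?thesis
    unfolding laplacian_def by (simp add: sum.distrib sum_distrib_left)
qed

lemma Ck_cut: "R > 0 \<Longrightarrow> Ck k (\<lambda>y. cut R (y - x))"
  using cut_test_function(1)[of R x UNIV] by (simp add: test_functions_def)

lemma laplacian_mult_one_minus_cut:
  fixes \<phi> :: "real^2 \<Rightarrow> real"
  assumes "Ck 2 \<phi>" "s > 0"
  shows "laplacian (\<lambda>y. \<phi> y * (1 - cut s y)) y =
    (1 - cut s y) * laplacian \<phi> y - 2 * (\<Sum>i\<in>Basis. partial_deriv i \<phi> y * dcut i s y) - \<phi> y * lap_cut s y"
proof -
  have p1: "partial_deriv i (\<lambda>y. 1 - cut s y) = (\<lambda>y. - dcut i s y)" for i :: "real^2"
    using partial_derivI[OF has_derivative_diff[OF has_derivative_const cut_has_derivative[of s 0]]]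
    by (intro ext) simp
  have p2: "partial_deriv i (\<lambda>y. - dcut i s y) y = - d2cut i i s y" for i :: "real^2"
    using partial_derivI[OF has_derivative_minus[OF dcut_has_derivative[of i s 0]]] by simp
  have "laplacian (\<lambda>y. 1 - cut s y) y = - lap_cut s y"
    unfolding laplacian_def p1 p2 by (simp add: sum_negf sum_d2cut)
  moreover have "Ck 2 (\<lambda>y. 1 - cut s (y::real^2))"
    using Ck_diff[OF Ck_const Ck_cut[OF assms(2), of 2 0]] by simp
  ultimately show ?thesis
    using laplacian_mult[OF assms(1), of "\<lambda>y. 1 - cut s y" y]
    by (simp add: p1 sum_negf)
qed

text \<open>The factor \<open>1 - cut s\<close> vanishes for \<open>norm y \<le> s / 2\<close> and
  so keeps the support away from the origin: the punctured equation can be tested with functions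
  that do not vanish at 0.\<close>

lemma test_function_mult_one_minus_cut:
  fixes \<phi> :: "'a::euclidean_space \<Rightarrow> real"
  assumes "\<phi> \<in> test_functions \<Omega>" "s > 0"
  shows "(\<lambda>y. \<phi> y * (1 - cut s y)) \<in> test_functions (\<Omega> - {0})"
proof -
  have \<phi>: "\<forall>k. Ck k \<phi>" "compact (closure {x. \<phi> x \<noteq> 0})" "closure {x. \<phi> x \<noteq> 0} \<subseteq> \<Omega>"
    using assms(1) by (auto simp: test_functions_def)
  have "Ck k (\<lambda>y. 1 - cut s (y::'a))" for k
    using Ck_diff[OF Ck_const Ck_cut[OF assms(2), of k 0]] by simp
  then have Ck: "\<forall>k. Ck k (\<lambda>y. \<phi> y * (1 - cut s y))" using \<phi>(1) Ck_mult by blast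
  have sub: "{y. \<phi> y * (1 - cut s y) \<noteq> 0} \<subseteq> closure {x. \<phi> x \<noteq> 0} \<inter> {y. s \<le> 2 * norm y}"
  proof
    fix y assume y: "y \<in> {y. \<phi> y * (1 - cut s y) \<noteq> 0}"
    then have "\<phi> y \<noteq> 0" "cut s y \<noteq> 1" by auto
    then show "y \<in> closure {x. \<phi> x \<noteq> 0} \<inter> {y. s \<le> 2 * norm y}"
      using cut_inside[OF assms(2), of y] closure_subset[of "{x. \<phi> x \<noteq> 0}"] by force
  qed
  have "closed (closure {x. \<phi> x \<noteq> 0} \<inter> {y. s \<le> 2 * norm y})"
    by (intro closed_Int closed_closure closed_Collect_le continuous_intros)
  then have cl: "closure {y. \<phi> y * (1 - cut s y) \<noteq> 0} \<subseteq> closure {x. \<phi> x \<noteq> 0} \<inter> {y. s \<le> 2 * norm y}"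
    by (rule closure_minimal[OF sub])
  have "bounded {y. \<phi> y * (1 - cut s y) \<noteq> 0}"
    using bounded_subset[OF compact_imp_bounded[OF \<phi>(2)]] sub by blast
  then have "compact (closure {y. \<phi> y * (1 - cut s y) \<noteq> 0})" by simp
  moreover have "closure {y. \<phi> y * (1 - cut s y) \<noteq> 0} \<subseteq> \<Omega> - {0}"
    using cl \<phi>(3) assms(2) by auto
  ultimately show ?thesis
    using Ck unfolding test_functions_def by blast
qed

text \<open>Discards the value at 0 as well: \<open>u 0\<close> and \<open>g 0\<close> are arbitrary
  and must not enter any integral.\<close>

definition trunc :: "(real^2 \<Rightarrow> real) \<Rightarrow> real^2 \<Rightarrow> real" where
  "trunc h y = indicator (ball 0 1 - {0}) y * h y"

lemma trunc_eq: "y \<in> ball 0 1 - {0} \<Longrightarrow> trunc h y = h y"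
  by (simp add: trunc_def)

lemma trunc_outside: "y \<notin> ball 0 1 - {0} \<Longrightarrow> trunc h y = 0"
  by (auto simp: trunc_def)

lemma trunc_measurable:
  assumes "continuous_on (ball 0 1 - {0}) h"
  shows "trunc h \<in> borel_measurable borel"
  using borel_measurable_continuous_on_indicator[OF _ assms] by (simp add: trunc_def[abs_def])

lemma decay_integrable:
  assumes h: "continuous_on (ball 0 1 - {0}) h" and \<beta>: "0 \<le> \<beta>" "\<beta> < 2"
    and C: "\<And>x. x \<in> ball 0 1 - {0} \<Longrightarrow> \<bar>h x\<bar> \<le> C * norm x powr (- \<beta>)"
  shows "integrable lborel (trunc h)"
    and "R > 0 \<Longrightarrow> (LBINT y:ball x R. \<bar>trunc h y\<bar>) \<le> C * (pi + 2 * pi / (2 - \<beta>)) * R powr (2 - \<beta>)"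
proof -
  note meas = trunc_measurable[OF h]
  \<comment> \<open>The sign of \<open>C\<close> is read off from the hypothesis at one point of the
    punctured disc.\<close>
  have "C \<ge> 0"
  proof -
    have "(1/2) *\<^sub>R axis 1 1 \<in> ball (0::real^2) 1 - {0}" by (simp add: axis_eq_0_iff)
    from C[OF this] have "0 \<le> C * (1/2) powr (- \<beta>)" by simp
    then show ?thesis by (simp add: zero_le_mult_iff)
  qed
  have le: "\<bar>trunc h y\<bar> \<le> C * norm y powr (- \<beta>)" for y
  proof (cases "y \<in> ball 0 1 - {0}")
    case True
    then show ?thesis using C[OF True] by (simp add: trunc_eq)
  next
    case False
    then show ?thesis using \<open>C \<ge> 0\<close> by (simp add: trunc_outside)
  qed
  have int0: "integrable lborel (\<lambda>y. indicator (ball (0::real^2) 1) y * (norm y powr (- \<beta>)))"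
    using norm_powr_ball(1)[of 1 \<beta> 0] \<beta> by (simp add: set_integrable_def)
  show int: "integrable lborel (trunc h)"
  proof (rule Bochner_Integration.integrable_bound)
    show "integrable lborel (\<lambda>y. C * (indicator (ball (0::real^2) 1) y * (norm y powr (- \<beta>))))"
      by (rule integrable_mult_right[OF int0])
    have "norm (trunc h y) \<le> norm (C * (indicator (ball (0::real^2) 1) y * (norm y powr (- \<beta>))))" for y
      using le[of y] \<open>C \<ge> 0\<close> trunc_outside[of y h] by (cases "y \<in> ball 0 1") (auto simp: abs_mult)
    then show "AE y in lborel. norm (trunc h y) \<le> norm (C * (indicator (ball (0::real^2) 1) y * (norm y powr (- \<beta>))))"
      by simp
  qed (use meas in auto)
  assume R: "R > 0"
  have "(LBINT y:ball x R. \<bar>trunc h y\<bar>) \<le> (LBINT y:ball x R. C * norm y powr (- \<beta>))"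
  proof (rule set_integral_mono)
    show "set_integrable lborel (ball x R) (\<lambda>y. \<bar>trunc h y\<bar>)"
      unfolding set_integrable_def by (intro integrable_mult_indicator integrable_abs int) simp
    show "set_integrable lborel (ball x R) (\<lambda>y. C * norm y powr (- \<beta>))"
      by (intro set_integrable_mult_right norm_powr_ball R \<beta>)
  qed (rule le)
  also have "\<dots> = C * (LBINT y:ball x R. norm y powr (- \<beta>))" by simp
  also have "\<dots> \<le> C * ((pi + 2 * pi / (2 - \<beta>)) * R powr (2 - \<beta>))"
    by (intro mult_left_mono norm_powr_ball R \<beta> \<open>C \<ge> 0\<close>)
  finally show "(LBINT y:ball x R. \<bar>trunc h y\<bar>) \<le> C * (pi + 2 * pi / (2 - \<beta>)) * R powr (2 - \<beta>)"
    by (simp add: mult.assoc)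
qed

lemma bounded_away_from_0:
  fixes h :: "real^2 \<Rightarrow> real"
  assumes "continuous_on (cball 0 1 - {0}) h" "r > 0"
  obtains M where "M \<ge> 0" "\<And>x. x \<in> cball 0 1 \<Longrightarrow> norm x \<ge> r \<Longrightarrow> \<bar>h x\<bar> \<le> M"
proof -
  have "compact (cball 0 1 \<inter> {x::real^2. r \<le> norm x})"
    by (intro compact_Int_closed compact_cball closed_Collect_le continuous_intros)
  moreover have "continuous_on (cball 0 1 \<inter> {x::real^2. r \<le> norm x}) h"
    using assms by (intro continuous_on_subset[OF assms(1)]) auto
  ultimately have "bounded (h ` (cball 0 1 \<inter> {x::real^2. r \<le> norm x}))"
    by (intro compact_imp_bounded compact_continuous_image)
  then obtain M where "\<forall>x\<in>cball 0 1 \<inter> {x::real^2. r \<le> norm x}. \<bar>h x\<bar> \<le> M"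
    unfolding bounded_real by blast
  then show thesis by (intro that[of "max M 0"]) (auto simp: le_max_iff_disj)
qed

text \<open>A bound near the origin suffices: away from it, continuity and \<open>norm x powr (- p) \<ge> 1\<close> take over.\<close>

lemma decay_extend:
  fixes h :: "real^2 \<Rightarrow> real"
  assumes h: "continuous_on (cball 0 1 - {0}) h" and "r > 0" "p \<ge> 0"
    and C: "\<And>x. x \<noteq> 0 \<Longrightarrow> norm x \<le> r \<Longrightarrow> \<bar>h x\<bar> \<le> C * norm x powr (- p)"
  obtains C' where "C' \<ge> 0" "\<And>x. x \<in> cball 0 1 - {0} \<Longrightarrow> \<bar>h x\<bar> \<le> C' * norm x powr (- p)"
proof -
  obtain M where M: "M \<ge> 0" "\<And>x. x \<in> cball 0 1 \<Longrightarrow> norm x \<ge> r \<Longrightarrow> \<bar>h x\<bar> \<le> M"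
    using bounded_away_from_0[OF h \<open>r > 0\<close>] by blast
  have "\<bar>h x\<bar> \<le> (\<bar>C\<bar> + M) * norm x powr (- p)" if x: "x \<in> cball 0 1 - {0}" for x
  proof (cases "norm x \<le> r")
    case True
    have "\<bar>h x\<bar> \<le> C * norm x powr (- p)" using C x True by auto
    also have "\<dots> \<le> (\<bar>C\<bar> + M) * norm x powr (- p)" using M(1) by (intro mult_right_mono) auto
    finally show ?thesis .
  next
    case False
    have "1 \<le> norm x powr (- p)"
      using powr_mono2'[of "-p" "norm x" 1] x \<open>p \<ge> 0\<close> by auto
    then have "M * 1 \<le> (\<bar>C\<bar> + M) * norm x powr (- p)" using M(1) by (intro mult_mono) auto
    then show ?thesis using M(2)[of x] x False by auto
  qed
  then show thesis using M(1) by (intro that[of "\<bar>C\<bar> + M"]) auto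
qed

text \<open>\<open>g\<close> is the gradient that \<open>C1_on\<close> supplies, continuous up to
  the unit circle; \<open>grad u\<close>, defined through the full derivative, is identified with it
  only in the open punctured disc.\<close>

locale punctured_solution =
  fixes m a b q :: real and u :: "real^2 \<Rightarrow> real" and g :: "real^2 \<Rightarrow> real^2"
  assumes m: "m > 0" and a: "a > 0" and b: "b > 0" and q: "1 < q" "q < 2"
    and u_cont: "continuous_on (cball 0 1 - {0}) u" and g_cont: "continuous_on (cball 0 1 - {0}) g"
    and u_deriv: "\<And>x. x \<in> ball 0 1 - {0} \<Longrightarrow> (u has_derivative (\<lambda>h. g x \<bullet> h)) (at x)"
    and u_pos: "\<And>x. x \<in> cball 0 1 - {0} \<Longrightarrow> u x > 0"
    and sol: "solves (ball 0 1 - {0}) u (\<lambda>x. m * norm (g x) powr q - a * exp (b * u x))"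
begin

abbreviation \<Omega> :: "(real^2) set" where "\<Omega> \<equiv> ball 0 1 - {0}"

definition f :: "real^2 \<Rightarrow> real" where
  "f x = m * norm (g x) powr q - a * exp (b * u x)"

lemma sol': "solves \<Omega> u f"
  using sol by (simp add: f_def[abs_def])

lemma open_\<Omega>: "open \<Omega>" by auto

lemma \<Omega>_sub: "\<Omega> \<subseteq> cball 0 1 - {0}" using ball_subset_cball by blast

lemma cont_\<Omega>: "continuous_on \<Omega> u" "continuous_on \<Omega> g"
  using continuous_on_subset[OF u_cont \<Omega>_sub] continuous_on_subset[OF g_cont \<Omega>_sub] .

lemma cont_gradq: "continuous_on (cball 0 1 - {0}) (\<lambda>x. norm (g x) powr q)"
  using q by (intro continuous_on_powr' continuous_intros g_cont) auto

lemma cont_expu: "continuous_on (cball 0 1 - {0}) (\<lambda>x. exp (b * u x))"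
  by (intro continuous_intros u_cont)

lemma cont_f: "continuous_on (cball 0 1 - {0}) f"
  unfolding f_def by (intro continuous_intros cont_gradq cont_expu)

lemma cont_f_\<Omega>: "continuous_on \<Omega> f"
  using continuous_on_subset[OF cont_f \<Omega>_sub] .

text \<open>Chosen so that \<open>a * KO\<close> is the sum of \<open>8 / b\<close>, from the
  Laplacian of the comparison function, and \<open>m * (4 / b) powr q\<close>, from its gradient
  term, both in units of \<open>r\<^sup>2 / (s y)\<^sup>2\<close>.\<close>

definition KO where "KO = (8 / b + m * (4 / b) powr q) / a"

lemma KO_pos: "KO > 0"
  unfolding KO_def using m a b by (intro divide_pos_pos add_pos_nonneg) auto

text \<open>Comparison with the boundary blow-up supersolution
  \<open>v y = (ln (KO * r\<^sup>2) - 2 * ln (r\<^sup>2 - \<bar>y - x\<bar>\<^sup>2)) / b\<close>; the gradient term is absorbed because \<open>q < 2\<close>.\<close>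

lemma keller_osserman:
  assumes r: "0 < r" "r \<le> 1" and sub: "cball x r \<subseteq> \<Omega>"
  shows "exp (b * u x) \<le> KO / r\<^sup>2"
proof -
  define s where "s y = r\<^sup>2 - (y - x) \<bullet> (y - x)" for y
  define v where "v y = (ln (KO * r\<^sup>2) - 2 * ln (s y)) / b" for y
  define dv where "dv y = (4 / (b * s y)) *\<^sub>R (y - x)" for y
  define d2v where "d2v i y h = 4 / b * ((h \<bullet> i) / s y + 2 * ((y - x) \<bullet> i) * ((y - x) \<bullet> h) / (s y)\<^sup>2)" for i y h
  have s_pos: "s y > 0" if "y \<in> ball x r" for y
    using that norm_lt_square[of "y - x" r] by (simp add: s_def dist_norm norm_minus_commute)
  have s_le: "s y \<le> r\<^sup>2" for y by (simp add: s_def)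
  have s_deriv: "(s has_derivative (\<lambda>h. - 2 * ((y - x) \<bullet> h))) (at y)" for y
    unfolding s_def[abs_def] by (auto intro!: derivative_eq_intros simp: inner_commute)
  have dv: "(v has_derivative (\<lambda>h. dv y \<bullet> h)) (at y)" if "y \<in> ball x r" for y
  proof -
    have "((\<lambda>y. ln (s y)) has_derivative (\<lambda>h. - 2 * ((y - x) \<bullet> h) * (1 / s y))) (at y)"
      using has_derivative_ln[OF s_pos[OF that] s_deriv] by (simp add: field_simps)
    from has_derivative_mult_right[OF has_derivative_diff[OF has_derivative_const has_derivative_mult_right[OF this, of 2]],
        of "1 / b" "ln (KO * r\<^sup>2)"]
    have "((\<lambda>y. 1 / b * (ln (KO * r\<^sup>2) - 2 * ln (s y))) has_derivative (\<lambda>h. dv y \<bullet> h)) (at y)"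
      by (rule has_derivative_eq_rhs) (simp add: dv_def)
    then show ?thesis by (simp add: v_def[abs_def])
  qed
  have d2v: "((\<lambda>y. dv y \<bullet> i) has_derivative d2v i y) (at y)" if "y \<in> ball x r" for y i
  proof -
    have inv: "((\<lambda>y. inverse (s y)) has_derivative (\<lambda>h. - (inverse (s y) * (- 2 * ((y - x) \<bullet> h)) * inverse (s y)))) (at y)"
      using s_pos[OF that] by (intro Deriv.has_derivative_inverse s_deriv) auto
    have "((\<lambda>y. (y - x) \<bullet> i) has_derivative (\<lambda>h. h \<bullet> i)) (at y)"
      by (auto intro!: derivative_eq_intros)
    from has_derivative_mult_right[OF has_derivative_mult[OF inv this], of "4 / b"]
    have "((\<lambda>y. 4 / b * (inverse (s y) * ((y - x) \<bullet> i))) has_derivative d2v i y) (at y)"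
      by (rule has_derivative_eq_rhs) (use s_pos[OF that] in \<open>simp add: d2v_def fun_eq_iff field_simps power2_eq_square\<close>)
    moreover have "(\<lambda>y. 4 / b * (inverse (s y) * ((y - x) \<bullet> i))) = (\<lambda>y. dv y \<bullet> i)"
      by (simp add: dv_def divide_inverse mult_ac)
    ultimately show ?thesis by simp
  qed
  have cs: "continuous_on S s" for S unfolding s_def[abs_def] by (intro continuous_intros)
  have cd2: "continuous_on (ball x r) (\<lambda>y. d2v i y i)" for i
    unfolding d2v_def using s_pos by (intro continuous_intros cs) (auto simp: less_imp_neq[symmetric])
  have lap: "(\<Sum>i\<in>Basis. d2v i y i) = 8 * r\<^sup>2 / (b * (s y)\<^sup>2)" if "y \<in> ball x r" for y
  proof -
    have "(\<Sum>i\<in>Basis. d2v i y i) = (\<Sum>i\<in>(Basis::(real^2) set). 4 / b * (1 / s y))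
        + 4 / b * 2 / (s y)\<^sup>2 * (\<Sum>i\<in>Basis. ((y - x) \<bullet> i) * ((y - x) \<bullet> i))"
      unfolding sum_distrib_left sum.distrib[symmetric]
      by (intro sum.cong refl) (simp add: d2v_def distrib_left mult.assoc)
    also have "\<dots> = 8 / b * (1 / s y) + 8 / b / (s y)\<^sup>2 * (r\<^sup>2 - s y)"
      unfolding sum_Basis_inner by (simp add: s_def)
    also have "\<dots> = 8 * r\<^sup>2 / (b * (s y)\<^sup>2)"
      using s_pos[OF that] b by (simp add: field_simps power2_eq_square)
    finally show ?thesis .
  qed
  \<comment> \<open>Up to the constant factor \<open>KO * r\<^sup>2\<close> this is
    \<open>exp (b * (u y - v y))\<close>. In this form it is continuous up to the circle, where it
    is 0, so a maximum exists.\<close>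
  have "continuous_on (cball x r) (\<lambda>y. exp (b * u y) * (s y)\<^sup>2)"
    using sub \<Omega>_sub by (intro continuous_intros cs continuous_on_subset[OF u_cont]) auto
  then obtain y where y: "y \<in> cball x r" and ymax: "\<And>z. z \<in> cball x r \<Longrightarrow> exp (b * u z) * (s z)\<^sup>2 \<le> exp (b * u y) * (s y)\<^sup>2"
    using continuous_attains_sup[of "cball x r"] r by fastforce
  have "exp (b * u y) * (s y)\<^sup>2 \<le> KO * r\<^sup>2"
  proof (rule ccontr)
    assume "\<not> exp (b * u y) * (s y)\<^sup>2 \<le> KO * r\<^sup>2"
    then have big: "exp (b * u y) * (s y)\<^sup>2 > KO * r\<^sup>2" by simp
    have "y \<in> ball x r"
    proof (rule ccontr)
      assume "y \<notin> ball x r"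
      then have "norm (y - x) = r" using y by (auto simp: dist_norm norm_minus_commute)
      then have "s y = 0" by (simp add: s_def dot_square_norm)
      moreover have "0 < KO * r\<^sup>2" using KO_pos r by simp
      ultimately show False using big by simp
    qed
    note sy = s_pos[OF this]
    define \<rho> where "\<rho> = r - dist x y"
    have \<rho>: "\<rho> > 0" "ball y \<rho> \<subseteq> ball x r"
      using \<open>y \<in> ball x r\<close> by (auto simp: \<rho>_def ball_subset_ball_iff dist_commute)
    have sub': "ball y \<rho> \<subseteq> \<Omega>" using \<rho>(2) sub ball_subset_cball by blast
    have wmax: "u z - v z \<le> u y - v y" if z: "z \<in> ball x r" for z
    proof -
      have "z \<in> cball x r" using z ball_subset_cball by blast
      then have "ln (exp (b * u z) * (s z)\<^sup>2) \<le> ln (exp (b * u y) * (s y)\<^sup>2)"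
        using ymax s_pos[OF z] sy by (intro ln_mono) auto
      then have "b * u z + 2 * ln (s z) \<le> b * u y + 2 * ln (s y)"
        using s_pos[OF z] sy by (simp add: ln_mult ln_realpow)
      then have "(b * u z + 2 * ln (s z)) / b \<le> (b * u y + 2 * ln (s y)) / b"
        using b by (intro divide_right_mono) auto
      then show ?thesis using b by (simp add: v_def add_divide_distrib diff_divide_distrib)
    qed
    have "- f y \<le> (\<Sum>i\<in>Basis. d2v i y i)"
      by (rule maximum_principle[OF sol' \<rho>(1) sub' cont_\<Omega>(1) cont_f_\<Omega> dv d2v continuous_on_subset[OF cd2 \<rho>(2)] wmax])
        (use \<rho>(2) in blast)+
    then have 1: "a * exp (b * u y) \<le> 8 * r\<^sup>2 / (b * (s y)\<^sup>2) + m * norm (g y) powr q"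
      using lap[OF \<open>y \<in> ball x r\<close>] by (simp add: f_def)
    \<comment> \<open>At the interior maximum the gradients of \<open>u\<close> and \<open>v\<close>
      coincide, which makes the gradient term explicit.\<close>
    have "(\<lambda>h. g y \<bullet> h - dv y \<bullet> h) = (\<lambda>h. 0)"
    proof (rule differential_zero_maxmin[OF \<open>y \<in> ball x r\<close> open_ball])
      show "((\<lambda>z. u z - v z) has_derivative (\<lambda>h. g y \<bullet> h - dv y \<bullet> h)) (at y)"
        using sub y by (intro has_derivative_diff u_deriv dv \<open>y \<in> ball x r\<close>) blast
    qed (use wmax in auto)
    then have "(g y - dv y) \<bullet> (g y - dv y) = 0"
      by (metis inner_diff_left)
    then have gy: "g y = dv y" by simp
    have "norm (g y) powr q \<le> (4 / b) powr q * (r\<^sup>2 / (s y)\<^sup>2)"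
    proof -
      have "norm (g y) = 4 / b * (norm (y - x) / s y)"
        using sy b by (simp add: gy dv_def)
      also have "\<dots> \<le> 4 / b * (r / s y)"
        using \<open>y \<in> ball x r\<close> sy b by (intro mult_left_mono divide_right_mono) (auto simp: dist_norm norm_minus_commute)
      finally have "norm (g y) powr q \<le> (4 / b * (r / s y)) powr q"
        using q by (intro powr_mono2) auto
      also have "\<dots> = (4 / b) powr q * (r / s y) powr q"
        by (rule powr_mult)
      finally have *: "norm (g y) powr q \<le> (4 / b) powr q * (r / s y) powr q" .
      \<comment> \<open>Here \<open>q < 2\<close> and \<open>r \<le> 1\<close> enter:
        \<open>s y \<le> r\<^sup>2 \<le> r\<close>, so the base is at least 1.\<close>
      have "(r / s y) powr q \<le> (r / s y) powr 2"
      proof (rule powr_mono)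
        have "s y \<le> r" using s_le[of y] r power_decreasing[of 1 2 r] by simp
        then show "1 \<le> r / s y" using sy by simp
      qed (use q in auto)
      also have "(r / s y) powr 2 = r\<^sup>2 / (s y)\<^sup>2"
        using r sy by (simp add: power_divide)
      finally have "(4 / b) powr q * (r / s y) powr q \<le> (4 / b) powr q * (r\<^sup>2 / (s y)\<^sup>2)"
        by (intro mult_left_mono) auto
      with * show ?thesis by linarith
    qed
    then have "m * norm (g y) powr q \<le> m * ((4 / b) powr q * (r\<^sup>2 / (s y)\<^sup>2))"
      using m by (intro mult_left_mono) auto
    with 1 have "a * exp (b * u y) \<le> 8 / b * (r\<^sup>2 / (s y)\<^sup>2) + m * (4 / b) powr q * (r\<^sup>2 / (s y)\<^sup>2)"
      using b by simp
    also have "\<dots> = a * KO * (r\<^sup>2 / (s y)\<^sup>2)"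
    proof -
      have "a * KO = 8 / b + m * (4 / b) powr q" using a by (simp add: KO_def)
      then show ?thesis by (simp only: distrib_right)
    qed
    finally have "a * exp (b * u y) \<le> a * (KO * (r\<^sup>2 / (s y)\<^sup>2))"
      by (simp only: mult.assoc)
    then have "exp (b * u y) \<le> KO * (r\<^sup>2 / (s y)\<^sup>2)"
      using a by (simp only: mult_le_cancel_left_pos)
    then have "exp (b * u y) * (s y)\<^sup>2 \<le> KO * r\<^sup>2"
      using sy by (simp add: field_simps)
    then show False using big by simp
  qed
  \<comment> \<open>At the centre \<open>s x = r\<^sup>2\<close>; dividing by its square turns
    \<open>KO * r\<^sup>2\<close> into \<open>KO / r\<^sup>2\<close>.\<close>
  moreover have "exp (b * u x) * (s x)\<^sup>2 \<le> exp (b * u y) * (s y)\<^sup>2"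
    using ymax[of x] r by simp
  ultimately have "exp (b * u x) * r\<^sup>2 * r\<^sup>2 \<le> KO * r\<^sup>2"
    by (simp add: s_def power2_eq_square mult.assoc)
  moreover have "r\<^sup>2 > 0" using r by simp
  ultimately have "exp (b * u x) * r\<^sup>2 \<le> KO" by (rule mult_right_le_imp_le)
  then show ?thesis using r by (simp add: pos_le_divide_eq)
qed

end

section \<open>Decay of the gradient\<close>

lemma ln_inverse_le_powr:
  assumes "0 < r" "r \<le> 1" "0 < (e::real)"
  shows "ln (1 / r) \<le> r powr (- e) / e"
  using ln_powr_bound[of "1 / r" e] assms by (simp add: powr_minus powr_divide divide_simps)

context punctured_solution
begin

lemma half_ball_sub:
  assumes "x \<noteq> 0" "norm x \<le> 1/2"
  shows "cball x (norm x / 2) \<subseteq> \<Omega>"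
    and "y \<in> cball x (norm x / 2) \<Longrightarrow> norm x / 2 \<le> norm y \<and> norm y \<le> 3 / 2 * norm x"
proof -
  show *: "norm x / 2 \<le> norm y \<and> norm y \<le> 3 / 2 * norm x" if "y \<in> cball x (norm x / 2)" for y
    using that norm_triangle_ineq2[of x y] norm_triangle_ineq2[of y x]
    by (auto simp: dist_norm norm_minus_commute)
  have "norm x > 0" using assms by simp
  show "cball x (norm x / 2) \<subseteq> \<Omega>"
  proof
    fix y assume "y \<in> cball x (norm x / 2)"
    from *[OF this] have "norm y < 1" "norm y > 0" using assms \<open>norm x > 0\<close> by linarith+
    then show "y \<in> \<Omega>" by auto
  qed
qed

lemma expu_bound:
  assumes "x \<noteq> 0" "norm x \<le> 1/2"
  shows "exp (b * u x) \<le> 4 * KO / (norm x)\<^sup>2"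
  using keller_osserman[of "norm x / 2" x] half_ball_sub(1)[OF assms] assms
  by (simp add: power_divide mult.commute)

lemma u_bound:
  assumes "x \<noteq> 0" "norm x \<le> 1/2"
  shows "u x \<le> (ln (4 * KO) + 2 * ln (1 / norm x)) / b"
proof -
  have "b * u x = ln (exp (b * u x))" by simp
  also have "\<dots> \<le> ln (4 * KO / (norm x)\<^sup>2)"
    using expu_bound[OF assms] by (intro ln_mono) auto
  also have "\<dots> = ln (4 * KO) + 2 * ln (1 / norm x)"
    using KO_pos assms by (simp add: ln_div ln_realpow)
  finally show ?thesis using b by (simp add: pos_le_divide_eq mult.commute)
qed

lemma abs_f_le: "\<bar>f x\<bar> \<le> m * norm (g x) powr q + a * exp (b * u x)"
proof -
  have "m * norm (g x) powr q \<ge> 0" "a * exp (b * u x) \<ge> 0" using m a by auto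
  then show ?thesis unfolding f_def by linarith
qed

text \<open>Weighted interior estimate: maximise \<open>(r - \<bar>y - x\<bar>) * \<bar>g y\<bar>\<close> and apply the gradient estimate at the
  maximum \<open>N\<close> on a ball of relative radius \<open>\<theta> ~ N powr (1 - q)\<close>, so that the reaction term is absorbed.\<close>

lemma interior_gradient:
  assumes M: "M \<ge> 0"
  obtains C where "C > 0" "\<And>x r L. 0 < r \<Longrightarrow> r \<le> 1 \<Longrightarrow> cball x r \<subseteq> \<Omega> \<Longrightarrow> L \<ge> 1 \<Longrightarrow>
    (\<And>y. y \<in> cball x r \<Longrightarrow> u y \<le> L) \<Longrightarrow> (\<And>y. y \<in> cball x r \<Longrightarrow> exp (b * u y) \<le> M / r\<^sup>2) \<Longrightarrow>
    r * norm (g x) \<le> C * L powr (1 / (2 - q))"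
proof -
  obtain C1 where C1: "C1 > 0" and grad_est: "\<And>\<Omega> u g f x R L F. solves \<Omega> u f \<Longrightarrow> open \<Omega> \<Longrightarrow> R > 0 \<Longrightarrow> cball x R \<subseteq> \<Omega> \<Longrightarrow>
    (\<And>y. y \<in> \<Omega> \<Longrightarrow> (u has_derivative (\<lambda>h. g y \<bullet> h)) (at y)) \<Longrightarrow> continuous_on \<Omega> g \<Longrightarrow> continuous_on \<Omega> f \<Longrightarrow>
    (\<And>y. y \<in> ball x R \<Longrightarrow> \<bar>u y\<bar> \<le> L) \<Longrightarrow> (\<And>y. y \<in> ball x R \<Longrightarrow> \<bar>f y\<bar> \<le> F) \<Longrightarrow>
    norm (g x) \<le> C1 * (L / R + R * F)"
    by (rule gradient_estimate) blast
  \<comment> \<open>\<open>A\<close> dominates the coefficient of the gradient term, so that the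
    choice \<open>\<theta> = 1 / (2 * A * P)\<close> makes its contribution at most
    \<open>N / 2\<close>. \<open>D\<close> collects what remains once that half is absorbed on the
    left.\<close>
  define A where "A = max 1 (C1 * (m * 2 powr q))"
  define D where "D = 4 * C1 * A + 2 * C1 * a * M + 1"
  have A: "A \<ge> 1" "C1 * (m * 2 powr q) \<le> A" by (auto simp: A_def)
  have D1: "D \<ge> 1" using C1 A(1) a M by (simp add: D_def)
  show thesis
  proof (rule that[of "D powr (1 / (2 - q))"])
    show "D powr (1 / (2 - q)) > 0" using D1 by simp
    fix x r L
    assume r: "0 < r" "r \<le> 1" and sub: "cball x r \<subseteq> \<Omega>" and L: "L \<ge> 1"
      and uL: "\<And>y. y \<in> cball x r \<Longrightarrow> u y \<le> L" and eM: "\<And>y. y \<in> cball x r \<Longrightarrow> exp (b * u y) \<le> M / r\<^sup>2"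
    have "continuous_on (cball x r) (\<lambda>y. (r - dist x y) * norm (g y))"
      by (intro continuous_intros continuous_on_subset[OF cont_\<Omega>(2) sub])
    then obtain y where y: "y \<in> cball x r" and
      ymax: "\<And>z. z \<in> cball x r \<Longrightarrow> (r - dist x z) * norm (g z) \<le> (r - dist x y) * norm (g y)"
      using continuous_attains_sup[of "cball x r"] r by fastforce
    define d where "d = r - dist x y"
    define N where "N = d * norm (g y)"
    have N: "(r - dist x z) * norm (g z) \<le> N" if "z \<in> cball x r" for z
      using ymax[OF that] by (simp add: N_def d_def)
    have "r * norm (g x) \<le> N" using N[of x] r by simp
    also have "N \<le> (D * L) powr (1 / (2 - q))"
    \<comment> \<open>Small \<open>N\<close> is within the bound already, since
      \<open>D * L \<ge> 1\<close>; for \<open>N > 1\<close> the power \<open>P\<close> is at least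
      1, which keeps \<open>\<theta>\<close> at most 1/2.\<close>
    proof (cases "N \<le> 1")
      case True
      have "1 * 1 \<le> D * L" using D1 L by (intro mult_mono) auto
      then have "1 \<le> (D * L) powr (1 / (2 - q))" using q by (intro ge_one_powr_ge_zero) auto
      then show ?thesis using True by linarith
    next
      case False
      then have N1: "N > 1" by simp
      have "d \<ge> 0" using y by (simp add: d_def)
      then have d: "0 < d" "d \<le> r" using N1 unfolding N_def by (auto simp: d_def less_le)
      define P where "P = N powr (q - 1)"
      have P: "P \<ge> 1" unfolding P_def using N1 q by (intro ge_one_powr_ge_zero) auto
      define \<theta> where "\<theta> = 1 / (2 * A * P)"
      have AP: "A * P \<ge> 1" using mult_mono[of 1 A 1 P] A P by simp
      then have \<theta>: "0 < \<theta>" "\<theta> \<le> 1/2" unfolding \<theta>_def by (auto simp: field_simps)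
      define R where "R = \<theta> * d"
      have R: "0 < R" "R \<le> d / 2" using \<theta> d mult_right_mono[of \<theta> "1/2" d] by (auto simp: R_def)
      define F0 where "F0 = m * (2 * N / d) powr q + a * (M / r\<^sup>2)"
      \<comment> \<open>Within distance \<open>R \<le> d / 2\<close> of \<open>y\<close> the weight
        is still at least \<open>d / 2\<close>, so maximality gives
        \<open>norm (g z) \<le> 2 * N / d\<close> there.\<close>
      have ball: "z \<in> cball x r" "d / 2 \<le> r - dist x z" if "z \<in> cball y R" for z
        using that R dist_triangle[of x z y] by (auto simp: d_def)
      have "norm (g y) \<le> C1 * (L / R + R * F0)"
      proof (rule grad_est[OF sol' open_\<Omega> R(1) _ u_deriv cont_\<Omega>(2) cont_f_\<Omega>])
        show "cball y R \<subseteq> \<Omega>" using ball(1) sub by blast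
        fix z assume "z \<in> ball y R"
        then have z: "z \<in> cball y R" using ball_subset_cball by blast
        have "z \<in> \<Omega>" using ball(1)[OF z] sub by blast
        then have "u z > 0" using u_pos \<Omega>_sub by blast
        then show "\<bar>u z\<bar> \<le> L" using uL[OF ball(1)[OF z]] by simp
        have "d / 2 * norm (g z) \<le> N"
          using N[OF ball(1)[OF z]] mult_right_mono[OF ball(2)[OF z], of "norm (g z)"] by simp
        then have "norm (g z) \<le> 2 * N / d" using d by (simp add: field_simps)
        then have "m * norm (g z) powr q \<le> m * (2 * N / d) powr q"
          using m q by (intro mult_left_mono powr_mono2) auto
        moreover have "a * exp (b * u z) \<le> a * (M / r\<^sup>2)"
          using a eM[OF ball(1)[OF z]] by (intro mult_left_mono) auto
        ultimately show "\<bar>f z\<bar> \<le> F0" using abs_f_le[of z] by (simp add: F0_def)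
      qed
      then have "N \<le> d * (C1 * (L / R + R * F0))"
        unfolding N_def using d by (intro mult_left_mono) auto
      also have "\<dots> = C1 * (L / \<theta>) + C1 * (\<theta> * (d\<^sup>2 * F0))"
        using d \<theta> by (simp add: R_def field_simps power2_eq_square)
      also have "d\<^sup>2 * F0 \<le> m * 2 powr q * (N * P) + a * M"
      proof -
        have "d\<^sup>2 * (2 * N / d) powr q = d powr (2 - q) * (2 * N) powr q"
          using d N1 by (simp add: powr_divide powr_diff)
        also have "\<dots> \<le> 1 * (2 * N) powr q"
          using d r q by (intro mult_right_mono powr_le1) auto
        also have "\<dots> = 2 powr q * (N * P)"
        proof -
          have "N * P = N powr q" using N1 by (simp add: P_def powr_diff)
          then show ?thesis using N1 by (simp add: powr_mult)
        qed
        finally have 1: "m * (d\<^sup>2 * (2 * N / d) powr q) \<le> m * (2 powr q * (N * P))"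
          using m by (intro mult_left_mono) auto
        have "d\<^sup>2 / r\<^sup>2 \<le> 1" using d by (simp add: power_mono)
        then have "a * M * (d\<^sup>2 / r\<^sup>2) \<le> a * M * 1" using a M by (intro mult_left_mono) auto
        with 1 show ?thesis by (simp add: F0_def algebra_simps)
      qed
      then have "C1 * (L / \<theta>) + C1 * (\<theta> * (d\<^sup>2 * F0)) \<le> C1 * (L / \<theta>) + C1 * (\<theta> * (m * 2 powr q * (N * P) + a * M))"
        using C1 \<theta> by (intro add_left_mono mult_left_mono) auto
      also have "\<dots> = 2 * C1 * A * (L * P) + \<theta> * (C1 * (m * 2 powr q)) * (N * P) + \<theta> * (C1 * a * M)"
        using A P by (simp add: \<theta>_def field_simps)
      also have "\<dots> \<le> 2 * C1 * A * (L * P) + N / 2 + C1 * a * M"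
      proof (intro add_mono order_refl)
        have "\<theta> * (C1 * (m * 2 powr q)) * (N * P) \<le> \<theta> * A * (N * P)"
          using \<theta> A(2) N1 P by (intro mult_right_mono mult_left_mono) auto
        also have "\<dots> = N / 2" using A P by (simp add: \<theta>_def field_simps)
        finally show "\<theta> * (C1 * (m * 2 powr q)) * (N * P) \<le> N / 2" .
        show "\<theta> * (C1 * a * M) \<le> C1 * a * M"
          using \<theta> C1 a M by (intro mult_left_le_one_le) auto
      qed
      finally have "N \<le> 4 * C1 * A * (L * P) + 2 * C1 * a * M * 1" by simp
      also have "\<dots> \<le> 4 * C1 * A * (L * P) + 2 * C1 * a * M * (L * P)"
        using C1 a M mult_mono[of 1 L 1 P] L P by (intro add_left_mono mult_left_mono) auto
      also have "\<dots> \<le> D * (L * P)" using L P by (simp add: D_def algebra_simps)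
      finally have "N \<le> (D * L) * P" by (simp add: mult.assoc)
      \<comment> \<open>Cancelling \<open>P\<close> leaves the power \<open>2 - q\<close> of
        \<open>N\<close>, which is positive and therefore bounds \<open>N\<close>.\<close>
      moreover have "N = N powr (2 - q) * P" using N1 by (simp add: P_def flip: powr_add)
      ultimately have "N powr (2 - q) * P \<le> (D * L) * P" by simp
      then have "N powr (2 - q) \<le> D * L" using P by (simp only: mult_le_cancel_right)
      then have "(N powr (2 - q)) powr (1 / (2 - q)) \<le> (D * L) powr (1 / (2 - q))"
        using q by (intro powr_mono2) auto
      then show ?thesis using q N1 by (simp add: powr_powr)
    qed
    also have "\<dots> = D powr (1 / (2 - q)) * L powr (1 / (2 - q))"
      by (rule powr_mult)
    finally show "r * norm (g x) \<le> D powr (1 / (2 - q)) * L powr (1 / (2 - q))" .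
  qed
qed

text \<open>For \<open>norm x \<le> 1/3\<close> the points of the half ball have norm at most 3/2 *
  1/3 = 1/2, where \<open>expu_bound\<close> applies.\<close>

lemma expu_half_ball:
  assumes "x \<noteq> 0" "norm x \<le> 1/3" "y \<in> cball x (norm x / 2)"
  shows "exp (b * u y) \<le> 4 * KO / (norm x / 2)\<^sup>2"
proof -
  have y: "norm x / 2 \<le> norm y" "norm y \<le> 1/2" "y \<noteq> 0"
    using half_ball_sub(2)[of x y] assms by auto
  have "exp (b * u y) \<le> 4 * KO / (norm y)\<^sup>2" by (rule expu_bound[OF y(3,2)])
  also have "\<dots> \<le> 4 * KO / (norm x / 2)\<^sup>2"
    using y assms KO_pos by (intro divide_left_mono power_mono) auto
  finally show ?thesis .
qed

lemma grad_decay: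
  assumes p: "p > 1"
  obtains C where "C \<ge> 0" "\<And>x. x \<in> cball 0 1 - {0} \<Longrightarrow> norm (g x) \<le> C * norm x powr (- p)"
proof -
  have "4 * KO \<ge> 0" using KO_pos by simp
  then obtain C where C: "C > 0" and grad: "\<And>x r L. 0 < r \<Longrightarrow> r \<le> 1 \<Longrightarrow> cball x r \<subseteq> \<Omega> \<Longrightarrow> L \<ge> 1 \<Longrightarrow>
    (\<And>y. y \<in> cball x r \<Longrightarrow> u y \<le> L) \<Longrightarrow> (\<And>y. y \<in> cball x r \<Longrightarrow> exp (b * u y) \<le> 4 * KO / r\<^sup>2) \<Longrightarrow>
    r * norm (g x) \<le> C * L powr (1 / (2 - q))"
    by (rule interior_gradient) blast
  \<comment> \<open>The logarithmic bound on \<open>u\<close> is traded for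
    \<open>r powr (- e)\<close>, which after raising to the power \<open>1 / (2 - q)\<close> is
    exactly \<open>r powr (- (p - 1))\<close>.\<close>
  define e where "e = (p - 1) * (2 - q)"
  have e: "e > 0" using p q by (simp add: e_def)
  define c where "c = 1 + (\<bar>ln (4 * KO)\<bar> + 2 / e) / b"
  have c: "c \<ge> 1" using b e by (simp add: c_def)
  have near: "\<bar>norm (g x)\<bar> \<le> (C * c powr (1 / (2 - q)) * 2 powr p) * norm x powr (- p)" if x: "x \<noteq> 0" "norm x \<le> 1/3" for x
  proof -
    define r where "r = norm x / 2"
    have r: "0 < r" "r \<le> 1" using x by (auto simp: r_def)
    have re: "1 \<le> r powr (- e)" using r e powr_mono2'[of "-e" r 1] by simp
    have "r * norm (g x) \<le> C * (c * r powr (- e)) powr (1 / (2 - q))"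
    proof (rule grad[OF r])
      show "cball x r \<subseteq> \<Omega>" unfolding r_def using half_ball_sub(1) x by auto
      show "1 \<le> c * r powr (- e)" using mult_mono[OF c re] c by simp
      fix y assume "y \<in> cball x r"
      then have y: "y \<in> cball x (norm x / 2)" by (simp add: r_def)
      then show "exp (b * u y) \<le> 4 * KO / r\<^sup>2" unfolding r_def by (rule expu_half_ball[OF x])
      have ny: "r \<le> norm y" "norm y \<le> 1/2" "y \<noteq> 0"
        using half_ball_sub(2)[of x y] x y by (auto simp: r_def)
      have "ln (1 / norm y) \<le> ln (1 / r)" using ny r by (intro ln_mono divide_left_mono) auto
      also have "\<dots> \<le> r powr (- e) / e" using ln_inverse_le_powr[OF r e] .
      finally have "ln (4 * KO) + 2 * ln (1 / norm y) \<le> \<bar>ln (4 * KO)\<bar> * r powr (- e) + 2 / e * r powr (- e)"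
        using mult_left_mono[OF re, of "\<bar>ln (4 * KO)\<bar>"] by simp
      then have "(ln (4 * KO) + 2 * ln (1 / norm y)) / b \<le> (\<bar>ln (4 * KO)\<bar> * r powr (- e) + 2 / e * r powr (- e)) / b"
        using b by (intro divide_right_mono) auto
      also have "\<dots> \<le> c * r powr (- e)"
        by (simp add: c_def algebra_simps add_divide_distrib)
      finally show "u y \<le> c * r powr (- e)" using u_bound[OF ny(3,2)] by linarith
    qed
    also have "(c * r powr (- e)) powr (1 / (2 - q)) = c powr (1 / (2 - q)) * r powr (- (p - 1))"
    proof -
      have "(c * r powr (- e)) powr (1 / (2 - q)) = c powr (1 / (2 - q)) * (r powr (- e)) powr (1 / (2 - q))"
        by (rule powr_mult)
      moreover have "- e * (1 / (2 - q)) = - (p - 1)" using q by (simp add: e_def)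
      ultimately show ?thesis by (simp only: powr_powr)
    qed
    finally have "norm (g x) \<le> C * c powr (1 / (2 - q)) * (r powr (- (p - 1)) / r)"
      using r by (simp add: field_simps)
    also have "r powr (- (p - 1)) / r = r powr (- p)"
      using r by (simp add: powr_diff powr_minus field_simps)
    also have "\<dots> = 2 powr p * norm x powr (- p)"
      by (simp add: r_def powr_divide powr_minus field_simps)
    finally show ?thesis by (simp add: mult.assoc)
  qed
  obtain C' where "C' \<ge> 0" "\<And>x. x \<in> cball 0 1 - {0} \<Longrightarrow> \<bar>norm (g x)\<bar> \<le> C' * norm x powr (- p)"
    by (rule decay_extend[of "\<lambda>x. norm (g x)" "1/3" p "C * c powr (1 / (2 - q)) * 2 powr p"])
      (use near p in \<open>auto intro!: continuous_intros g_cont\<close>)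
  then show thesis by (intro that[of C']) auto
qed

text \<open>Take \<open>p = \<beta> / q > 1\<close> in \<open>grad_decay\<close>. As
  \<open>q < 2\<close>, some admissible \<open>\<beta>\<close> lies below 2, the threshold of
  integrability in the plane.\<close>

lemma gradq_decay:
  assumes "q < \<beta>"
  obtains C where "C \<ge> 0" "\<And>x. x \<in> cball 0 1 - {0} \<Longrightarrow> \<bar>norm (g x) powr q\<bar> \<le> C * norm x powr (- \<beta>)"
proof -
  have "\<beta> / q > 1" using assms q by simp
  then obtain C where C: "C \<ge> 0" "\<And>x. x \<in> cball 0 1 - {0} \<Longrightarrow> norm (g x) \<le> C * norm x powr (- (\<beta> / q))"
    using grad_decay by blast
  have "norm (g x) powr q \<le> C powr q * norm x powr (- \<beta>)" if "x \<in> cball 0 1 - {0}" for x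
  proof -
    have "norm (g x) powr q \<le> (C * norm x powr (- (\<beta> / q))) powr q"
      using C(2)[OF that] q by (intro powr_mono2) auto
    also have "\<dots> = C powr q * (norm x powr (- (\<beta> / q))) powr q"
      by (rule powr_mult)
    also have "\<dots> = C powr q * norm x powr (- \<beta>)"
      using q by (simp add: powr_powr)
    finally show ?thesis .
  qed
  then show thesis by (intro that[of "C powr q"]) auto
qed

lemma u_decay:
  assumes p: "p > 0"
  obtains C where "C \<ge> 0" "\<And>x. x \<in> cball 0 1 - {0} \<Longrightarrow> \<bar>u x\<bar> \<le> C * norm x powr (- p)"
proof -
  have near: "\<bar>u x\<bar> \<le> ((\<bar>ln (4 * KO)\<bar> + 2 / p) / b) * norm x powr (- p)" if x: "x \<noteq> 0" "norm x \<le> 1/2" for x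
  proof -
    have re: "1 \<le> norm x powr (- p)" using x p powr_mono2'[of "-p" "norm x" 1] by simp
    have "ln (1 / norm x) \<le> norm x powr (- p) / p"
      using x p by (intro ln_inverse_le_powr) auto
    then have "ln (4 * KO) + 2 * ln (1 / norm x) \<le> \<bar>ln (4 * KO)\<bar> * norm x powr (- p) + 2 / p * norm x powr (- p)"
      using mult_left_mono[OF re, of "\<bar>ln (4 * KO)\<bar>"] by simp
    then have "(ln (4 * KO) + 2 * ln (1 / norm x)) / b \<le> (\<bar>ln (4 * KO)\<bar> * norm x powr (- p) + 2 / p * norm x powr (- p)) / b"
      using b by (intro divide_right_mono) auto
    then have "u x \<le> ((\<bar>ln (4 * KO)\<bar> + 2 / p) / b) * norm x powr (- p)"
      using u_bound[OF x] by (simp add: algebra_simps add_divide_distrib)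
    moreover have "u x > 0" using u_pos[of x] x by simp
    ultimately show ?thesis by simp
  qed
  obtain C' where "C' \<ge> 0" "\<And>x. x \<in> cball 0 1 - {0} \<Longrightarrow> \<bar>u x\<bar> \<le> C' * norm x powr (- p)"
    by (rule decay_extend[OF u_cont, of "1/2" p "(\<bar>ln (4 * KO)\<bar> + 2 / p) / b"]) (use near p in auto)
  then show thesis by (intro that[of C']) auto
qed

lemma trunc_u_integrable: "integrable lborel (trunc u)"
proof -
  obtain C where "C \<ge> 0" "\<And>x. x \<in> cball 0 1 - {0} \<Longrightarrow> \<bar>u x\<bar> \<le> C * norm x powr (- 1)"
    using u_decay[of 1] by auto
  then show ?thesis
    using \<Omega>_sub by (intro decay_integrable(1)[OF cont_\<Omega>(1), of 1 C]) auto
qed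

lemma trunc_gradq_integrable: "integrable lborel (trunc (\<lambda>x. norm (g x) powr q))"
proof -
  define \<beta> where "\<beta> = (q + 2) / 2"
  have \<beta>: "q < \<beta>" "\<beta> < 2" "0 \<le> \<beta>" using q by (auto simp: \<beta>_def)
  obtain C where "C \<ge> 0" "\<And>x. x \<in> cball 0 1 - {0} \<Longrightarrow> \<bar>norm (g x) powr q\<bar> \<le> C * norm x powr (- \<beta>)"
    using gradq_decay[OF \<beta>(1)] by blast
  then show ?thesis
    using \<Omega>_sub \<beta> by (intro decay_integrable(1)[OF continuous_on_subset[OF cont_gradq \<Omega>_sub], of \<beta> C]) auto
qed

end

section \<open>The flux at the origin\<close>

lemma integrable_trunc_mult:
  assumes h: "integrable lborel (trunc h)" and k: "continuous_on UNIV k"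
  shows "integrable lborel (\<lambda>y. trunc h y * k y)"
proof -
  have "bounded (k ` cball 0 1)"
    by (intro compact_imp_bounded compact_continuous_image continuous_on_subset[OF k]) auto
  then obtain B where "\<forall>y\<in>cball 0 1. \<bar>k y\<bar> \<le> B" unfolding bounded_real by blast
  then have B: "\<bar>k y\<bar> \<le> \<bar>B\<bar>" if "y \<in> cball 0 1" for y using that by fastforce
  have "integrable lborel (\<lambda>y. trunc h y * (indicator (cball 0 1) y * k y))"
  proof (rule integrable_mult_bounded[OF h])
    show "(\<lambda>y. indicator (cball 0 1) y * k y) \<in> borel_measurable lborel"
      using borel_measurable_continuous_onI[OF k] by (intro borel_measurable_times borel_measurable_indicator) auto
    show "\<bar>indicator (cball 0 1) y * k y\<bar> \<le> \<bar>B\<bar>" for y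
      using B[of y] by (auto simp: indicator_def)
  qed
  moreover have "(\<lambda>y. trunc h y * (indicator (cball 0 1) y * k y)) = (\<lambda>y. trunc h y * k y)"
    by (auto simp: trunc_def fun_eq_iff indicator_def)
  ultimately show ?thesis by simp
qed

text \<open>Serves \<open>exp (b * u)\<close> while its integrability at the origin is still
  unknown: with a weight that vanishes near 0, boundedness on an annulus is enough.\<close>

lemma integrable_trunc_mult_away:
  assumes h: "continuous_on (cball 0 1 - {0}) h" and k: "continuous_on UNIV k" and r: "r > 0"
    and zero: "\<And>y. norm y < r \<Longrightarrow> k y = 0"
  shows "integrable lborel (\<lambda>y. trunc h y * k y)"
proof -
  obtain M where M: "M \<ge> 0" "\<And>x. x \<in> cball 0 1 \<Longrightarrow> norm x \<ge> r \<Longrightarrow> \<bar>h x\<bar> \<le> M"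
    using bounded_away_from_0[OF h r] by blast
  have "continuous_on (ball 0 1 - {0}) h" using ball_subset_cball by (intro continuous_on_subset[OF h]) blast
  note mh = trunc_measurable[OF this]
  have "continuous_on (ball 0 1 - {0}) (\<lambda>_::real^2. 1::real)" by simp
  from trunc_measurable[OF this] have 1: "integrable lborel (trunc (\<lambda>_. M))"
    using decay_integrable(1)[of "\<lambda>_. M" 0 M] M(1) by (auto simp: powr_zero_eq_one)
  show ?thesis
  proof (rule Bochner_Integration.integrable_bound)
    show "integrable lborel (\<lambda>y. trunc (\<lambda>_. M) y * k y)" by (rule integrable_trunc_mult[OF 1 k])
    show "(\<lambda>y. trunc h y * k y) \<in> borel_measurable lborel"
      using mh borel_measurable_continuous_onI[OF k] by auto
    have "norm (trunc h y * k y) \<le> norm (trunc (\<lambda>_. M) y * k y)" for y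
    proof (cases "norm y < r \<or> y \<notin> ball 0 1 - {0}")
      case False
      then have "\<bar>h y\<bar> * \<bar>k y\<bar> \<le> M * \<bar>k y\<bar>" using M(2)[of y] by (intro mult_right_mono) auto
      then show ?thesis using False M(1) by (simp add: trunc_eq abs_mult)
    qed (auto simp: zero trunc_outside)
    then show "AE y in lborel. norm (trunc h y * k y) \<le> norm (trunc (\<lambda>_. M) y * k y)" by simp
  qed
qed

lemma cut_mono: "0 < s \<Longrightarrow> s \<le> t \<Longrightarrow> cut s y \<le> cut t y"
  unfolding cut_def by (intro cutoff_antimono divide_left_mono power_mono) auto

lemma one_minus_cut_tendsto:
  assumes "y \<noteq> 0"
  shows "((\<lambda>s. 1 - cut s y) \<longlongrightarrow> 1) (at_right 0)"
proof -
  have "\<forall>\<^sub>F s in at_right 0. 1 - cut s y = 1"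
    unfolding eventually_at_right_field
    using assms by (intro exI[of _ "norm y"]) (auto simp: cut_outside)
  then show ?thesis by (rule tendsto_eventually)
qed

text \<open>Dominated convergence, since \<open>1 - cut s\<close> lies between 0 and 1; this is how
  the cutoff at the origin is removed.\<close>

lemma trunc_cutoff_tendsto:
  assumes h: "integrable lborel (trunc h)" and k: "continuous_on UNIV k"
  shows "((\<lambda>s. LBINT y. trunc h y * (k y * (1 - cut s y))) \<longlongrightarrow> (LBINT y. trunc h y * k y)) (at_right 0)"
proof (rule integral_tendsto_at_within[where w="\<lambda>y. \<bar>trunc h y * k y\<bar>"])
  have km: "k \<in> borel_measurable borel" by (rule borel_measurable_continuous_onI[OF k])
  show "(\<lambda>y. trunc h y * (k y * (1 - cut s y))) \<in> borel_measurable lborel" for s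
    using h km by measurable
  show "(\<lambda>y. trunc h y * k y) \<in> borel_measurable lborel" using h km by measurable
  show "integrable lborel (\<lambda>y. \<bar>trunc h y * k y\<bar>)"
    by (intro integrable_abs integrable_trunc_mult h k)
  have "((\<lambda>s. trunc h y * (k y * (1 - cut s y))) \<longlongrightarrow> trunc h y * k y) (at_right 0)" for y
  proof (cases "y = 0")
    case False
    have "((\<lambda>s. trunc h y * (k y * (1 - cut s y))) \<longlongrightarrow> trunc h y * (k y * 1)) (at_right 0)"
      by (intro tendsto_mult tendsto_const one_minus_cut_tendsto False)
    then show ?thesis by simp
  qed (simp add: trunc_outside)
  then show "AE y in lborel. ((\<lambda>s. trunc h y * (k y * (1 - cut s y))) \<longlongrightarrow> trunc h y * k y) (at_right 0)"
    by simp
  show "\<bar>trunc h y * (k y * (1 - cut s y))\<bar> \<le> \<bar>trunc h y * k y\<bar>" for s y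
  proof -
    have "\<bar>trunc h y * k y\<bar> * \<bar>1 - cut s y\<bar> \<le> \<bar>trunc h y * k y\<bar> * 1"
      using cut_bounds[of s y] by (intro mult_left_mono) auto
    then show ?thesis by (simp add: abs_mult mult.assoc)
  qed
qed

lemma continuous_one_minus_cut: "continuous_on S (\<lambda>y. 1 - cut s y)"
  by (intro continuous_intros continuous_cut)

context punctured_solution
begin

lemma tested_away:
  assumes \<phi>: "\<phi> \<in> test_functions (ball 0 1)" and s: "s > 0"
  shows "- (LBINT y. trunc u y * ((1 - cut s y) * laplacian \<phi> y
      - 2 * (\<Sum>i\<in>Basis. partial_deriv i \<phi> y * dcut i s y) - \<phi> y * lap_cut s y)) =
    (LBINT y. trunc f y * (\<phi> y * (1 - cut s y)))"
proof -
  have Ck: "Ck 2 \<phi>" using \<phi> by (simp add: test_functions_def)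
  from sol'[unfolded solves_def, rule_format, OF test_function_mult_one_minus_cut[OF \<phi> s]]
  show ?thesis
    unfolding laplacian_mult_one_minus_cut[OF Ck s] set_lebesgue_integral_def trunc_def
    by (simp add: mult.assoc)
qed

text \<open>By \<open>avg_has_derivative\<close> this is \<open>s\<close> times the radial
  derivative of \<open>avg (trunc u) 0\<close> at \<open>s\<close>. For the model
  \<open>- \<gamma> * ln (norm y)\<close> it equals \<open>- \<gamma>\<close> at small
  \<open>s\<close>.\<close>

definition flux :: "real \<Rightarrow> real" where
  "flux s = (LBINT y. trunc u y * lap_cut s y) / (2 * pi)"

text \<open>Test with \<open>cut (1/2) * (1 - cut s)\<close>. For \<open>s \<le> 1/4\<close> the two
  factors vary on annuli that do not overlap, so there is no cross term and the Laplacian splits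
  into \<open>lap_cut (1/2) - lap_cut s\<close>.\<close>

lemma flux_eq:
  assumes s: "0 < s" "s \<le> 1/4"
  shows "2 * pi * flux s = 2 * pi * flux (1/2) + (LBINT y. trunc f y * (cut (1/2) y * (1 - cut s y)))"
proof -
  have \<phi>: "cut (1/2) \<in> test_functions (ball (0::real^2) 1)"
    using cut_test_function(1)[of "1/2" "0::real^2" "ball 0 1"] by (simp add: subset_eq)
  have *: "(1 - cut s y) * laplacian (cut (1/2)) y - 2 * (\<Sum>i\<in>Basis. partial_deriv i (cut (1/2)) y * dcut i s y)
      - cut (1/2) y * lap_cut s y = lap_cut (1/2) y - lap_cut s y" for y :: "real^2"
  proof (cases "norm y < s")
    case True
    then have "2 * norm y \<le> 1/2" using s by simp
    then show ?thesis
      using laplacian_cut[of "1/2" 0] partial_deriv_cut[of _ "1/2" "0::real^2"]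
      by (simp add: cut_inside dcut_inside lap_cut_inside)
  next
    case False
    then show ?thesis
      using laplacian_cut[of "1/2" 0] s by (simp add: cut_outside dcut_outside lap_cut_outside)
  qed
  have int: "integrable lborel (\<lambda>y. trunc u y * lap_cut t y)" if "t > 0" for t
    using integrable_lap_cut_mult[OF trunc_u_integrable that, of 0] by simp
  from tested_away[OF \<phi> s(1)]
  have "- (LBINT y. trunc u y * lap_cut (1/2) y - trunc u y * lap_cut s y) =
      (LBINT y. trunc f y * (cut (1/2) y * (1 - cut s y)))"
    unfolding * by (simp add: right_diff_distrib)
  then show ?thesis
    using int[of "1/2"] int[OF s(1)] by (simp add: flux_def)
qed

abbreviation "gradq \<equiv> \<lambda>x. norm (g x) powr q"
abbreviation "expu \<equiv> \<lambda>x. exp (b * u x)"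

lemma trunc_f: "trunc f y = m * trunc gradq y - a * trunc expu y"
  by (simp add: trunc_def f_def algebra_simps)

lemma trunc_u_nonneg: "trunc u y \<ge> 0"
  using u_pos[of y] by (auto simp: trunc_def indicator_def)

lemma trunc_expu_nonneg: "trunc expu y \<ge> 0" and trunc_gradq_nonneg: "trunc gradq y \<ge> 0"
  by (auto simp: trunc_def indicator_def)

lemma continuous_annulus_weight: "continuous_on UNIV (\<lambda>y. cut (1/2) y * (1 - cut s y))"
  by (intro continuous_intros continuous_cut continuous_one_minus_cut)

lemma integrable_expu_away:
  assumes "s > 0"
  shows "integrable lborel (\<lambda>y. trunc expu y * (cut (1/2) y * (1 - cut s y)))"
  by (rule integrable_trunc_mult_away[OF cont_expu continuous_annulus_weight, of "s/2"])
    (use assms in \<open>auto simp: cut_inside\<close>)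

text \<open>If \<open>exp (b * u)\<close> were not integrable, the flux through small circles would exceed the growth \<open>2 / b\<close>
  that the Keller-Osserman bound allows.\<close>

lemma expu_away_bounded:
  "\<exists>T. \<forall>s. 0 < s \<and> s \<le> 1/4 \<longrightarrow> (LBINT y. trunc expu y * (cut (1/2) y * (1 - cut s y))) \<le> T"
proof (rule ccontr)
  define A where "A s = (LBINT y. trunc expu y * (cut (1/2) y * (1 - cut s y)))" for s
  assume "\<not> ?thesis"
  then have unbounded: "\<exists>s. 0 < s \<and> s \<le> 1/4 \<and> A s > T" for T
    by (auto simp: A_def not_le)
  have A_mono: "A t \<le> A s" if "0 < s" "s \<le> t" for s t
    unfolding A_def
  proof (intro integral_mono integrable_expu_away)
    fix y :: "real^2"
    show "trunc expu y * (cut (1/2) y * (1 - cut t y)) \<le> trunc expu y * (cut (1/2) y * (1 - cut s y))"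
      using cut_mono[OF that, of y] cut_bounds trunc_expu_nonneg by (intro mult_left_mono) auto
  qed (use that in auto)
  define c where "c = 2 * pi * flux (1/2) + m * (LBINT y. trunc gradq y)"
  have flux_le: "2 * pi * flux s \<le> c - a * A s" if s: "0 < s" "s \<le> 1/4" for s
  proof -
    have ig: "integrable lborel (\<lambda>y. trunc gradq y * (cut (1/2) y * (1 - cut s y)))"
      by (rule integrable_trunc_mult[OF trunc_gradq_integrable continuous_annulus_weight])
    have "(LBINT y. trunc f y * (cut (1/2) y * (1 - cut s y))) =
        (LBINT y. m * (trunc gradq y * (cut (1/2) y * (1 - cut s y))) - a * (trunc expu y * (cut (1/2) y * (1 - cut s y))))"
      by (intro Bochner_Integration.integral_cong refl) (simp add: trunc_f algebra_simps)
    also have "\<dots> = m * (LBINT y. trunc gradq y * (cut (1/2) y * (1 - cut s y))) - a * A s"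
      using ig integrable_expu_away[OF s(1)] by (simp add: A_def)
    also have "(LBINT y. trunc gradq y * (cut (1/2) y * (1 - cut s y))) \<le> (LBINT y. trunc gradq y)"
    proof (intro integral_mono ig trunc_gradq_integrable)
      fix y :: "real^2"
      have "cut (1/2) y * (1 - cut s y) \<le> 1 * 1" using cut_bounds by (intro mult_mono) auto
      then show "trunc gradq y * (cut (1/2) y * (1 - cut s y)) \<le> trunc gradq y"
        using trunc_gradq_nonneg[of y] mult_left_mono[of "cut (1/2) y * (1 - cut s y)" 1 "trunc gradq y"] by simp
    qed
    finally show ?thesis using flux_eq[OF s] m by (simp add: c_def mult_left_mono)
  qed
  \<comment> \<open>Brings the flux down to \<open>- 3 / b\<close> below \<open>s0\<close>; any rate
    beyond \<open>2 / b\<close> leads to the contradiction.\<close>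
  obtain s0 where s0: "0 < s0" "s0 \<le> 1/4" "A s0 > (c + 2 * pi * (3 / b)) / a"
    using unbounded by blast
  have flux_small: "flux s \<le> - 3 / b" if s: "0 < s" "s \<le> s0" for s
  proof -
    have "(c + 2 * pi * (3 / b)) / a \<le> A s" using A_mono[OF s] s0(3) by linarith
    then have "c + 2 * pi * (3 / b) \<le> a * A s" using a by (simp add: pos_divide_le_eq mult.commute)
    then have "2 * pi * flux s \<le> 2 * pi * (- 3 / b)" using flux_le[of s] s s0 by simp
    then show ?thesis by (simp only: mult_le_cancel_left_pos pi_gt_zero mult_pos_pos zero_less_numeral)
  qed
  have "3 * (ln s0 - ln s) \<le> ln (4 * KO) + 2 * ln (2 / s)" if s: "0 < s" "s \<le> s0" for s
  proof -
    \<comment> \<open>Integrates the flux bound: as \<open>s\<close> decreases, the average about 0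
      grows at least like \<open>3 / b * (ln s0 - ln s)\<close>.\<close>
    have "(\<lambda>t. avg (trunc u) 0 t + 3 / b * ln t) s \<ge> (\<lambda>t. avg (trunc u) 0 t + 3 / b * ln t) s0"
    proof (rule DERIV_nonpos_imp_nonincreasing[OF s(2)])
      fix t assume t: "s \<le> t" "t \<le> s0"
      then have t0: "t > 0" using s by linarith
      have "((\<lambda>t. avg (trunc u) 0 t + 3 / b * ln t) has_real_derivative flux t / t + 3 / b * (1 / t)) (at t)"
        using avg_has_derivative[OF trunc_u_integrable t0, of 0] t0 b
        by (auto intro!: derivative_eq_intros simp: flux_def)
      moreover have "flux t / t + 3 / b * (1 / t) \<le> 0"
        using divide_right_mono[OF flux_small[OF t0 t(2)], of t] t0 by simp
      ultimately show "\<exists>y. ((\<lambda>t. avg (trunc u) 0 t + 3 / b * ln t) has_real_derivative y) (at t) \<and> y \<le> 0"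
        by blast
    qed
    moreover have "avg (trunc u) 0 s0 \<ge> 0"
      by (rule avg_ge[OF trunc_u_integrable s0(1)]) (rule trunc_u_nonneg)
    moreover have "avg (trunc u) 0 s \<le> (ln (4 * KO) + 2 * ln (2 / s)) / b"
    proof (rule avg_le_annulus[OF trunc_u_integrable s(1)])
      fix y :: "real^2" assume y: "s \<le> 2 * norm (y - 0)" "norm (y - 0) \<le> s"
      then have y': "y \<noteq> 0" "norm y \<le> 1/2" "norm y < 1" using s s0 by auto
      have "ln (1 / norm y) \<le> ln (2 / s)" using y y' s by (intro ln_mono) (auto simp: field_simps)
      then have "(ln (4 * KO) + 2 * ln (1 / norm y)) / b \<le> (ln (4 * KO) + 2 * ln (2 / s)) / b"
        using b by (intro divide_right_mono) auto
      then show "trunc u y \<le> (ln (4 * KO) + 2 * ln (2 / s)) / b"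
        using u_bound[OF y'(1,2)] y' by (simp add: trunc_eq)
    qed
    ultimately have "3 * (ln s0 - ln s) / b \<le> (ln (4 * KO) + 2 * ln (2 / s)) / b"
      by (simp add: diff_divide_distrib right_diff_distrib)
    then show ?thesis using b by (simp add: divide_le_cancel)
  qed
  then have bound: "- ln s \<le> ln (4 * KO) + 2 * ln 2 - 3 * ln s0" if "0 < s" "s \<le> s0" for s
    using that by (fastforce simp: ln_div)
  \<comment> \<open>At the smaller of \<open>s0\<close> and \<open>exp (- (Z + 1))\<close> the value
    \<open>- ln s\<close> exceeds the bound \<open>Z\<close>.\<close>
  define Z where "Z = ln (4 * KO) + 2 * ln 2 - 3 * ln s0"
  have "- ln (min s0 (exp (- (Z + 1)))) \<ge> Z + 1"
    using s0(1) ln_mono[of "min s0 (exp (- (Z + 1)))" "exp (- (Z + 1))"] by simp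
  then show False using bound[of "min s0 (exp (- (Z + 1)))"] s0(1) by (simp add: Z_def)
qed

text \<open>Monotone convergence along the radii \<open>s n\<close>, with integrals bounded by
  \<open>expu_away_bounded\<close>, settles the part weighted by \<open>cut (1/2)\<close>; the
  complementary weight vanishes near the origin.\<close>

lemma trunc_expu_integrable: "integrable lborel (trunc expu)"
proof -
  obtain T where T: "\<And>s. 0 < s \<Longrightarrow> s \<le> 1/4 \<Longrightarrow> (LBINT y. trunc expu y * (cut (1/2) y * (1 - cut s y))) \<le> T"
    using expu_away_bounded by blast
  define s where "s n = 1 / (4 * real (Suc n))" for n
  have s: "0 < s n" "s n \<le> 1/4" for n by (auto simp: s_def field_simps)
  have s_anti: "s k \<le> s n" if "n \<le> k" for n k unfolding s_def using that by (intro divide_left_mono) auto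
  have s_lim: "s \<longlonglongrightarrow> 0"
    using tendsto_mult_left[OF LIMSEQ_inverse_real_of_nat, of "1/4"] by (simp add: s_def[abs_def] field_simps)
  then have s_lim': "filterlim s (at_right 0) sequentially"
    using s(1) less_imp_neq[OF s(1)] by (auto simp: filterlim_at intro!: always_eventually)
  define F where "F n y = trunc expu y * (cut (1/2) y * (1 - cut (s n) y))" for n y
  have F_mono: "F n y \<le> F k y" if "n \<le> k" for n k y
    unfolding F_def
    using cut_mono[OF s(1) s_anti[OF that], of y] cut_bounds trunc_expu_nonneg by (intro mult_left_mono) auto
  have F_int: "integrable lborel (F n)" for n
    unfolding F_def by (rule integrable_expu_away[OF s(1)])
  have "incseq (\<lambda>n. integral\<^sup>L lborel (F n))"
    unfolding incseq_def by (intro allI impI integral_mono F_int F_mono)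
  moreover have "integral\<^sup>L lborel (F n) \<le> T" for n unfolding F_def by (rule T[OF s])
  ultimately obtain L where L: "(\<lambda>n. integral\<^sup>L lborel (F n)) \<longlonglongrightarrow> L"
    using incseq_convergent by metis
  have meas: "trunc expu \<in> borel_measurable borel"
    by (rule trunc_measurable[OF continuous_on_subset[OF cont_expu \<Omega>_sub]])
  have 1: "integrable lborel (\<lambda>y. trunc expu y * cut (1/2) y)"
  proof (rule integral_monotone_convergence_nonneg(1)[OF F_int _ _ _ L])
    show "AE y in lborel. mono (\<lambda>n. F n y)" using F_mono by (auto intro!: monoI)
    show "AE y in lborel. 0 \<le> F n y" for n
      unfolding F_def using cut_bounds by (intro AE_I2 mult_nonneg_nonneg trunc_expu_nonneg) auto
    have "(\<lambda>n. F n y) \<longlonglongrightarrow> trunc expu y * cut (1/2) y" for y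
    proof (cases "y = 0")
      case False
      have "(\<lambda>n. trunc expu y * (cut (1/2) y * (1 - cut (s n) y))) \<longlonglongrightarrow> trunc expu y * (cut (1/2) y * 1)"
        by (intro tendsto_mult tendsto_const filterlim_compose[OF one_minus_cut_tendsto[OF False] s_lim'])
      then show ?thesis by (simp add: F_def)
    qed (simp add: F_def trunc_outside)
    then show "AE y in lborel. (\<lambda>n. F n y) \<longlonglongrightarrow> trunc expu y * cut (1/2) y" by simp
    show "(\<lambda>y. trunc expu y * cut (1/2) y) \<in> borel_measurable lborel" using meas by measurable
  qed
  have 2: "integrable lborel (\<lambda>y. trunc expu y * (1 - cut (1/2) y))"
    by (rule integrable_trunc_mult_away[OF cont_expu continuous_one_minus_cut, of "1/4"]) (auto simp: cut_inside)
  from Bochner_Integration.integrable_add[OF 1 2] show ?thesis by (simp add: algebra_simps)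
qed

lemma trunc_f_integrable: "integrable lborel (trunc f)"
  using trunc_expu_integrable trunc_gradq_integrable by (simp add: trunc_f[abs_def])

text \<open>Minus the limit of \<open>flux s\<close> as \<open>s\<close> tends to 0, written out by
  means of \<open>flux_eq\<close>, so that convergence is a lemma (\<open>flux_tendsto\<close>) and
  not part of the definition.\<close>

definition \<gamma> :: real where
  "\<gamma> = - (flux (1/2) + (LBINT y. trunc f y * cut (1/2) y) / (2 * pi))"

lemma flux_tendsto: "(flux \<longlongrightarrow> - \<gamma>) (at_right 0)"
proof -
  have "((\<lambda>s. flux (1/2) + (LBINT y. trunc f y * (cut (1/2) y * (1 - cut s y))) / (2 * pi)) \<longlongrightarrow> - \<gamma>) (at_right 0)"
    unfolding \<gamma>_def minus_minus
    by (intro tendsto_intros trunc_cutoff_tendsto[OF trunc_f_integrable continuous_cut]) auto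
  moreover have "\<forall>\<^sub>F s in at_right 0. flux (1/2) + (LBINT y. trunc f y * (cut (1/2) y * (1 - cut s y))) / (2 * pi) = flux s"
    unfolding eventually_at_right_field
  proof (intro exI[of _ "1/4"] conjI allI impI)
    fix s :: real assume "0 < s" "s < 1/4"
    then have "2 * pi * flux s = 2 * pi * flux (1/2) + (LBINT y. trunc f y * (cut (1/2) y * (1 - cut s y)))"
      by (intro flux_eq) auto
    then show "flux (1/2) + (LBINT y. trunc f y * (cut (1/2) y * (1 - cut s y))) / (2 * pi) = flux s"
      by (simp add: field_simps)
  qed simp
  ultimately show ?thesis by (rule Lim_transform_eventually)
qed

text \<open>The exponent 3/2 is \<open>2 - 1/2\<close>, from the decay rate 1/2 of \<open>u\<close>;
  anything above 1 beats the kernels of size \<open>1 / s\<close> in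
  \<open>small_kernel_tendsto_0\<close>.\<close>

lemma trunc_u_ball:
  obtains C where "C \<ge> 0" "\<And>s. s > 0 \<Longrightarrow> (LBINT y:ball 0 s. \<bar>trunc u y\<bar>) \<le> C * s powr (3/2)"
proof -
  obtain C where C: "C \<ge> 0" "\<And>x. x \<in> cball 0 1 - {0} \<Longrightarrow> \<bar>u x\<bar> \<le> C * norm x powr (- (1/2))"
    using u_decay[of "1/2"] by auto
  have "(LBINT y:ball 0 s. \<bar>trunc u y\<bar>) \<le> C * (pi + 2 * pi / (2 - 1/2)) * s powr (2 - 1/2)" if "s > 0" for s
    by (rule decay_integrable(2)[OF cont_\<Omega>(1) _ _ C(2) that]) (use \<Omega>_sub in auto)
  then show thesis using C(1) by (intro that[of "C * (pi + 2 * pi / (2 - 1/2))"]) auto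
qed

lemma trunc_set_integrable: "integrable lborel (trunc h) \<Longrightarrow> set_integrable lborel (ball x s) (trunc h)"
  unfolding set_integrable_def by (rule integrable_mult_indicator) auto

lemma small_kernel_tendsto_0:
  assumes "\<And>s y. 0 < s \<Longrightarrow> s < 1 \<Longrightarrow> y \<in> ball 0 s \<Longrightarrow> \<bar>k s y\<bar> \<le> B / s"
    and "\<And>s y. 0 < s \<Longrightarrow> y \<notin> ball 0 s \<Longrightarrow> k s y = 0"
    and "\<And>s. k s \<in> borel_measurable borel" and "B \<ge> 0"
  shows "((\<lambda>s. LBINT y. trunc u y * k s y) \<longlongrightarrow> 0) (at_right 0)"
proof -
  obtain C where C: "C \<ge> 0" "\<And>s. s > 0 \<Longrightarrow> (LBINT y:ball 0 s. \<bar>trunc u y\<bar>) \<le> C * s powr (3/2)"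
    using trunc_u_ball by blast
  have le: "\<bar>LBINT y. trunc u y * k s y\<bar> \<le> B * C * s powr (1/2)" if s: "0 < s" "s < 1" for s
  proof -
    have "\<bar>LBINT y. trunc u y * k s y\<bar> \<le> B / s * (LBINT y:ball 0 s. \<bar>trunc u y\<bar>)"
      by (rule integral_ball_le[OF trunc_set_integrable[OF trunc_u_integrable] assms(3)]) (use s assms in auto)
    also have "\<dots> \<le> B / s * (C * s powr (3/2))"
      using s assms(4) by (intro mult_left_mono C) auto
    also have "\<dots> = B * C * (s powr (3/2) / s powr 1)" using s by simp
    also have "s powr (3/2) / s powr 1 = s powr (1/2)"
      unfolding powr_diff[symmetric] by simp
    finally show ?thesis .
  qed
  have "((\<lambda>s. B * C * s powr (1/2)) \<longlongrightarrow> B * C * 0 powr (1/2)) (at_right 0)"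
    by (intro tendsto_mult tendsto_const tendsto_powr' tendsto_ident_at)
      (auto simp: eventually_at_right_less eventually_at_filter)
  then have "((\<lambda>s. B * C * s powr (1/2)) \<longlongrightarrow> 0) (at_right 0)" by simp
  then show ?thesis
  proof (rule Lim_null_comparison[rotated])
    show "\<forall>\<^sub>F s in at_right 0. norm (LBINT y. trunc u y * k s y) \<le> B * C * s powr (1/2)"
      unfolding eventually_at_right_field using le by (intro exI[of _ 1]) auto
  qed
qed

text \<open>In the Laplacian of \<open>\<phi> * (1 - cut s)\<close> the term
  \<open>\<phi> * lap_cut s\<close> is split at \<open>\<phi> 0\<close>: the constant part yields
  \<open>2 * pi * \<phi> 0 * flux s\<close>, hence the Dirac mass. The remainder is of size
  \<open>1 / s\<close> by the Lipschitz bound on \<open>\<phi>\<close>, as is the mixed term, and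
  both vanish in the limit.\<close>

lemma dirac_equation:
  assumes \<phi>: "\<phi> \<in> test_functions (ball 0 1)"
  shows "- (LBINT y. trunc u y * laplacian \<phi> y) - (LBINT y. trunc f y * \<phi> y) = 2 * pi * \<gamma> * \<phi> 0"
proof -
  have Ck: "Ck k \<phi>" for k using \<phi> by (simp add: test_functions_def)
  have Ckd: "Ck k (partial_deriv i \<phi>)" if "i \<in> Basis" for i k
    by (rule Ck_partial_deriv[OF Ck that])
  have c\<phi>: "continuous_on S \<phi>" for S by (rule Ck_continuous_on[OF Ck])
  have cd: "continuous_on S (partial_deriv i \<phi>)" if "i \<in> Basis" for S i
    by (rule Ck_continuous_on[OF Ckd[OF that]])
  have cl: "continuous_on S (laplacian \<phi>)" for S
    unfolding laplacian_def
    by (intro continuous_intros Ck_continuous_on[OF Ck_partial_deriv[OF Ckd]])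
  obtain K where K: "K \<ge> 0" "\<And>y i. y \<in> cball 0 1 \<Longrightarrow> i \<in> Basis \<Longrightarrow> \<bar>partial_deriv i \<phi> y\<bar> \<le> K"
  proof -
    have "continuous_on (cball 0 1) (\<lambda>y. \<Sum>i\<in>Basis. \<bar>partial_deriv i \<phi> y\<bar>)"
      by (intro continuous_intros cd)
    then have "bounded ((\<lambda>y. \<Sum>i\<in>Basis. \<bar>partial_deriv i \<phi> y\<bar>) ` cball 0 1)"
      by (intro compact_imp_bounded compact_continuous_image) auto
    then obtain K where K: "\<forall>y\<in>cball 0 1. \<bar>\<Sum>i\<in>Basis. \<bar>partial_deriv i \<phi> y\<bar>\<bar> \<le> K"
      unfolding bounded_real by blast
    show thesis
    proof (rule that[of "\<bar>K\<bar>"])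
      fix y i :: "real^2" assume y: "y \<in> cball 0 1" and i: "i \<in> Basis"
      have "\<bar>partial_deriv i \<phi> y\<bar> \<le> (\<Sum>i\<in>Basis. \<bar>partial_deriv i \<phi> y\<bar>)"
        using i by (intro member_le_sum) auto
      then show "\<bar>partial_deriv i \<phi> y\<bar> \<le> \<bar>K\<bar>" using K y by fastforce
    qed simp
  qed
  have lip: "\<bar>\<phi> y - \<phi> 0\<bar> \<le> 2 * K * norm y" if y: "y \<in> cball 0 1" for y
  proof -
    have "norm (\<phi> y - \<phi> 0) \<le> 2 * K * norm (y - 0)"
    proof (rule differentiable_bound[of "cball 0 1" \<phi> "\<lambda>x. frechet_derivative \<phi> (at x)"])
      fix x :: "real^2" assume x: "x \<in> cball 0 1"
      have der: "(\<phi> has_derivative frechet_derivative \<phi> (at x)) (at x)"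
        by (rule Ck_frechet[OF Ck])
      then show "(\<phi> has_derivative frechet_derivative \<phi> (at x)) (at x within cball 0 1)"
        by (rule has_derivative_at_withinI)
      show "onorm (frechet_derivative \<phi> (at x)) \<le> 2 * K"
      proof (rule onorm_bound)
        fix h
        interpret linear "frechet_derivative \<phi> (at x)" by (rule has_derivative_linear[OF der])
        have "frechet_derivative \<phi> (at x) h = frechet_derivative \<phi> (at x) (\<Sum>i\<in>Basis. (h \<bullet> i) *\<^sub>R i)"
          by (simp add: euclidean_representation)
        also have "\<dots> = (\<Sum>i\<in>Basis. (h \<bullet> i) * partial_deriv i \<phi> x)"
          by (simp add: sum scale partial_deriv_def)
        also have "norm \<dots> \<le> (\<Sum>i\<in>(Basis::(real^2) set). norm h * K)"
          using Basis_le_norm[of _ h] K x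
          by (intro order_trans[OF norm_sum] sum_mono) (auto simp: abs_mult intro!: mult_mono)
        finally show "norm (frechet_derivative \<phi> (at x) h) \<le> 2 * K * norm h" by (simp add: mult_ac)
      qed (use K in auto)
    qed (use y in auto)
    then show ?thesis by simp
  qed
  obtain B where B: "B > 0" "\<And>R y i::real^2. R > 0 \<Longrightarrow> i \<in> Basis \<Longrightarrow> \<bar>dcut i R y\<bar> \<le> B / R"
    "\<And>R y. R > 0 \<Longrightarrow> \<bar>lap_cut R y\<bar> \<le> B / R\<^sup>2"
    by (rule kernel_bounds) blast
  define k1 where "k1 s y = (\<Sum>i\<in>Basis. partial_deriv i \<phi> y * dcut i s y)" for s y
  define k2 where "k2 s y = (\<phi> y - \<phi> 0) * lap_cut s y" for s y
  have c1: "continuous_on UNIV (k1 s)" and c2: "continuous_on UNIV (k2 s)" for s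
    unfolding k1_def k2_def by (intro continuous_intros cd c\<phi> continuous_dcut continuous_lap_cut; assumption)+
  have lim1: "((\<lambda>s. LBINT y. trunc u y * k1 s y) \<longlongrightarrow> 0) (at_right 0)"
  proof (rule small_kernel_tendsto_0[of _ "2 * K * B"])
    fix s y assume s: "0 < s" "s < (1::real)" and y: "y \<in> ball (0::real^2) s"
    have "\<bar>k1 s y\<bar> \<le> (\<Sum>i\<in>(Basis::(real^2) set). K * (B / s))"
      unfolding k1_def using K B s y
      by (intro order_trans[OF sum_abs] sum_mono, unfold abs_mult, intro mult_mono) auto
    then show "\<bar>k1 s y\<bar> \<le> 2 * K * B / s" by simp
  next
    fix s y assume "0 < s" "y \<notin> ball (0::real^2) s"
    then show "k1 s y = 0" by (simp add: k1_def dcut_outside)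
  qed (use K B borel_measurable_continuous_onI[OF c1] in auto)
  have lim2: "((\<lambda>s. LBINT y. trunc u y * k2 s y) \<longlongrightarrow> 0) (at_right 0)"
  proof (rule small_kernel_tendsto_0[of _ "2 * K * B"])
    fix s y assume s: "0 < s" "s < (1::real)" and y: "y \<in> ball (0::real^2) s"
    have "\<bar>\<phi> y - \<phi> 0\<bar> \<le> 2 * K * norm y" using y s by (intro lip) auto
    also have "\<dots> \<le> 2 * K * s" using y K by (intro mult_left_mono) auto
    finally have "\<bar>k2 s y\<bar> \<le> 2 * K * s * (B / s\<^sup>2)"
      unfolding k2_def abs_mult using B(3)[OF s(1)] K s by (intro mult_mono) auto
    then show "\<bar>k2 s y\<bar> \<le> 2 * K * B / s" using s by (simp add: power2_eq_square)
  next
    fix s y assume "0 < s" "y \<notin> ball (0::real^2) s"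
    then show "k2 s y = 0" by (simp add: k2_def lap_cut_outside)
  qed (use K B borel_measurable_continuous_onI[OF c2] in auto)
  have eq: "- ((LBINT y. trunc u y * (laplacian \<phi> y * (1 - cut s y))) - 2 * (LBINT y. trunc u y * k1 s y)
      - ((LBINT y. trunc u y * k2 s y) + 2 * pi * \<phi> 0 * flux s)) =
      (LBINT y. trunc f y * (\<phi> y * (1 - cut s y)))" if s: "s > 0" for s
  proof -
    have i0: "integrable lborel (\<lambda>y. trunc u y * (laplacian \<phi> y * (1 - cut s y)))"
      by (intro integrable_trunc_mult trunc_u_integrable continuous_intros cl continuous_cut)
    have i1: "integrable lborel (\<lambda>y. trunc u y * k1 s y)" and i2: "integrable lborel (\<lambda>y. trunc u y * k2 s y)"
      by (intro integrable_trunc_mult trunc_u_integrable c1 c2)+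
    have i3: "integrable lborel (\<lambda>y. trunc u y * lap_cut s y)"
      by (intro integrable_trunc_mult trunc_u_integrable continuous_lap_cut)
    have "(LBINT y. trunc u y * ((1 - cut s y) * laplacian \<phi> y
        - 2 * (\<Sum>i\<in>Basis. partial_deriv i \<phi> y * dcut i s y) - \<phi> y * lap_cut s y)) =
      (LBINT y. trunc u y * (laplacian \<phi> y * (1 - cut s y)) - 2 * (trunc u y * k1 s y)
        - (trunc u y * k2 s y + \<phi> 0 * (trunc u y * lap_cut s y)))"
      by (intro Bochner_Integration.integral_cong refl) (simp add: k1_def k2_def algebra_simps)
    also have "\<dots> = (LBINT y. trunc u y * (laplacian \<phi> y * (1 - cut s y))) - 2 * (LBINT y. trunc u y * k1 s y)
      - ((LBINT y. trunc u y * k2 s y) + \<phi> 0 * (LBINT y. trunc u y * lap_cut s y))"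
      using i0 i1 i2 i3 by simp
    finally show ?thesis using tested_away[OF \<phi> s] by (simp add: flux_def)
  qed
  have "((\<lambda>s. - ((LBINT y. trunc u y * (laplacian \<phi> y * (1 - cut s y))) - 2 * (LBINT y. trunc u y * k1 s y)
      - ((LBINT y. trunc u y * k2 s y) + 2 * pi * \<phi> 0 * flux s))) \<longlongrightarrow>
      - ((LBINT y. trunc u y * laplacian \<phi> y) - 2 * 0 - (0 + 2 * pi * \<phi> 0 * (- \<gamma>)))) (at_right 0)"
    by (intro tendsto_intros trunc_cutoff_tendsto trunc_u_integrable cl lim1 lim2 flux_tendsto)
  then have "((\<lambda>s. LBINT y. trunc f y * (\<phi> y * (1 - cut s y))) \<longlongrightarrow>
      - ((LBINT y. trunc u y * laplacian \<phi> y) - 2 * 0 - (0 + 2 * pi * \<phi> 0 * (- \<gamma>)))) (at_right 0)"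
    by (rule Lim_transform_eventually) (use eq in \<open>auto simp: eventually_at_filter\<close>)
  from tendsto_unique[OF _ this trunc_cutoff_tendsto[OF trunc_f_integrable c\<phi>]]
  show ?thesis by (simp add: mult_ac)
qed

end

section \<open>The logarithmic limit\<close>

lemma trunc_isCont:
  assumes "continuous_on (ball 0 1 - {0}) h" "x \<in> ball 0 1 - {0}"
  shows "isCont (trunc h) x"
proof -
  have "continuous_on (ball 0 1 - {0}) (trunc h)"
    by (rule continuous_on_eq[OF assms(1)]) (simp add: trunc_eq)
  then show ?thesis using assms(2) by (simp add: continuous_on_eq_continuous_at open_Diff)
qed

text \<open>Absolute continuity of the integral, obtained from \<open>trunc_cutoff_tendsto\<close>:
  \<open>cut s\<close> majorises the indicator of the ball of radius \<open>s / 2\<close>.\<close>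

lemma ball_integral_tendsto_0:
  assumes "integrable lborel (trunc h)" "e > 0"
  obtains s where "s > 0" "(LBINT y:ball 0 s. \<bar>trunc h y\<bar>) \<le> e"
proof -
  have abs: "trunc (\<lambda>y. \<bar>h y\<bar>) = (\<lambda>y. \<bar>trunc h y\<bar>)" by (auto simp: trunc_def fun_eq_iff abs_mult)
  have int: "integrable lborel (trunc (\<lambda>y. \<bar>h y\<bar>))" unfolding abs using assms(1) by auto
  have "((\<lambda>s. (LBINT y. trunc (\<lambda>y. \<bar>h y\<bar>) y * 1) - (LBINT y. trunc (\<lambda>y. \<bar>h y\<bar>) y * (1 * (1 - cut s y))))
      \<longlongrightarrow> (LBINT y. trunc (\<lambda>y. \<bar>h y\<bar>) y * 1) - (LBINT y. trunc (\<lambda>y. \<bar>h y\<bar>) y * 1)) (at_right 0)"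
    by (intro tendsto_diff tendsto_const trunc_cutoff_tendsto int continuous_intros)
  then have "\<forall>\<^sub>F s in at_right 0. (LBINT y. trunc (\<lambda>y. \<bar>h y\<bar>) y * 1)
      - (LBINT y. trunc (\<lambda>y. \<bar>h y\<bar>) y * (1 * (1 - cut s y))) < e"
    using assms(2) by (intro order_tendstoD(2)) auto
  then have "\<exists>s>0. (LBINT y. trunc (\<lambda>y. \<bar>h y\<bar>) y * 1)
      - (LBINT y. trunc (\<lambda>y. \<bar>h y\<bar>) y * (1 * (1 - cut s y))) < e"
    unfolding eventually_at_right_field by (meson dense)
  then obtain s where s: "s > 0" "(LBINT y. trunc (\<lambda>y. \<bar>h y\<bar>) y * 1)
      - (LBINT y. trunc (\<lambda>y. \<bar>h y\<bar>) y * (1 * (1 - cut s y))) < e"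
    by blast
  have icut: "integrable lborel (\<lambda>y. trunc (\<lambda>y. \<bar>h y\<bar>) y * cut s y)"
    and i1cut: "integrable lborel (\<lambda>y. trunc (\<lambda>y. \<bar>h y\<bar>) y * (1 - cut s y))"
    by (intro integrable_trunc_mult int continuous_cut continuous_one_minus_cut)+
  have "(LBINT y:ball 0 (s/2). \<bar>trunc h y\<bar>) \<le> (LBINT y. trunc (\<lambda>y. \<bar>h y\<bar>) y * cut s y)"
    unfolding set_lebesgue_integral_def
  proof (intro integral_mono icut)
    show "integrable lborel (\<lambda>y. indicator (ball 0 (s/2)) y *\<^sub>R \<bar>trunc h y\<bar>)"
      using assms(1) by (intro integrable_mult_indicator) auto
    fix y
    show "indicator (ball 0 (s/2)) y *\<^sub>R \<bar>trunc h y\<bar> \<le> trunc (\<lambda>y. \<bar>h y\<bar>) y * cut s y"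
      using s(1) cut_bounds[of s y] by (auto simp: abs indicator_def cut_inside)
  qed
  also have "\<dots> = (LBINT y. trunc (\<lambda>y. \<bar>h y\<bar>) y - trunc (\<lambda>y. \<bar>h y\<bar>) y * (1 - cut s y))"
    by (intro Bochner_Integration.integral_cong refl) (simp add: algebra_simps)
  also have "\<dots> = (LBINT y. trunc (\<lambda>y. \<bar>h y\<bar>) y) - (LBINT y. trunc (\<lambda>y. \<bar>h y\<bar>) y * (1 - cut s y))"
    by (intro Bochner_Integration.integral_diff int i1cut)
  also have "\<dots> \<le> e" using s(2) by simp
  finally show thesis using s(1) by (intro that[of "s/2"]) auto
qed

lemma ball_integral_mono:
  assumes "integrable lborel F" "ball x r \<subseteq> ball y s"
  shows "(LBINT z:ball x r. \<bar>F z\<bar>) \<le> (LBINT z:ball y s. \<bar>F z :: real\<bar>)"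
  unfolding set_lebesgue_integral_def
proof (intro integral_mono integrable_mult_indicator integrable_abs assms)
  fix z
  show "indicator (ball x r) z *\<^sub>R \<bar>F z\<bar> \<le> indicator (ball y s) z *\<^sub>R \<bar>F z\<bar>"
    using assms(2) by (auto simp: indicator_def)
qed auto

lemma abs_cut_integral_le:
  fixes F :: "real^2 \<Rightarrow> real"
  assumes "integrable lborel F" "t > 0"
  shows "\<bar>LBINT y. F y * cut t (y - x)\<bar> \<le> (LBINT y:ball x t. \<bar>F y\<bar>)"
proof -
  have "set_integrable lborel (ball x t) F"
    unfolding set_integrable_def by (intro integrable_mult_indicator assms) simp
  then have "\<bar>LBINT y. F y * cut t (y - x)\<bar> \<le> 1 * (LBINT y:ball x t. \<bar>F y\<bar>)"
    using cut_outside[OF assms(2) outside_ball] cut_bounds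
    by (intro integral_ball_le) (auto simp: abs_le_iff intro: order_trans[OF _ cut_bounds(1)])
  then show ?thesis by simp
qed

context punctured_solution
begin

text \<open>\<open>dirac_equation\<close> tested with the radial kernels. The ball may now contain
  the origin, at the price of the value of the test function there.\<close>

lemma solves_cut_0:
  assumes R: "R > 0" "cball x R \<subseteq> ball 0 1"
  shows "(LBINT y. trunc u y * lap_cut R (y - x)) = - (LBINT y. trunc f y * cut R (y - x)) - 2 * pi * \<gamma> * cut R (- x)"
    and "i \<in> Basis \<Longrightarrow> (LBINT y. trunc u y * lap_dcut i R (y - x)) =
      - (LBINT y. trunc f y * dcut i R (y - x)) - 2 * pi * \<gamma> * dcut i R (- x)"
  using dirac_equation[OF cut_test_function(1)[OF R]] dirac_equation[OF cut_test_function(2)[OF R, of i]]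
  by (simp_all add: laplacian_cut laplacian_dcut)

lemma avg_derivative:
  assumes R: "R > 0" "cball x R \<subseteq> ball 0 1"
  shows "((\<lambda>t. avg (trunc u) x t) has_real_derivative
    - ((LBINT y. trunc f y * cut R (y - x)) + 2 * pi * \<gamma> * cut R (- x)) / (2 * pi * R)) (at R)"
  using avg_has_derivative[OF trunc_u_integrable R(1), of x] by (simp add: solves_cut_0[OF R])

lemma avg_bound_limit:
  assumes x: "x \<in> \<Omega>" and R: "R > 0"
    and D: "\<And>r. 0 < r \<Longrightarrow> r < R \<Longrightarrow> \<bar>avg (trunc u) x R - avg (trunc u) x r\<bar> \<le> D"
  shows "\<bar>avg (trunc u) x R - u x\<bar> \<le> D"
proof -
  have "((\<lambda>r. avg (trunc u) x r) \<longlongrightarrow> trunc u x) (at_right 0)"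
    by (rule avg_tendsto[OF trunc_u_integrable trunc_isCont[OF cont_\<Omega>(1) x]])
  then have "((\<lambda>r. \<bar>avg (trunc u) x R - avg (trunc u) x r\<bar>) \<longlongrightarrow> \<bar>avg (trunc u) x R - u x\<bar>) (at_right 0)"
    using x by (intro tendsto_intros) (simp add: trunc_eq)
  then show ?thesis
  proof (rule tendsto_upperbound)
    show "\<forall>\<^sub>F r in at_right 0. \<bar>avg (trunc u) x R - avg (trunc u) x r\<bar> \<le> D"
      unfolding eventually_at_right_field using D R by blast
  qed simp
qed

text \<open>The inverse square is the scale-invariant rate: on a ball of radius comparable to
  \<open>norm x\<close> such a source changes averages by a bounded amount. For the gradient term
  \<open>q < 2\<close> permits \<open>\<beta> = 2\<close> in \<open>gradq_decay\<close>.\<close>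

lemma f_decay_2:
  obtains C where "C \<ge> 0" "\<And>x. x \<noteq> 0 \<Longrightarrow> norm x \<le> 1/2 \<Longrightarrow> \<bar>f x\<bar> \<le> C / (norm x)\<^sup>2"
proof -
  obtain C where C: "C \<ge> 0" "\<And>x. x \<in> cball 0 1 - {0} \<Longrightarrow> \<bar>norm (g x) powr q\<bar> \<le> C * norm x powr (- 2)"
    using gradq_decay[OF q(2)] by blast
  show thesis
  proof (rule that[of "m * C + a * (4 * KO)"])
    show "m * C + a * (4 * KO) \<ge> 0" using m a C(1) KO_pos by simp
    fix x :: "real^2" assume x: "x \<noteq> 0" "norm x \<le> 1/2"
    have "m * norm (g x) powr q \<le> m * (C * norm x powr (- 2))"
      using C(2)[of x] x m by (intro mult_left_mono) auto
    moreover have "a * exp (b * u x) \<le> a * (4 * KO / (norm x)\<^sup>2)"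
      using expu_bound[OF x] a by (intro mult_left_mono) auto
    moreover have "norm x powr (- 2) = 1 / (norm x)\<^sup>2" using x by (simp add: powr_neg_numeral)
    ultimately show "\<bar>f x\<bar> \<le> (m * C + a * (4 * KO)) / (norm x)\<^sup>2"
      using abs_f_le[of x] by (simp add: add_divide_distrib)
  qed
qed

text \<open>Up to the radius \<open>R = norm x / 2\<close> the ball avoids the origin, so the Dirac
  term vanishes and \<open>f\<close> is bounded by \<open>C / R\<^sup>2\<close>. The radial
  derivative is then at most \<open>C / R\<^sup>2 * t / 2\<close>, which adds up to
  \<open>C / 4\<close> whatever \<open>x\<close> is.\<close>

lemma avg_near:
  obtains C where "\<And>x. x \<noteq> 0 \<Longrightarrow> norm x \<le> 1/3 \<Longrightarrow> \<bar>avg (trunc u) x (norm x / 2) - u x\<bar> \<le> C"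
proof -
  obtain C where C: "C \<ge> 0" "\<And>x. x \<noteq> 0 \<Longrightarrow> norm x \<le> 1/2 \<Longrightarrow> \<bar>f x\<bar> \<le> C / (norm x)\<^sup>2"
    using f_decay_2 by blast
  show thesis
  proof (rule that[of "C / 4"])
    fix x :: "real^2" assume x: "x \<noteq> 0" "norm x \<le> 1/3"
    define R where "R = norm x / 2"
    have R: "R > 0" using x by (simp add: R_def)
    have sub: "cball x R \<subseteq> \<Omega>" using half_ball_sub(1)[of x] x by (simp add: R_def)
    have "x \<in> \<Omega>" using sub R by (auto simp: subset_eq)
    moreover have "\<bar>avg (trunc u) x R - avg (trunc u) x r\<bar> \<le> C / 4" if r: "0 < r" "r < R" for r
    proof -
      have "\<bar>avg (trunc u) x R - avg (trunc u) x r\<bar> \<le> (\<lambda>t. C / R\<^sup>2 * t\<^sup>2 / 4) R - (\<lambda>t. C / R\<^sup>2 * t\<^sup>2 / 4) r"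
      proof (rule increment_le)
        fix t assume t: "r \<le> t" "t \<le> R"
        have t0: "t > 0" using t r by linarith
        have "cball x t \<subseteq> cball x R" using t by auto
        then have tsub: "cball x t \<subseteq> ball 0 1" using sub by blast
        show "((\<lambda>t. avg (trunc u) x t) has_real_derivative
          - ((LBINT y. trunc f y * cut t (y - x)) + 2 * pi * \<gamma> * cut t (- x)) / (2 * pi * t)) (at t)"
          by (rule avg_derivative[OF t0 tsub])
        show "((\<lambda>t. C / R\<^sup>2 * t\<^sup>2 / 4) has_real_derivative C / R\<^sup>2 * t / 2) (at t)"
          using R by (auto intro!: derivative_eq_intros simp: field_simps eval_nat_numeral)
        have "t \<le> norm x" using t R unfolding R_def by linarith
        then have "cut t (- x) = 0" by (intro cut_outside t0) simp
        moreover have "\<bar>LBINT y. trunc f y * cut t (y - x)\<bar> \<le> pi * t\<^sup>2 * (C / R\<^sup>2)"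
        proof (intro order_trans[OF abs_cut_integral_le] integral_ball_const_le trunc_set_integrable trunc_f_integrable t0)
          fix y assume "y \<in> ball x t"
          then have y: "y \<in> cball x (norm x / 2)" using t by (auto simp: R_def)
          have ny: "R \<le> norm y" "norm y \<le> 1/2" "y \<noteq> 0" "y \<in> \<Omega>"
          proof -
            have x': "norm x \<le> 1/2" "norm x > 0" using x by auto
            note * = half_ball_sub(2)[OF x(1) x'(1) y]
            show "R \<le> norm y" "norm y \<le> 1/2" "y \<noteq> 0" using * x x'(2) by (auto simp: R_def)
            show "y \<in> \<Omega>" using half_ball_sub(1)[OF x(1) x'(1)] y by blast
          qed
          have "\<bar>trunc f y\<bar> \<le> C / (norm y)\<^sup>2" using C(2)[OF ny(3,2)] ny(4) by (simp add: trunc_eq)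
          also have "\<dots> \<le> C / R\<^sup>2" using ny R C(1) by (intro divide_left_mono power_mono) auto
          finally show "\<bar>trunc f y\<bar> \<le> C / R\<^sup>2" .
        qed
        ultimately have "\<bar>- ((LBINT y. trunc f y * cut t (y - x)) + 2 * pi * \<gamma> * cut t (- x)) / (2 * pi * t)\<bar>
            \<le> (pi * t\<^sup>2 * (C / R\<^sup>2)) / (2 * pi * t)"
          using t0 unfolding abs_divide by (intro frac_le) auto
        also have "\<dots> = C / R\<^sup>2 * t / 2" using t0 by (simp add: field_simps power2_eq_square)
        finally show "\<bar>- ((LBINT y. trunc f y * cut t (y - x)) + 2 * pi * \<gamma> * cut t (- x)) / (2 * pi * t)\<bar>
            \<le> C / R\<^sup>2 * t / 2" .
      qed (use r in auto)
      also have "\<dots> \<le> C / 4" using R C(1) by simp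
      finally show ?thesis .
    qed
    ultimately have "\<bar>avg (trunc u) x R - u x\<bar> \<le> C / 4"
      by (intro avg_bound_limit[OF _ R])
    then show "\<bar>avg (trunc u) x (norm x / 2) - u x\<bar> \<le> C / 4" by (simp add: R_def)
  qed
qed

lemma avg_abs_le:
  assumes "R > 0"
  obtains C where "\<And>x. \<bar>avg (trunc u) x R\<bar> \<le> C"
proof -
  obtain B where B: "\<And>R y. R > 0 \<Longrightarrow> kern R y \<le> B / R\<^sup>2" by (rule kernel_bounds) blast
  have "\<bar>avg (trunc u) x R\<bar> \<le> (LBINT y. \<bar>trunc u y\<bar> * (B / R\<^sup>2))" for x
  proof -
    have "\<bar>avg (trunc u) x R\<bar> \<le> (LBINT y. \<bar>trunc u y * kern R (y - x)\<bar>)"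
      unfolding avg_def by (rule integral_abs_bound)
    also have "\<dots> \<le> (LBINT y. \<bar>trunc u y\<bar> * (B / R\<^sup>2))"
    proof (intro integral_mono integrable_abs integrable_kern_mult integrable_mult_left trunc_u_integrable assms)
      show "\<bar>trunc u y * kern R (y - x)\<bar> \<le> \<bar>trunc u y\<bar> * (B / R\<^sup>2)" for y
        unfolding abs_mult using B[OF assms] kern_nonneg[OF assms] by (intro mult_left_mono) auto
    qed
    finally show ?thesis .
  qed
  then show thesis by (rule that)
qed

text \<open>Three regimes for the radius \<open>t\<close> of the average centred at \<open>x\<close>: below \<open>\<bar>x\<bar> / 2\<close> the source is
  \<open>O(\<bar>x\<bar> powr - 2)\<close>, between \<open>\<bar>x\<bar> / 2\<close> and \<open>2 * \<bar>x\<bar>\<close> the derivative is \<open>O(1 / t)\<close>, and beyond \<open>2 * \<bar>x\<bar>\<close>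
  it is \<open>(- \<gamma> + o(1)) / t\<close>.\<close>

lemma u_asymptotics:
  assumes \<delta>: "\<delta> > 0"
  obtains C r where "r > 0" "C \<ge> 0" "\<And>x. x \<noteq> 0 \<Longrightarrow> norm x \<le> r \<Longrightarrow> \<bar>u x + \<gamma> * ln (norm x)\<bar> \<le> C - \<delta> * ln (norm x)"
proof -
  obtain s where s: "s > 0" "(LBINT y:ball 0 s. \<bar>trunc f y\<bar>) \<le> 2 * pi * \<delta>"
    using ball_integral_tendsto_0[OF trunc_f_integrable, of "2 * pi * \<delta>"] \<delta> by auto
  \<comment> \<open>With \<open>norm x \<le> R / 2\<close> and \<open>t \<le> R\<close> the ball
    about \<open>x\<close> stays inside the unit disc and inside the ball of radius \<open>s\<close>
    about 0, where \<open>f\<close> has small mass.\<close>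
  define R where "R = min (s / 2) (1/4)"
  have R: "R > 0" "2 * R \<le> s" "R \<le> 1/4" using s by (auto simp: R_def)
  obtain C1 where C1: "\<And>x. x \<noteq> 0 \<Longrightarrow> norm x \<le> 1/3 \<Longrightarrow> \<bar>avg (trunc u) x (norm x / 2) - u x\<bar> \<le> C1"
    using avg_near by blast
  obtain C3 where C3: "\<And>x. \<bar>avg (trunc u) x R\<bar> \<le> C3" using avg_abs_le[OF R(1)] by blast
  \<comment> \<open>\<open>c2 / t\<close> bounds the radial derivative on the middle range; from
    \<open>n / 2\<close> to \<open>2 * n\<close> the radius grows by the factor 4, which costs
    \<open>c2 * ln 4\<close>.\<close>
  define c2 where "c2 = ((LBINT y. \<bar>trunc f y\<bar>) + 2 * pi * \<bar>\<gamma>\<bar>) / (2 * pi)"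
  define C where "C = \<bar>C1\<bar> + c2 * ln 4 + \<bar>C3\<bar> + \<bar>\<gamma> * ln R\<bar> + \<bar>\<gamma> * ln 2\<bar>"
  have c2: "c2 \<ge> 0" unfolding c2_def by (intro divide_nonneg_pos add_nonneg_nonneg) auto
  show thesis
  proof (rule that[of "R / 2" C])
    show "R / 2 > 0" using R by simp
    show "C \<ge> 0" using c2 by (simp add: C_def)
    fix x :: "real^2" assume x: "x \<noteq> 0" "norm x \<le> R / 2"
    define n where "n = norm x"
    have n: "n > 0" "n \<le> R / 2" using x by (auto simp: n_def)
    define A where "A t = avg (trunc u) x t" for t
    define I where "I t = (LBINT y. trunc f y * cut t (y - x))" for t
    have der: "(A has_real_derivative - (I t + 2 * pi * \<gamma> * cut t (- x)) / (2 * pi * t)) (at t)" if t: "0 < t" "t \<le> R" for t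
    proof -
      have "cball x t \<subseteq> ball 0 1"
      proof
        fix y assume "y \<in> cball x t"
        then have "norm y \<le> n + t" using norm_triangle_ineq[of x "y - x"] by (simp add: n_def dist_norm norm_minus_commute)
        then show "y \<in> ball 0 1" using n t R by simp
      qed
      from avg_derivative[OF t(1) this] show ?thesis unfolding A_def I_def .
    qed
    have 1: "\<bar>A (n / 2) - u x\<bar> \<le> C1"
      using C1[of x] x R by (simp add: A_def n_def)
    have 2: "\<bar>A (2 * n) - A (n / 2)\<bar> \<le> (\<lambda>t. c2 * ln t) (2 * n) - (\<lambda>t. c2 * ln t) (n / 2)"
    proof (rule increment_le)
      fix t assume t: "n / 2 \<le> t" "t \<le> 2 * n"
      have t0: "0 < t" "t \<le> R" using t n by auto
      show "(A has_real_derivative - (I t + 2 * pi * \<gamma> * cut t (- x)) / (2 * pi * t)) (at t)" by (rule der[OF t0])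
      show "((\<lambda>t. c2 * ln t) has_real_derivative c2 / t) (at t)"
        using t0 by (auto intro!: derivative_eq_intros)
      have "\<bar>I t\<bar> \<le> (LBINT y:ball x t. \<bar>trunc f y\<bar>)"
        unfolding I_def by (rule abs_cut_integral_le[OF trunc_f_integrable t0(1)])
      also have "\<dots> \<le> (LBINT y. \<bar>trunc f y\<bar>)"
        unfolding set_lebesgue_integral_def
        by (intro integral_mono integrable_mult_indicator integrable_abs trunc_f_integrable) (auto simp: indicator_def)
      finally have "\<bar>I t\<bar> \<le> (LBINT y. \<bar>trunc f y\<bar>)" .
      moreover have "\<bar>2 * pi * \<gamma> * cut t (- x)\<bar> \<le> 2 * pi * \<bar>\<gamma>\<bar>"
        using mult_left_mono[OF cut_bounds(2)[of t "-x"], of "2 * pi * \<bar>\<gamma>\<bar>"] cut_bounds(1)[of t "-x"] by (simp add: abs_mult)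
      ultimately have "\<bar>- (I t + 2 * pi * \<gamma> * cut t (- x))\<bar> \<le> 2 * pi * c2"
        unfolding c2_def using abs_triangle_ineq[of "I t" "2 * pi * \<gamma> * cut t (- x)"] by simp
      then have "\<bar>- (I t + 2 * pi * \<gamma> * cut t (- x))\<bar> / \<bar>2 * pi * t\<bar> \<le> 2 * pi * c2 / (2 * pi * t)"
        using t0 by (intro frac_le) auto
      then show "\<bar>- (I t + 2 * pi * \<gamma> * cut t (- x)) / (2 * pi * t)\<bar> \<le> c2 / t"
        unfolding abs_divide by simp
    qed (use n in auto)
    have 3: "\<bar>(\<lambda>t. A t + \<gamma> * ln t) R - (\<lambda>t. A t + \<gamma> * ln t) (2 * n)\<bar> \<le> (\<lambda>t. \<delta> * ln t) R - (\<lambda>t. \<delta> * ln t) (2 * n)"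
    proof (rule increment_le)
      fix t assume t: "2 * n \<le> t" "t \<le> R"
      have t0: "0 < t" using t n by auto
      have "cut t (- x) = 1" using t by (intro cut_inside t0) (simp add: n_def)
      then have "(A has_real_derivative - (I t + 2 * pi * \<gamma>) / (2 * pi * t)) (at t)"
        using der[OF t0 t(2)] by simp
      then show "((\<lambda>t. A t + \<gamma> * ln t) has_real_derivative - I t / (2 * pi * t)) (at t)"
        using t0 by (auto intro!: derivative_eq_intros simp: field_simps)
      show "((\<lambda>t. \<delta> * ln t) has_real_derivative \<delta> / t) (at t)"
        using t0 by (auto intro!: derivative_eq_intros)
      have "\<bar>I t\<bar> \<le> (LBINT y:ball x t. \<bar>trunc f y\<bar>)"
        unfolding I_def by (rule abs_cut_integral_le[OF trunc_f_integrable t0(1)])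
      also have "\<dots> \<le> (LBINT y:ball 0 s. \<bar>trunc f y\<bar>)"
      proof (rule ball_integral_mono[OF trunc_f_integrable])
        show "ball x t \<subseteq> ball 0 s"
          using t n R by (auto simp: ball_subset_ball_iff n_def)
      qed
      also have "\<dots> \<le> 2 * pi * \<delta>" by (rule s(2))
      finally have "\<bar>I t\<bar> / (2 * pi * t) \<le> (2 * pi * \<delta>) / (2 * pi * t)" using t0 by (intro divide_right_mono) auto
      then show "\<bar>- I t / (2 * pi * t)\<bar> \<le> \<delta> / t" using t0 by (simp add: abs_mult)
    qed (use n in auto)
    have "ln (2 * n) - ln (n / 2) = ln (4::real)"
      using n ln_realpow[of 2 2] by (simp add: ln_mult ln_div)
    then have 2: "\<bar>A (2 * n) - A (n / 2)\<bar> \<le> c2 * ln 4" using 2 by (simp flip: right_diff_distrib)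
    have l2: "ln (2 * n) = ln 2 + ln n" using n by (simp add: ln_mult)
    have "\<delta> * ln R \<le> \<delta> * ln 2"
      using R \<delta> by (intro mult_left_mono ln_mono) auto
    then have "\<delta> * ln R - \<delta> * (ln 2 + ln n) \<le> - \<delta> * ln n" by (simp add: algebra_simps)
    moreover have "\<bar>A R + \<gamma> * ln R - (A (2 * n) + \<gamma> * (ln 2 + ln n))\<bar> \<le> \<delta> * ln R - \<delta> * (ln 2 + ln n)"
      using 3 unfolding l2 .
    ultimately have 3: "\<bar>A R + \<gamma> * ln R - (A (2 * n) + \<gamma> * ln 2 + \<gamma> * ln n)\<bar> \<le> - \<delta> * ln n"
      by (simp add: distrib_left add.assoc)
    have "\<bar>A R\<bar> \<le> C3" using C3 by (simp add: A_def)
    then have "\<bar>u x + \<gamma> * ln n\<bar> \<le> C + - \<delta> * ln n"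
      using 1 2 3 unfolding C_def by linarith
    then show "\<bar>u x + \<gamma> * ln (norm x)\<bar> \<le> C - \<delta> * ln (norm x)" by (simp add: n_def)
  qed
qed

lemma neg_ln_norm_at_top: "filterlim (\<lambda>x::real^2. - ln (norm x)) at_top (at 0)"
proof -
  have "filterlim (\<lambda>x::real^2. norm x) (at_right 0) (at 0)"
    unfolding filterlim_at by (auto simp: eventually_at_filter intro!: tendsto_eq_intros)
  from filterlim_compose[OF ln_at_0 this] show ?thesis by (simp add: filterlim_uminus_at_top)
qed

lemma u_limit: "((\<lambda>x. u x / (- ln (norm x))) \<longlongrightarrow> \<gamma>) (at 0)"
proof (rule tendstoI)
  fix e :: real assume e: "e > 0"
  then have "e / 2 > 0" by simp
  then obtain C r where C: "r > 0" "C \<ge> 0"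
    "\<And>x. x \<noteq> 0 \<Longrightarrow> norm x \<le> r \<Longrightarrow> \<bar>u x + \<gamma> * ln (norm x)\<bar> \<le> C - e / 2 * ln (norm x)"
    by (rule u_asymptotics) blast
  have "\<forall>\<^sub>F x::real^2 in at 0. - ln (norm x) > 2 * C / e"
    using neg_ln_norm_at_top by (simp add: filterlim_at_top_dense)
  moreover have "\<forall>\<^sub>F x::real^2 in at 0. x \<noteq> 0 \<and> norm x \<le> r"
    using C(1) by (auto simp: eventually_at intro!: exI[of _ r])
  ultimately show "\<forall>\<^sub>F x in at 0. dist (u x / (- ln (norm x))) \<gamma> < e"
  proof eventually_elim
    case (elim x)
    define l where "l = - ln (norm x)"
    have "2 * C / e \<ge> 0" using C e by simp
    moreover have "2 * C / e < l" using elim by (simp only: l_def)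
    \<comment> \<open>Equivalently \<open>C < e / 2 * l\<close>, so the constant and the error
      \<open>e / 2 * l\<close> together stay below \<open>e * l\<close>.\<close>
    ultimately have l: "l > 0" "2 * C / e < l" by linarith+
    have "\<bar>u x - \<gamma> * l\<bar> \<le> C + e / 2 * l" using C(3)[of x] elim by (simp add: l_def)
    also have "\<dots> < e * l" using l e by (simp add: field_simps)
    finally have "\<bar>u x - \<gamma> * l\<bar> / l < e" using l by (simp add: pos_divide_less_eq)
    moreover have "u x / l - \<gamma> = (u x - \<gamma> * l) / l" using l by (simp add: diff_divide_distrib)
    ultimately show "dist (u x / (- ln (norm x))) \<gamma> < e"
      using l by (simp add: dist_real_def l_def[symmetric] abs_divide)
  qed
qed

text \<open>Both bounds pass to the limit: the lower one from positivity of \<open>u\<close>, the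
  upper one from \<open>u_bound\<close>, where \<open>2 / b\<close> is the coefficient of the
  logarithm.\<close>

lemma \<gamma>_bounds: "0 \<le> \<gamma>" "\<gamma> \<le> 2 / b"
proof -
  have near: "\<forall>\<^sub>F x::real^2 in at 0. x \<noteq> 0 \<and> norm x \<le> 1/2"
    by (auto simp: eventually_at intro!: exI[of _ "1/2"])
  have "\<forall>\<^sub>F x in at 0. 0 \<le> u x / (- ln (norm x))"
    using near
  proof eventually_elim
    case (elim x)
    then have "u x > 0" "ln (norm x) < 0" using u_pos[of x] by auto
    then show ?case by (simp add: divide_nonneg_neg)
  qed
  then show "0 \<le> \<gamma>" by (rule tendsto_lowerbound[OF u_limit]) simp
  have "((\<lambda>x::real^2. ln (4 * KO) / b / (- ln (norm x)) + 2 / b) \<longlongrightarrow> 0 + 2 / b) (at 0)"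
    by (intro tendsto_add real_tendsto_divide_at_top[OF tendsto_const neg_ln_norm_at_top] tendsto_const)
  moreover have "\<forall>\<^sub>F x in at 0. u x / (- ln (norm x)) \<le> ln (4 * KO) / b / (- ln (norm x)) + 2 / b"
    using near
  proof eventually_elim
    case (elim x)
    then have l: "- ln (norm x) > 0" by simp
    have "u x / (- ln (norm x)) \<le> (ln (4 * KO) + 2 * ln (1 / norm x)) / b / (- ln (norm x))"
      using u_bound[of x] elim l by (intro divide_right_mono) auto
    also have "ln (1 / norm x) = - ln (norm x)" using elim by (simp add: ln_div)
    also have "(ln (4 * KO) + 2 * - ln (norm x)) / b / (- ln (norm x)) = ln (4 * KO) / b / (- ln (norm x)) + 2 / b"
      using l by (simp only: add_divide_distrib) simp
    finally show ?case .
  qed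
  ultimately have "\<gamma> \<le> 0 + 2 / b"
    by (intro tendsto_le[OF _ _ u_limit]) auto
  then show "\<gamma> \<le> 2 / b" by simp
qed

end

section \<open>Regularity when the flux vanishes\<close>

text \<open>\<open>W t\<close> stands for averages at radius \<open>t\<close>. Being uniformly
  Cauchy, they have a continuous limit that matches every pointwise limit already known, and at the
  origin it supplies the missing value.\<close>

lemma uniform_approximation_continuous:
  fixes W :: "real \<Rightarrow> 'a::metric_space \<Rightarrow> real"
  assumes T: "T > 0" and cont: "\<And>t. 0 < t \<Longrightarrow> t \<le> T \<Longrightarrow> continuous_on S (W t)"
    and cauchy: "\<And>s t x. 0 < s \<Longrightarrow> s \<le> t \<Longrightarrow> t \<le> T \<Longrightarrow> x \<in> S \<Longrightarrow> \<bar>W t x - W s x\<bar> \<le> c t"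
    and c: "(c \<longlongrightarrow> 0) (at_right 0)"
  obtains l where "continuous_on S l" "\<And>x L. x \<in> S \<Longrightarrow> ((\<lambda>t. W t x) \<longlongrightarrow> L) (at_right 0) \<Longrightarrow> l x = L"
proof -
  define t where "t n = T / real (Suc n)" for n
  have t: "0 < t n" "t n \<le> T" for n using T by (auto simp: t_def field_simps)
  have t_anti: "t k \<le> t n" if "n \<le> k" for n k
    unfolding t_def using that T by (intro divide_left_mono) auto
  have t_lim: "t \<longlonglongrightarrow> 0"
    using tendsto_mult_left[OF LIMSEQ_inverse_real_of_nat, of T] by (simp add: t_def[abs_def] field_simps)
  then have t_lim': "filterlim t (at_right 0) sequentially"
    using t(1) less_imp_neq[OF t(1)] by (auto simp: filterlim_at intro!: always_eventually)
  have "uniformly_Cauchy_on S (\<lambda>n. W (t n))"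
  proof (rule uniformly_Cauchy_onI')
    fix e :: real assume "e > 0"
    then have "\<forall>\<^sub>F n in sequentially. c (t n) < e"
      using order_tendstoD(2)[OF filterlim_compose[OF c t_lim']] by simp
    then obtain N where N: "\<And>n. n \<ge> N \<Longrightarrow> c (t n) < e"
      unfolding eventually_sequentially by blast
    have "dist (W (t n) x) (W (t k) x) < e" if "x \<in> S" "n \<ge> N" "k > n" for x n k
      using cauchy[OF t(1) t_anti t(2) that(1), of n k] N[OF that(2)] that(3) by (simp add: dist_real_def)
    then show "\<exists>N. \<forall>x\<in>S. \<forall>n\<ge>N. \<forall>k>n. dist (W (t n) x) (W (t k) x) < e" by blast
  qed
  then obtain l where l: "uniform_limit S (\<lambda>n. W (t n)) l sequentially"
    using Cauchy_uniformly_convergent by (auto simp: uniformly_convergent_on_def)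
  show thesis
  proof (rule that)
    show "continuous_on S l"
      by (rule uniform_limit_theorem[OF _ l]) (auto intro!: always_eventually cont t)
    fix x L assume x: "x \<in> S" and "((\<lambda>t. W t x) \<longlongrightarrow> L) (at_right 0)"
    then have "(\<lambda>n. W (t n) x) \<longlonglongrightarrow> L" by (intro filterlim_compose[OF _ t_lim'])
    moreover have "(\<lambda>n. W (t n) x) \<longlonglongrightarrow> l x" by (rule tendsto_uniform_limitI[OF l x])
    ultimately show "l x = L" using LIMSEQ_unique by blast
  qed
qed

lemma continuous_convolution:
  fixes U k :: "'a::euclidean_space \<Rightarrow> real"
  assumes U: "integrable lborel U" and k: "continuous_on UNIV k" and B: "\<And>z. \<bar>k z\<bar> \<le> B"
  shows "continuous_on S (\<lambda>x. LBINT y. U y * k (y - x))"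
proof (rule continuous_at_imp_continuous_on, rule ballI)
  fix x
  have km: "k \<in> borel_measurable borel" by (rule borel_measurable_continuous_onI[OF k])
  have "((\<lambda>x. LBINT y. U y * k (y - x)) \<longlongrightarrow> (LBINT y. U y * k (y - x))) (at x within UNIV)"
  proof (rule integral_tendsto_at_within[where w="\<lambda>y. \<bar>U y\<bar> * B"])
    show "(\<lambda>y. U y * k (y - x)) \<in> borel_measurable lborel" for x
      using U km by measurable
    show "(\<lambda>y. U y * k (y - x)) \<in> borel_measurable lborel"
      using U km by measurable
    show "integrable lborel (\<lambda>y. \<bar>U y\<bar> * B)" using U by auto
    have "isCont k z" for z using k by (simp add: continuous_on_eq_continuous_at)
    then have "((\<lambda>z. k (y - z)) \<longlongrightarrow> k (y - x)) (at x)" for y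
      by (intro isCont_tendsto_compose[of _ k] tendsto_intros)
    then show "AE y in lborel. ((\<lambda>z. U y * k (y - z)) \<longlongrightarrow> U y * k (y - x)) (at x within UNIV)"
      by (intro AE_I2 tendsto_mult_left)
    show "\<bar>U y * k (y - z)\<bar> \<le> \<bar>U y\<bar> * B" for z y
      unfolding abs_mult using B by (intro mult_left_mono) auto
  qed
  then show "isCont (\<lambda>x. LBINT y. U y * k (y - x)) x" by (simp add: isCont_def)
qed

lemma continuous_avg:
  assumes "integrable lborel U" "t > 0"
  shows "continuous_on S (\<lambda>x. avg U x t)" and "i \<in> Basis \<Longrightarrow> continuous_on S (\<lambda>x. davg i U x t)"
proof -
  obtain B where B: "\<And>R y. R > 0 \<Longrightarrow> kern R y \<le> B / R\<^sup>2"
    "\<And>R y i. R > 0 \<Longrightarrow> i \<in> Basis \<Longrightarrow> \<bar>dkern i R y\<bar> \<le> B / R ^ 3" by (rule kernel_bounds) blast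
  show "continuous_on S (\<lambda>x. avg U x t)"
    unfolding avg_def using B(1)[OF assms(2)] kern_nonneg[OF assms(2)]
    by (intro continuous_convolution[of _ _ "B / t\<^sup>2"] assms continuous_kern) auto
  show "continuous_on S (\<lambda>x. davg i U x t)" if "i \<in> Basis"
    unfolding davg_def using B(2)[OF assms(2) that]
    by (intro continuous_minus continuous_on_minus continuous_convolution[of _ _ "B / t ^ 3"] assms continuous_dkern) auto
qed

lemma cmult_powr_has_derivative:
  assumes "0 < (t::real)" "e = c * p" "d = p - 1"
  shows "((\<lambda>t. c * t powr p) has_real_derivative e * t powr d) (at t)"
  using DERIV_cmult[OF has_real_derivative_powr[OF assms(1)], of c p] assms by (simp add: mult.assoc)

lemma powr_tendsto_0_right:
  assumes "p > (0::real)"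
  shows "((\<lambda>t. K * t powr p) \<longlongrightarrow> 0) (at_right 0)"
proof -
  have "((\<lambda>t. K * t powr p) \<longlongrightarrow> K * 0 powr p) (at_right 0)"
    using assms by (intro tendsto_mult tendsto_const tendsto_powr' tendsto_ident_at)
      (auto simp: eventually_at_right_less eventually_at_filter)
  then show ?thesis by simp
qed

context punctured_solution
begin

lemma sub_unit_ball:
  assumes "norm x \<le> 1/4" "t \<le> 1/2"
  shows "cball x t \<subseteq> ball 0 1"
proof
  fix y assume "y \<in> cball x t"
  then have "norm y \<le> norm x + t" using norm_triangle_ineq[of x "y - x"] by (simp add: dist_norm norm_minus_commute)
  then show "y \<in> ball 0 1" using assms by simp
qed

text \<open>With \<open>\<gamma> = 0\<close>, \<open>u_asymptotics\<close> lets \<open>u\<close>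
  grow only like an arbitrarily small multiple of \<open>- ln (norm x)\<close>; the multiple
  \<open>e / b\<close> becomes the power \<open>- e\<close> after exponentiation.\<close>

lemma expu_decay_zero:
  assumes z: "\<gamma> = 0" and e: "e > 0"
  obtains C where "C \<ge> 0" "\<And>x. x \<in> cball 0 1 - {0} \<Longrightarrow> \<bar>exp (b * u x)\<bar> \<le> C * norm x powr (- e)"
proof -
  have "e / b > 0" using e b by simp
  then obtain C r where C: "r > 0" "C \<ge> 0"
    "\<And>x. x \<noteq> 0 \<Longrightarrow> norm x \<le> r \<Longrightarrow> \<bar>u x + \<gamma> * ln (norm x)\<bar> \<le> C - e / b * ln (norm x)"
    by (rule u_asymptotics) blast
  have near: "\<bar>exp (b * u x)\<bar> \<le> exp (b * C) * norm x powr (- e)" if x: "x \<noteq> 0" "norm x \<le> r" for x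
  proof -
    have "u x \<le> C - e / b * ln (norm x)" using C(3)[OF x] z by simp
    then have "b * u x \<le> b * (C - e / b * ln (norm x))" using b by (intro mult_left_mono) auto
    also have "\<dots> = b * C + - e * ln (norm x)" using b by (simp add: right_diff_distrib)
    finally have "exp (b * u x) \<le> exp (b * C) * exp (- e * ln (norm x))" by (simp flip: exp_add)
    then show ?thesis using x by (simp add: powr_def)
  qed
  show thesis
    by (rule decay_extend[OF cont_expu C(1) _ near]) (use e that in auto)
qed

lemma f_decay:
  assumes C1: "C1 \<ge> 0" "\<And>x. x \<in> cball 0 1 - {0} \<Longrightarrow> norm (g x) powr q \<le> C1 * norm x powr (- \<beta>)"
    and C2: "C2 \<ge> 0" "\<And>x. x \<in> cball 0 1 - {0} \<Longrightarrow> exp (b * u x) \<le> C2 * norm x powr (- \<beta>)"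
  obtains C where "C \<ge> 0" "\<And>x. x \<in> \<Omega> \<Longrightarrow> \<bar>f x\<bar> \<le> C * norm x powr (- \<beta>)"
proof (rule that[of "m * C1 + a * C2"])
  show "m * C1 + a * C2 \<ge> 0" using m a C1(1) C2(1) by simp
  fix x assume "x \<in> \<Omega>"
  then have x: "x \<in> cball 0 1 - {0}" using \<Omega>_sub by blast
  have "m * norm (g x) powr q \<le> m * (C1 * norm x powr (- \<beta>))" "a * exp (b * u x) \<le> a * (C2 * norm x powr (- \<beta>))"
    using C1(2)[OF x] C2(2)[OF x] m a by (auto intro: mult_left_mono)
  then show "\<bar>f x\<bar> \<le> (m * C1 + a * C2) * norm x powr (- \<beta>)"
    using abs_f_le[of x] by (simp add: algebra_simps)
qed

text \<open>With \<open>\<gamma> = 0\<close> there is no Dirac term, so the radial derivative is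
  controlled by the mass of \<open>f\<close> on the ball, of order
  \<open>t powr (2 - \<beta>)\<close>, divided by \<open>t\<close>. The estimate is uniform in
  \<open>x\<close> and includes \<open>x = 0\<close>, on which the extension relies.\<close>

lemma avg_error:
  assumes z: "\<gamma> = 0" and C: "C \<ge> 0" "\<And>x. x \<in> \<Omega> \<Longrightarrow> \<bar>f x\<bar> \<le> C * norm x powr (- \<beta>)" and \<beta>: "0 \<le> \<beta>" "\<beta> < 2"
  obtains K where "K \<ge> 0" "\<And>x s t. norm x \<le> 1/4 \<Longrightarrow> 0 < s \<Longrightarrow> s \<le> t \<Longrightarrow> t \<le> 1/2 \<Longrightarrow>
    \<bar>avg (trunc u) x t - avg (trunc u) x s\<bar> \<le> K * t powr (2 - \<beta>)"
proof -
  define D where "D = C * (pi + 2 * pi / (2 - \<beta>))"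
  have D: "D \<ge> 0" unfolding D_def using C(1) \<beta> by (intro mult_nonneg_nonneg add_nonneg_nonneg) auto
  have int: "(LBINT y:ball x t. \<bar>trunc f y\<bar>) \<le> D * t powr (2 - \<beta>)" if "t > 0" for x t
    unfolding D_def by (rule decay_integrable(2)[OF cont_f_\<Omega> \<beta> C(2) that])
  define K where "K = D / (2 * pi * (2 - \<beta>))"
  have K: "K \<ge> 0" unfolding K_def using D \<beta> by (intro divide_nonneg_pos) auto
  show thesis
  proof (rule that[OF K])
    fix x :: "real^2" and s t :: real assume x: "norm x \<le> 1/4" and st: "0 < s" "s \<le> t" "t \<le> 1/2"
    have "\<bar>avg (trunc u) x t - avg (trunc u) x s\<bar> \<le> (\<lambda>t. K * t powr (2 - \<beta>)) t - (\<lambda>t. K * t powr (2 - \<beta>)) s"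
    proof (rule increment_le[OF st(2)])
      fix r assume r: "s \<le> r" "r \<le> t"
      have r0: "r > 0" "r \<le> 1/2" using r st by auto
      let ?I = "LBINT y. trunc f y * cut r (y - x)"
      show "((\<lambda>t. avg (trunc u) x t) has_real_derivative - ?I / (2 * pi * r)) (at r)"
        using avg_derivative[OF r0(1) sub_unit_ball[OF x r0(2)]] z by simp
      show "((\<lambda>t. K * t powr (2 - \<beta>)) has_real_derivative K * (2 - \<beta>) * r powr (1 - \<beta>)) (at r)"
        by (rule cmult_powr_has_derivative[OF r0(1)]) auto
      have "\<bar>- ?I / (2 * pi * r)\<bar> \<le> D * r powr (2 - \<beta>) / (2 * pi * r)"
        unfolding abs_divide abs_minus_cancel
        using D r0 order_trans[OF abs_cut_integral_le[OF trunc_f_integrable r0(1)] int[OF r0(1)]]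
        by (intro frac_le) auto
      also have "\<dots> = D / (2 * pi) * (r powr (2 - \<beta>) / r powr 1)" using r0 by simp
      also have "r powr (2 - \<beta>) / r powr 1 = r powr (1 - \<beta>)" unfolding powr_diff[symmetric] by simp
      also have "D / (2 * pi) * r powr (1 - \<beta>) = K * (2 - \<beta>) * r powr (1 - \<beta>)"
        using \<beta> by (simp add: K_def)
      finally show "\<bar>- ?I / (2 * pi * r)\<bar> \<le> K * (2 - \<beta>) * r powr (1 - \<beta>)" .
    qed
    also have "\<dots> \<le> K * t powr (2 - \<beta>)" using K by simp
    finally show "\<bar>avg (trunc u) x t - avg (trunc u) x s\<bar> \<le> K * t powr (2 - \<beta>)" .
  qed
qed

text \<open>By \<open>avg_error\<close> with some \<open>\<beta>\<close> between \<open>q\<close>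
  and 2, \<open>u x\<close> differs by a bounded amount from its average at radius 1/2, and those
  averages are bounded.\<close>

lemma u_bounded:
  assumes z: "\<gamma> = 0"
  obtains L where "L \<ge> 1" "\<And>x. x \<in> cball 0 1 - {0} \<Longrightarrow> u x \<le> L"
proof -
  define \<beta> where "\<beta> = (q + 2) / 2"
  have \<beta>: "q < \<beta>" "\<beta> < 2" "0 \<le> \<beta>" "0 < \<beta>" using q by (auto simp: \<beta>_def)
  obtain C1 where C1: "C1 \<ge> 0" "\<And>x. x \<in> cball 0 1 - {0} \<Longrightarrow> \<bar>norm (g x) powr q\<bar> \<le> C1 * norm x powr (- \<beta>)"
    using gradq_decay[OF \<beta>(1)] by blast
  obtain C2 where C2: "C2 \<ge> 0" "\<And>x. x \<in> cball 0 1 - {0} \<Longrightarrow> \<bar>exp (b * u x)\<bar> \<le> C2 * norm x powr (- \<beta>)"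
    using expu_decay_zero[OF z \<beta>(4)] by blast
  obtain C where C: "C \<ge> 0" "\<And>x. x \<in> \<Omega> \<Longrightarrow> \<bar>f x\<bar> \<le> C * norm x powr (- \<beta>)"
    using f_decay[of C1 \<beta> C2] C1 C2 by auto
  obtain K where K: "K \<ge> 0" "\<And>x s t. norm x \<le> 1/4 \<Longrightarrow> 0 < s \<Longrightarrow> s \<le> t \<Longrightarrow> t \<le> 1/2 \<Longrightarrow>
    \<bar>avg (trunc u) x t - avg (trunc u) x s\<bar> \<le> K * t powr (2 - \<beta>)"
    using avg_error[OF z C \<beta>(3,2)] by blast
  have half: "(1/2::real) > 0" by simp
  obtain C3 where C3: "\<And>x. \<bar>avg (trunc u) x (1/2)\<bar> \<le> C3"
    using avg_abs_le[OF half] by blast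
  obtain M where M: "M \<ge> 0" "\<And>x. x \<in> cball 0 1 \<Longrightarrow> norm x \<ge> 1/4 \<Longrightarrow> \<bar>u x\<bar> \<le> M"
    using bounded_away_from_0[OF u_cont, of "1/4"] by auto
  have near: "u x \<le> C3 + K * (1/2) powr (2 - \<beta>)" if x: "x \<noteq> 0" "norm x \<le> 1/4" for x
  proof -
    have "x \<in> \<Omega>" using x by auto
    then have "\<bar>avg (trunc u) x (1/2) - u x\<bar> \<le> K * (1/2) powr (2 - \<beta>)"
      by (rule avg_bound_limit) (use K(2)[OF x(2)] in auto)
    then show ?thesis using C3[of x] by linarith
  qed
  show thesis
  proof (rule that[of "max 1 (max M (C3 + K * (1/2) powr (2 - \<beta>)))"])
    fix x :: "real^2" assume x: "x \<in> cball 0 1 - {0}"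
    show "u x \<le> max 1 (max M (C3 + K * (1/2) powr (2 - \<beta>)))"
      using near[of x] M(2)[of x] x by (cases "norm x \<le> 1/4") auto
  qed simp
qed

text \<open>\<open>interior_gradient\<close> with a constant \<open>L\<close>, now that
  \<open>u\<close> is bounded: the endpoint \<open>p = 1\<close> missing from
  \<open>grad_decay\<close>, and the start of the bootstrap.\<close>

lemma grad_decay_1:
  assumes z: "\<gamma> = 0"
  obtains C where "C \<ge> 0" "\<And>x. x \<in> cball 0 1 - {0} \<Longrightarrow> norm (g x) \<le> C * norm x powr (- 1)"
proof -
  obtain L where L: "L \<ge> 1" "\<And>x. x \<in> cball 0 1 - {0} \<Longrightarrow> u x \<le> L" using u_bounded[OF z] by blast
  have "exp (b * L) \<ge> 0" by simp
  then obtain C where C: "C > 0" and grad: "\<And>x r L'. 0 < r \<Longrightarrow> r \<le> 1 \<Longrightarrow> cball x r \<subseteq> \<Omega> \<Longrightarrow> L' \<ge> 1 \<Longrightarrow>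
    (\<And>y. y \<in> cball x r \<Longrightarrow> u y \<le> L') \<Longrightarrow> (\<And>y. y \<in> cball x r \<Longrightarrow> exp (b * u y) \<le> exp (b * L) / r\<^sup>2) \<Longrightarrow>
    r * norm (g x) \<le> C * L' powr (1 / (2 - q))"
    by (rule interior_gradient) blast
  have near: "\<bar>norm (g x)\<bar> \<le> (2 * (C * L powr (1 / (2 - q)))) * norm x powr (- 1)" if x: "x \<noteq> 0" "norm x \<le> 1/2" for x
  proof -
    have sub: "cball x (norm x / 2) \<subseteq> \<Omega>" by (rule half_ball_sub(1)[OF x])
    have r: "0 < norm x / 2" "norm x / 2 \<le> 1" using x by auto
    have "norm x / 2 * norm (g x) \<le> C * L powr (1 / (2 - q))"
    proof (rule grad[OF r sub L(1)])
      fix y assume "y \<in> cball x (norm x / 2)"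
      then have "y \<in> cball 0 1 - {0}" using sub \<Omega>_sub by blast
      then show uy: "u y \<le> L" by (rule L(2))
      have "exp (b * u y) \<le> exp (b * L) / 1" using uy b by simp
      also have "\<dots> \<le> exp (b * L) / (norm x / 2)\<^sup>2"
        using r by (intro divide_left_mono power_le_one) auto
      finally show "exp (b * u y) \<le> exp (b * L) / (norm x / 2)\<^sup>2" .
    qed
    then show ?thesis using x by (simp add: powr_minus field_simps)
  qed
  obtain C' where "C' \<ge> 0" "\<And>x. x \<in> cball 0 1 - {0} \<Longrightarrow> \<bar>norm (g x)\<bar> \<le> C' * norm x powr (- 1)"
    by (rule decay_extend[of "\<lambda>x. norm (g x)" "1/2" 1 "2 * (C * L powr (1 / (2 - q)))"])
      (use near in \<open>auto intro!: continuous_intros g_cont\<close>)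
  then show thesis by (intro that[of C']) auto
qed

section \<open>Averages of the gradient without a Dirac mass\<close>

lemma davg_derivative:
  assumes z: "\<gamma> = 0" and R: "R > 0" "cball x R \<subseteq> ball 0 1" and i: "i \<in> Basis"
  shows "((\<lambda>t. davg i (trunc u) x t) has_real_derivative (LBINT y. trunc f y * dcut i R (y - x)) / (2 * pi * R)) (at R)"
  using davg_has_derivative[OF trunc_u_integrable R(1) i, of x] solves_cut_0(2)[OF R i] z by simp

lemma davg_tendsto:
  assumes x: "x \<in> \<Omega>" and i: "i \<in> Basis"
  shows "((\<lambda>r. davg i (trunc u) x r) \<longlongrightarrow> g x \<bullet> i) (at_right 0)"
proof -
  have cgi: "continuous_on \<Omega> (\<lambda>y. g y \<bullet> i)" by (intro continuous_intros cont_\<Omega>)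
  \<comment> \<open>Any exponent above 1, for \<open>grad_decay\<close>, and below 2, for
    integrability, would serve.\<close>
  obtain C where C: "C \<ge> 0" "\<And>x. x \<in> cball 0 1 - {0} \<Longrightarrow> norm (g x) \<le> C * norm x powr (- (3/2))"
    using grad_decay[of "3/2"] by auto
  have int: "integrable lborel (trunc (\<lambda>y. g y \<bullet> i))"
  proof (rule decay_integrable(1)[OF cgi, of "3/2" C])
    fix y assume "y \<in> \<Omega>"
    then show "\<bar>g y \<bullet> i\<bar> \<le> C * norm y powr (- (3/2))"
      using C(2)[of y] \<Omega>_sub Basis_le_norm[OF i, of "g y"] by (intro order_trans[OF _ C(2)]) auto
  qed auto
  obtain d where d: "d > 0" "cball x d \<subseteq> \<Omega>"
    using open_\<Omega> x open_contains_cball by blast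
  have "((\<lambda>r. avg (trunc (\<lambda>y. g y \<bullet> i)) x r) \<longlongrightarrow> trunc (\<lambda>y. g y \<bullet> i) x) (at_right 0)"
    by (rule avg_tendsto[OF int trunc_isCont[OF cgi x]])
  moreover have "\<forall>\<^sub>F r in at_right 0. avg (trunc (\<lambda>y. g y \<bullet> i)) x r = davg i (trunc u) x r"
    unfolding eventually_at_right_field
  proof (intro exI[of _ d] conjI allI impI)
    fix r assume r: "0 < r" "r < d"
    have "cball x r \<subseteq> cball x d" using r by auto
    then have sub: "cball x r \<subseteq> \<Omega>" using d by blast
    have "y \<in> \<Omega>" if "y \<in> ball x r" for y using that sub ball_subset_cball by blast
    then show "avg (trunc (\<lambda>y. g y \<bullet> i)) x r = davg i (trunc u) x r"
      by (intro davg_eq_avg_derivative[OF open_\<Omega> sub r(1) i u_deriv cont_\<Omega>(2), symmetric]) (auto simp: trunc_eq)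
  qed (use d in auto)
  ultimately have "((\<lambda>r. davg i (trunc u) x r) \<longlongrightarrow> trunc (\<lambda>y. g y \<bullet> i) x) (at_right 0)"
    by (rule Lim_transform_eventually)
  then show ?thesis by (simp only: trunc_eq[OF x])
qed

text \<open>The first rate \<open>t powr (- \<beta>)\<close> is not integrable at 0 once
  \<open>\<beta> \<ge> 1\<close>. For small radii the ball stays at distance at least
  \<open>n\<close> from the origin, where \<open>f\<close> is at most
  \<open>C * n powr (- \<beta>)\<close>; this gives the second, constant rate.\<close>

lemma davg_derivative_bound:
  assumes C: "C \<ge> 0" "\<And>x. x \<in> \<Omega> \<Longrightarrow> \<bar>f x\<bar> \<le> C * norm x powr (- \<beta>)" and \<beta>: "0 \<le> \<beta>" "\<beta> < 2"
  obtains K where "K \<ge> 0"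
    "\<And>i x t. i \<in> Basis \<Longrightarrow> 0 < t \<Longrightarrow> \<bar>(LBINT y. trunc f y * dcut i t (y - x)) / (2 * pi * t)\<bar> \<le> K * t powr (- \<beta>)"
    "\<And>i x t n. i \<in> Basis \<Longrightarrow> 0 < t \<Longrightarrow> t \<le> n \<Longrightarrow> 2 * n \<le> norm x \<Longrightarrow>
      \<bar>(LBINT y. trunc f y * dcut i t (y - x)) / (2 * pi * t)\<bar> \<le> K * n powr (- \<beta>)"
proof -
  define D where "D = C * (pi + 2 * pi / (2 - \<beta>))"
  have D: "D \<ge> 0" unfolding D_def using C(1) \<beta> by (intro mult_nonneg_nonneg add_nonneg_nonneg) auto
  have int: "(LBINT y:ball x t. \<bar>trunc f y\<bar>) \<le> D * t powr (2 - \<beta>)" if "t > 0" for x t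
    unfolding D_def by (rule decay_integrable(2)[OF cont_f_\<Omega> \<beta> C(2) that])
  obtain B where B: "B > 0"
    "\<And>(i::real^2) F x R. i \<in> Basis \<Longrightarrow> R > 0 \<Longrightarrow> set_integrable lborel (ball x R) F \<Longrightarrow>
      \<bar>LBINT y. F y * dcut i R (y - x)\<bar> \<le> B / R * (LBINT y:ball x R. \<bar>F y\<bar>)"
    by (rule davg_bound) blast
  have le: "\<bar>(LBINT y. trunc f y * dcut i t (y - x)) / (2 * pi * t)\<bar> \<le> B / (2 * pi) * (J / t\<^sup>2)"
    if i: "i \<in> Basis" and t: "0 < t" and J: "(LBINT y:ball x t. \<bar>trunc f y\<bar>) \<le> J" for i x t J
  proof -
    have "\<bar>LBINT y. trunc f y * dcut i t (y - x)\<bar> \<le> B / t * J"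
      using B(1) t by (intro order_trans[OF B(2)[OF i t trunc_set_integrable[OF trunc_f_integrable]]] mult_left_mono J) auto
    then have "\<bar>(LBINT y. trunc f y * dcut i t (y - x)) / (2 * pi * t)\<bar> \<le> B / t * J / (2 * pi * t)"
      unfolding abs_divide using t by (intro frac_le) auto
    also have "\<dots> = B / (2 * pi) * (J / t\<^sup>2)" by (simp add: power2_eq_square)
    finally show ?thesis .
  qed
  define K where "K = B / (2 * pi) * (D + pi * C)"
  show thesis
  proof (rule that[of K])
    show "K \<ge> 0" unfolding K_def using B(1) D C(1) by (intro mult_nonneg_nonneg add_nonneg_nonneg) auto
    fix i x :: "real^2" and t :: real assume i: "i \<in> Basis" and t: "0 < t"
    have "\<bar>(LBINT y. trunc f y * dcut i t (y - x)) / (2 * pi * t)\<bar> \<le> B / (2 * pi) * (D * t powr (2 - \<beta>) / t\<^sup>2)"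
      by (rule le[OF i t int[OF t]])
    also have "D * t powr (2 - \<beta>) / t\<^sup>2 = D * t powr (- \<beta>)"
    proof -
      have "t\<^sup>2 = t powr 2" using t by simp
      then have "t powr (2 - \<beta>) / t\<^sup>2 = t powr (2 - \<beta> - 2)" by (simp only: powr_diff)
      then have "t powr (2 - \<beta>) / t\<^sup>2 = t powr (- \<beta>)" by simp
      then show ?thesis by (simp only: times_divide_eq_right[symmetric])
    qed
    also have "B / (2 * pi) * (D * t powr (- \<beta>)) \<le> K * t powr (- \<beta>)"
      unfolding K_def mult.assoc[symmetric] using B(1) C(1)
      by (intro mult_right_mono mult_left_mono) auto
    finally show "\<bar>(LBINT y. trunc f y * dcut i t (y - x)) / (2 * pi * t)\<bar> \<le> K * t powr (- \<beta>)" .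
  next
    fix i x :: "real^2" and t n :: real assume i: "i \<in> Basis" and t: "0 < t" and n: "t \<le> n" "2 * n \<le> norm x"
    have "(LBINT y:ball x t. \<bar>trunc f y\<bar>) \<le> pi * t\<^sup>2 * (C * n powr (- \<beta>))"
    proof (rule integral_ball_const_le[OF trunc_set_integrable[OF trunc_f_integrable] t])
      fix y assume "y \<in> ball x t"
      then have ny: "n \<le> norm y"
        using n norm_triangle_ineq2[of x y] by (simp add: dist_norm)
      show "\<bar>trunc f y\<bar> \<le> C * n powr (- \<beta>)"
      proof (cases "y \<in> \<Omega>")
        case True
        have "\<bar>f y\<bar> \<le> C * norm y powr (- \<beta>)" by (rule C(2)[OF True])
        also have "\<dots> \<le> C * n powr (- \<beta>)"
          using ny n t \<beta> C(1) by (intro mult_left_mono powr_mono2') auto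
        finally show ?thesis using True by (simp add: trunc_eq)
      qed (use C(1) in \<open>simp add: trunc_outside\<close>)
    qed
    from le[OF i t this]
    have "\<bar>(LBINT y. trunc f y * dcut i t (y - x)) / (2 * pi * t)\<bar> \<le> B / (2 * pi) * (pi * C) * n powr (- \<beta>)"
      using t by (simp add: mult_ac)
    also have "\<dots> \<le> K * n powr (- \<beta>)"
      unfolding K_def using B(1) D by (intro mult_right_mono mult_left_mono) auto
    finally show "\<bar>(LBINT y. trunc f y * dcut i t (y - x)) / (2 * pi * t)\<bar> \<le> K * n powr (- \<beta>)" .
  qed
qed

lemma davg_half_bounded:
  obtains C where "C \<ge> 0" "\<And>i x. i \<in> Basis \<Longrightarrow> \<bar>davg i (trunc u) x (1/2)\<bar> \<le> C"
proof -
  obtain B where B: "B > 0"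
    "\<And>i U x R. i \<in> Basis \<Longrightarrow> R > 0 \<Longrightarrow> set_integrable lborel (ball x R) U \<Longrightarrow>
      \<bar>davg i U x R\<bar> \<le> B / R ^ 3 * (LBINT y:ball x R. \<bar>U y\<bar>)"
    by (rule davg_bound) blast
  show thesis
  proof (rule that[of "B / (1/2) ^ 3 * (LBINT y. \<bar>trunc u y\<bar>)"])
    show "0 \<le> B / (1/2) ^ 3 * (LBINT y. \<bar>trunc u y\<bar>)" using B(1) by (intro mult_nonneg_nonneg) auto
    fix i x :: "real^2" assume i: "i \<in> Basis"
    have "\<bar>davg i (trunc u) x (1/2)\<bar> \<le> B / (1/2) ^ 3 * (LBINT y:ball x (1/2). \<bar>trunc u y\<bar>)"
      by (rule B(2)[OF i _ trunc_set_integrable[OF trunc_u_integrable]]) simp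
    also have "\<dots> \<le> B / (1/2) ^ 3 * (LBINT y. \<bar>trunc u y\<bar>)"
      unfolding set_lebesgue_integral_def using B(1)
      by (intro mult_left_mono integral_mono integrable_mult_indicator integrable_abs trunc_u_integrable)
        (auto simp: indicator_def)
    finally show "\<bar>davg i (trunc u) x (1/2)\<bar> \<le> B / (1/2) ^ 3 * (LBINT y. \<bar>trunc u y\<bar>)" .
  qed
qed

text \<open>Put \<open>n = norm x / 2\<close>. The rate \<open>t powr (- \<beta>)\<close> between
  \<open>n\<close> and 1/2 and the constant rate \<open>n powr (- \<beta>)\<close> below
  \<open>n\<close> both add up to order \<open>n powr (1 - \<beta>)\<close>: integrating the source
  gains one power.\<close>

lemma bootstrap_step:
  assumes z: "\<gamma> = 0" and C: "C \<ge> 0" "\<And>x. x \<in> \<Omega> \<Longrightarrow> \<bar>f x\<bar> \<le> C * norm x powr (- \<beta>)" and \<beta>: "1 < \<beta>" "\<beta> < 2"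
  obtains C' where "C' \<ge> 0" "\<And>x. x \<in> cball 0 1 - {0} \<Longrightarrow> norm (g x) \<le> C' * norm x powr (- (\<beta> - 1))"
proof -
  have \<beta>0: "0 \<le> \<beta>" using \<beta> by simp
  obtain K where K: "K \<ge> 0"
    "\<And>i x t. i \<in> Basis \<Longrightarrow> 0 < t \<Longrightarrow> \<bar>(LBINT y. trunc f y * dcut i t (y - x)) / (2 * pi * t)\<bar> \<le> K * t powr (- \<beta>)"
    "\<And>i x t n. i \<in> Basis \<Longrightarrow> 0 < t \<Longrightarrow> t \<le> n \<Longrightarrow> 2 * n \<le> norm x \<Longrightarrow>
      \<bar>(LBINT y. trunc f y * dcut i t (y - x)) / (2 * pi * t)\<bar> \<le> K * n powr (- \<beta>)"
    using davg_derivative_bound[OF C \<beta>0 \<beta>(2)] by blast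
  obtain C3 where C3: "C3 \<ge> 0" "\<And>i x. i \<in> Basis \<Longrightarrow> \<bar>davg i (trunc u) x (1/2)\<bar> \<le> C3"
    using davg_half_bounded by blast
  define M where "M = C3 + K / (\<beta> - 1) + K"
  have comp: "\<bar>g x \<bullet> i\<bar> \<le> M * (norm x / 2) powr (1 - \<beta>)" if x: "x \<noteq> 0" "norm x \<le> 1/4" and i: "i \<in> Basis" for x i
  proof -
    define n where "n = norm x / 2"
    have n: "0 < n" "n \<le> 1/2" using x by (auto simp: n_def)
    have n1: "n powr (1 - \<beta>) \<ge> 1" using n \<beta> powr_mono2'[of "1 - \<beta>" n 1] by simp
    have der: "((\<lambda>t. davg i (trunc u) x t) has_real_derivative (LBINT y. trunc f y * dcut i t (y - x)) / (2 * pi * t)) (at t)"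
      if "0 < t" "t \<le> 1/2" for t
      by (rule davg_derivative[OF z that(1) sub_unit_ball[OF x(2) that(2)] i])
    have "\<bar>davg i (trunc u) x (1/2) - davg i (trunc u) x n\<bar> \<le>
        (\<lambda>t. - K / (\<beta> - 1) * t powr (1 - \<beta>)) (1/2) - (\<lambda>t. - K / (\<beta> - 1) * t powr (1 - \<beta>)) n"
    proof (rule increment_le[OF n(2)])
      fix t assume t: "n \<le> t" "t \<le> 1/2"
      then have t0: "t > 0" using n by linarith
      show "((\<lambda>t. davg i (trunc u) x t) has_real_derivative (LBINT y. trunc f y * dcut i t (y - x)) / (2 * pi * t)) (at t)"
        by (rule der[OF t0 t(2)])
      show "((\<lambda>t. - K / (\<beta> - 1) * t powr (1 - \<beta>)) has_real_derivative K * t powr (- \<beta>)) (at t)"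
        by (rule cmult_powr_has_derivative[OF t0]) (use \<beta> in \<open>auto simp: field_simps\<close>)
      show "\<bar>(LBINT y. trunc f y * dcut i t (y - x)) / (2 * pi * t)\<bar> \<le> K * t powr (- \<beta>)"
        by (rule K(2)[OF i t0])
    qed
    also have "\<dots> \<le> K / (\<beta> - 1) * n powr (1 - \<beta>)"
    proof -
      have "K / (\<beta> - 1) * (1/2) powr (1 - \<beta>) \<ge> 0" using K(1) \<beta> by (intro mult_nonneg_nonneg) auto
      then show ?thesis by simp
    qed
    finally have 1: "\<bar>davg i (trunc u) x (1/2) - davg i (trunc u) x n\<bar> \<le> K / (\<beta> - 1) * n powr (1 - \<beta>)" .
    have 2: "\<bar>davg i (trunc u) x n - davg i (trunc u) x r\<bar> \<le> K * n powr (1 - \<beta>)" if r: "0 < r" "r < n" for r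
    proof -
      have "\<bar>davg i (trunc u) x n - davg i (trunc u) x r\<bar> \<le> (\<lambda>t. K * n powr (- \<beta>) * t) n - (\<lambda>t. K * n powr (- \<beta>) * t) r"
      proof (rule increment_le)
        fix t assume t: "r \<le> t" "t \<le> n"
        then have t0: "t > 0" using r by linarith
        show "((\<lambda>t. davg i (trunc u) x t) has_real_derivative (LBINT y. trunc f y * dcut i t (y - x)) / (2 * pi * t)) (at t)"
          using t n by (intro der[OF t0]) auto
        show "((\<lambda>t. K * n powr (- \<beta>) * t) has_real_derivative K * n powr (- \<beta>)) (at t)"
          by (auto intro!: derivative_eq_intros)
        show "\<bar>(LBINT y. trunc f y * dcut i t (y - x)) / (2 * pi * t)\<bar> \<le> K * n powr (- \<beta>)"
          by (rule K(3)[OF i t0 t(2)]) (simp add: n_def)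
      qed (use r in auto)
      also have "\<dots> \<le> K * (n powr (- \<beta>) * n)" using K(1) r by simp
      also have "n powr (- \<beta>) * n = n powr (1 - \<beta>)"
      proof -
        have "n powr (- \<beta>) * n powr 1 = n powr (- \<beta> + 1)" by (rule powr_add[symmetric])
        then show ?thesis using n by (simp add: add.commute)
      qed
      finally show ?thesis .
    qed
    have "x \<in> \<Omega>" using x by auto
    then have "((\<lambda>r. \<bar>davg i (trunc u) x n - davg i (trunc u) x r\<bar>) \<longlongrightarrow> \<bar>davg i (trunc u) x n - g x \<bullet> i\<bar>) (at_right 0)"
      by (intro tendsto_intros davg_tendsto i)
    moreover have "\<forall>\<^sub>F r in at_right 0. \<bar>davg i (trunc u) x n - davg i (trunc u) x r\<bar> \<le> K * n powr (1 - \<beta>)"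
      unfolding eventually_at_right_field using 2 n(1) by blast
    ultimately have 3: "\<bar>davg i (trunc u) x n - g x \<bullet> i\<bar> \<le> K * n powr (1 - \<beta>)"
      by (rule tendsto_upperbound) simp
    have "C3 \<le> C3 * n powr (1 - \<beta>)" using mult_left_mono[OF n1 C3(1)] by simp
    then have "\<bar>g x \<bullet> i\<bar> \<le> C3 * n powr (1 - \<beta>) + K / (\<beta> - 1) * n powr (1 - \<beta>) + K * n powr (1 - \<beta>)"
      using 1 3 C3(2)[OF i, of x] by linarith
    then show ?thesis by (simp add: M_def n_def distrib_right)
  qed
  have near: "\<bar>norm (g x)\<bar> \<le> (2 * (M * (1/2) powr (1 - \<beta>))) * norm x powr (- (\<beta> - 1))" if x: "x \<noteq> 0" "norm x \<le> 1/4" for x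
  proof -
    have "norm (g x) \<le> (\<Sum>i\<in>Basis. \<bar>g x \<bullet> i\<bar>)" by (rule norm_le_l1)
    also have "\<dots> \<le> (\<Sum>i\<in>(Basis::(real^2) set). M * (norm x / 2) powr (1 - \<beta>))"
      by (intro sum_mono comp x)
    also have "\<dots> = 2 * (M * (norm x * (1/2)) powr (1 - \<beta>))" by simp
    also have "(norm x * (1/2)) powr (1 - \<beta>) = norm x powr (1 - \<beta>) * (1/2) powr (1 - \<beta>)" by (rule powr_mult)
    finally show ?thesis by (simp add: mult_ac)
  qed
  obtain C' where "C' \<ge> 0" "\<And>x. x \<in> cball 0 1 - {0} \<Longrightarrow> \<bar>norm (g x)\<bar> \<le> C' * norm x powr (- (\<beta> - 1))"
    by (rule decay_extend[of "\<lambda>x. norm (g x)" "1/4" "\<beta> - 1" "2 * (M * (1/2) powr (1 - \<beta>))"])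
      (use near \<beta> in \<open>auto intro!: continuous_intros g_cont\<close>)
  then show thesis by (intro that[of C']) auto
qed

end

lemma Basis_choice:
  assumes "\<And>i. i \<in> Basis \<Longrightarrow> \<exists>l. P i l"
  obtains l where "\<And>i. i \<in> Basis \<Longrightarrow> P i (l i)"
proof -
  have "\<forall>i\<in>Basis. \<exists>l. P i l" using assms by blast
  then have "\<exists>l. \<forall>i\<in>Basis. P i (l i)" by (rule bchoice)
  then show thesis using that by blast
qed

text \<open>The mean value theorem on the segments \<open>{0<..y}\<close> only uses the derivative away from the origin.\<close>

lemma removable_derivative:
  fixes v :: "'a::euclidean_space \<Rightarrow> real"
  assumes r: "r > 0" and v: "continuous_on (ball 0 r) v" and G: "continuous_on (ball 0 r) G"
    and deriv: "\<And>x. x \<in> ball 0 r - {0} \<Longrightarrow> (v has_derivative (\<lambda>h. G x \<bullet> h)) (at x)"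
  shows "(v has_derivative (\<lambda>h. G 0 \<bullet> h)) (at 0)"
  unfolding has_derivative_at_alt
proof (intro conjI allI impI)
  show "bounded_linear (\<lambda>h. G 0 \<bullet> h)" by (rule bounded_linear_inner_right)
  fix e :: real assume "e > 0"
  moreover have "isCont G 0" using G r by (simp add: continuous_on_eq_continuous_at)
  ultimately obtain d where d: "d > 0" "\<And>y. dist y 0 < d \<Longrightarrow> dist (G y) (G 0) < e"
    unfolding continuous_at_eps_delta by meson
  show "\<exists>d>0. \<forall>y. norm (y - 0) < d \<longrightarrow> norm (v y - v 0 - G 0 \<bullet> (y - 0)) \<le> e * norm (y - 0)"
  proof (intro exI[of _ "min d r"] conjI allI impI)
    fix y :: 'a assume "norm (y - 0) < min d r"
    then have y: "norm y < d" "norm y < r" by auto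
    show "norm (v y - v 0 - G 0 \<bullet> (y - 0)) \<le> e * norm (y - 0)"
    proof (cases "y = 0")
      case False
      have seg: "norm (t *\<^sub>R y) \<le> norm y" if "0 \<le> t" "t \<le> 1" for t
        using that mult_right_mono[of t 1 "norm y"] by simp
      have "\<exists>t\<in>{0<..<1}. v (1 *\<^sub>R y) - v (0 *\<^sub>R y) = G (t *\<^sub>R y) \<bullet> ((1 - 0) *\<^sub>R y)"
      proof (rule mvt[of 0 1 "\<lambda>t. v (t *\<^sub>R y)" "\<lambda>t h. G (t *\<^sub>R y) \<bullet> (h *\<^sub>R y)"])
        show "continuous_on {0..1} (\<lambda>t. v (t *\<^sub>R y))"
          by (intro continuous_on_compose2[OF v] continuous_intros) (use seg y in \<open>force\<close>)
        fix t :: real assume t: "0 < t" "t < 1"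
        have "norm (t *\<^sub>R y) < r" using order_le_less_trans[OF seg y(2)] t by simp
        then have "t *\<^sub>R y \<in> ball 0 r - {0}" using t False by simp
        moreover have "((\<lambda>t. t *\<^sub>R y) has_derivative (\<lambda>h. h *\<^sub>R y)) (at t)"
          by (auto intro!: derivative_eq_intros)
        ultimately show "((\<lambda>t. v (t *\<^sub>R y)) has_derivative (\<lambda>h. G (t *\<^sub>R y) \<bullet> (h *\<^sub>R y))) (at t)"
          using has_derivative_compose[OF _ deriv] by blast
      qed (auto simp: Bex_def)
      then obtain t where t: "0 < t" "t < 1" "v y - v 0 = G (t *\<^sub>R y) \<bullet> y" by auto
      have "norm (v y - v 0 - G 0 \<bullet> y) = \<bar>(G (t *\<^sub>R y) - G 0) \<bullet> y\<bar>"
        by (simp add: t(3) inner_diff_left)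
      also have "\<dots> \<le> norm (G (t *\<^sub>R y) - G 0) * norm y" by (rule Cauchy_Schwarz_ineq2)
      also have "\<dots> \<le> e * norm y"
      proof (rule mult_right_mono)
        have "norm (t *\<^sub>R y) < d" using order_le_less_trans[OF seg y(1)] t by simp
        then show "norm (G (t *\<^sub>R y) - G 0) \<le> e"
          using d(2)[of "t *\<^sub>R y"] by (simp add: dist_norm)
      qed simp
      finally show ?thesis by simp
    qed simp
  qed (use d r in auto)
qed

context punctured_solution
begin

text \<open>Since \<open>u\<close> is bounded when \<open>\<gamma> = 0\<close>, only the gradient
  term of \<open>f\<close> can blow up, with exponent \<open>q * p\<close>; a larger
  \<open>\<beta>\<close> is a weaker bound because \<open>norm x \<le> 1\<close>.\<close>

lemma f_decay_from_grad:
  assumes z: "\<gamma> = 0" and C: "C \<ge> 0" "\<And>x. x \<in> cball 0 1 - {0} \<Longrightarrow> norm (g x) \<le> C * norm x powr (- p)"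
    and \<beta>: "0 \<le> \<beta>" "q * p \<le> \<beta>"
  obtains C' where "C' \<ge> 0" "\<And>x. x \<in> \<Omega> \<Longrightarrow> \<bar>f x\<bar> \<le> C' * norm x powr (- \<beta>)"
proof -
  obtain L where L: "L \<ge> 1" "\<And>x. x \<in> cball 0 1 - {0} \<Longrightarrow> u x \<le> L" using u_bounded[OF z] by blast
  have 1: "norm (g x) powr q \<le> C powr q * norm x powr (- \<beta>)" if x: "x \<in> cball 0 1 - {0}" for x
  proof -
    have "norm (g x) powr q \<le> (C * norm x powr (- p)) powr q"
      using C(2)[OF x] q by (intro powr_mono2) auto
    also have "\<dots> = C powr q * (norm x powr (- p)) powr q" by (rule powr_mult)
    also have "(norm x powr (- p)) powr q = norm x powr (- (q * p))" by (simp add: powr_powr mult.commute)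
    also have "C powr q * norm x powr (- (q * p)) \<le> C powr q * norm x powr (- \<beta>)"
      using x \<beta> by (intro mult_left_mono powr_mono') auto
    finally show ?thesis .
  qed
  have 2: "exp (b * u x) \<le> exp (b * L) * norm x powr (- \<beta>)" if x: "x \<in> cball 0 1 - {0}" for x
  proof -
    have "exp (b * u x) \<le> exp (b * L) * 1" using L(2)[OF x] b by simp
    also have "\<dots> \<le> exp (b * L) * norm x powr (- \<beta>)"
      using x \<beta> powr_mono2'[of "- \<beta>" "norm x" 1] by (intro mult_left_mono) auto
    finally show ?thesis .
  qed
  show thesis
    by (rule f_decay[of "C powr q" \<beta> "exp (b * L)"]) (use 1 2 that in auto)
qed

text \<open>One step takes the exponent \<open>p\<close> to \<open>q * p - 1\<close>, and
  \<open>q * p - 1 \<le> p - (2 - q)\<close> because \<open>p \<le> 1\<close>: a gain of at least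
  \<open>2 - q\<close>. The floor \<open>1 / (2 * q)\<close> is where the iteration may stop, since
  \<open>q\<close> times it is 1/2.\<close>

lemma bootstrap:
  assumes z: "\<gamma> = 0"
  shows "\<exists>C\<ge>0. \<forall>x\<in>cball 0 1 - {0}. norm (g x) \<le> C * norm x powr (- max (1 / (2 * q)) (1 - real n * (2 - q)))"
proof (induction n)
  case 0
  have "1 / (2 * q) \<le> 1" using q by simp
  then have "max (1 / (2 * q)) (1 - real 0 * (2 - q)) = 1" by simp
  moreover obtain C where "C \<ge> 0" "\<And>x. x \<in> cball 0 1 - {0} \<Longrightarrow> norm (g x) \<le> C * norm x powr (- 1)"
    using grad_decay_1[OF z] by blast
  ultimately show ?case by (simp only:) blast
next
  case (Suc n)
  define e where "e = 1 / (2 * q)"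
  have e: "0 < e" "e < 1" "q * e = 1/2" using q by (auto simp: e_def)
  define p where "p = max e (1 - real n * (2 - q))"
  have p: "e \<le> p" "p \<le> 1" using e q by (auto simp: p_def)
  \<comment> \<open>\<open>bootstrap_step\<close> needs an exponent above 1; the alternative
    \<open>1 + e\<close> ensures this and leads exactly to the floor \<open>e\<close>.\<close>
  define \<beta> where "\<beta> = max (q * p) (1 + e)"
  have "q * p \<le> q * 1" using p q by (intro mult_left_mono) auto
  then have "q * p < 2" using q by linarith
  then have \<beta>: "1 < \<beta>" "\<beta> < 2" "0 \<le> \<beta>" "q * p \<le> \<beta>" using e by (auto simp: \<beta>_def)
  obtain C where C: "C \<ge> 0" "\<And>x. x \<in> cball 0 1 - {0} \<Longrightarrow> norm (g x) \<le> C * norm x powr (- p)"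
    using Suc.IH unfolding p_def e_def by auto
  obtain C' where C': "C' \<ge> 0" "\<And>x. x \<in> \<Omega> \<Longrightarrow> \<bar>f x\<bar> \<le> C' * norm x powr (- \<beta>)"
    using f_decay_from_grad[OF z C \<beta>(3,4)] by blast
  obtain C'' where C'': "C'' \<ge> 0" "\<And>x. x \<in> cball 0 1 - {0} \<Longrightarrow> norm (g x) \<le> C'' * norm x powr (- (\<beta> - 1))"
    using bootstrap_step[OF z C' \<beta>(1,2)] by blast
  have "(q - 1) * p \<le> (q - 1) * 1" using p q by (intro mult_left_mono) auto
  then have "q * p - 1 \<le> p - (2 - q)" by (simp add: algebra_simps)
  also have "\<dots> \<le> max e (1 - real (Suc n) * (2 - q))" using q by (auto simp: p_def algebra_simps max_def)
  finally have le: "\<beta> - 1 \<le> max e (1 - real (Suc n) * (2 - q))" by (auto simp: \<beta>_def)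
  have "norm (g x) \<le> C'' * norm x powr (- max e (1 - real (Suc n) * (2 - q)))" if x: "x \<in> cball 0 1 - {0}" for x
  proof -
    have "norm x powr (- (\<beta> - 1)) \<le> norm x powr (- max e (1 - real (Suc n) * (2 - q)))"
      using x le by (intro powr_mono') auto
    then show ?thesis using C''(2)[OF x] mult_left_mono[OF _ C''(1)] by (meson order_trans)
  qed
  then show ?case using C''(1) unfolding e_def by blast
qed

text \<open>Finitely many bootstrap steps reach the floor. The exponent 1/2 lies below 1, so the
  rate of the gradient averages becomes integrable at radius 0, as \<open>davg_error\<close>
  requires.\<close>

lemma f_decay_half:
  assumes z: "\<gamma> = 0"
  obtains C where "C \<ge> 0" "\<And>x. x \<in> \<Omega> \<Longrightarrow> \<bar>f x\<bar> \<le> C * norm x powr (- (1/2))"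
proof -
  obtain n where "1 / (2 - q) < real n" using reals_Archimedean2 by blast
  then have "1 < real n * (2 - q)" using q by (simp add: pos_divide_less_eq)
  moreover have "0 \<le> 1 / (2 * q)" using q by simp
  ultimately have "1 - real n * (2 - q) \<le> 1 / (2 * q)" by linarith
  then have "max (1 / (2 * q)) (1 - real n * (2 - q)) = 1 / (2 * q)" by simp
  then obtain C where C: "C \<ge> 0" "\<And>x. x \<in> cball 0 1 - {0} \<Longrightarrow> norm (g x) \<le> C * norm x powr (- (1 / (2 * q)))"
    using bootstrap[OF z, of n] by auto
  show thesis
    by (rule f_decay_from_grad[OF z C, of "1/2"]) (use q that in auto)
qed

lemma davg_error:
  assumes z: "\<gamma> = 0" and C: "C \<ge> 0" "\<And>x. x \<in> \<Omega> \<Longrightarrow> \<bar>f x\<bar> \<le> C * norm x powr (- (1/2))"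
  obtains K where "K \<ge> 0" "\<And>i x s t. i \<in> Basis \<Longrightarrow> norm x \<le> 1/4 \<Longrightarrow> 0 < s \<Longrightarrow> s \<le> t \<Longrightarrow> t \<le> 1/2 \<Longrightarrow>
    \<bar>davg i (trunc u) x t - davg i (trunc u) x s\<bar> \<le> K * t powr (1/2)"
proof -
  obtain K where K: "K \<ge> 0"
    "\<And>i x t. i \<in> Basis \<Longrightarrow> 0 < t \<Longrightarrow> \<bar>(LBINT y. trunc f y * dcut i t (y - x)) / (2 * pi * t)\<bar> \<le> K * t powr (- (1/2))"
    by (rule davg_derivative_bound[OF C]) auto
  show thesis
  proof (rule that[of "2 * K"])
    fix i x :: "real^2" and s t :: real
    assume i: "i \<in> Basis" and x: "norm x \<le> 1/4" and st: "0 < s" "s \<le> t" "t \<le> 1/2"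
    have "\<bar>davg i (trunc u) x t - davg i (trunc u) x s\<bar> \<le> (\<lambda>t. 2 * K * t powr (1/2)) t - (\<lambda>t. 2 * K * t powr (1/2)) s"
    proof (rule increment_le[OF st(2)])
      fix r assume r: "s \<le> r" "r \<le> t"
      have r0: "r > 0" "r \<le> 1/2" using r st by auto
      show "((\<lambda>t. davg i (trunc u) x t) has_real_derivative (LBINT y. trunc f y * dcut i r (y - x)) / (2 * pi * r)) (at r)"
        by (rule davg_derivative[OF z r0(1) sub_unit_ball[OF x r0(2)] i])
      show "((\<lambda>t. 2 * K * t powr (1/2)) has_real_derivative K * r powr (- (1/2))) (at r)"
        by (rule cmult_powr_has_derivative[OF r0(1)]) auto
      show "\<bar>(LBINT y. trunc f y * dcut i r (y - x)) / (2 * pi * r)\<bar> \<le> K * r powr (- (1/2))"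
        by (rule K(2)[OF i r0(1)])
    qed
    also have "\<dots> \<le> 2 * K * t powr (1/2)" using K(1) by simp
    finally show "\<bar>davg i (trunc u) x t - davg i (trunc u) x s\<bar> \<le> 2 * K * t powr (1/2)" .
  qed (use K in auto)
qed

text \<open>Near the origin the averages of \<open>u\<close> and of its gradient converge uniformly,
  also at 0 itself; the limits there supply \<open>v 0\<close> and \<open>G 0\<close>, and
  \<open>removable_derivative\<close> shows that they belong together.\<close>

lemma C1_extension:
  assumes z: "\<gamma> = 0"
  obtains v G where "continuous_on (cball 0 1) G" "\<And>x. x \<in> cball 0 1 - {0} \<Longrightarrow> v x = u x \<and> G x = g x"
    "(v has_derivative (\<lambda>h. G 0 \<bullet> h)) (at 0)"
proof -
  obtain C where C: "C \<ge> 0" "\<And>x. x \<in> \<Omega> \<Longrightarrow> \<bar>f x\<bar> \<le> C * norm x powr (- (1/2))"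
    using f_decay_half[OF z] by blast
  define S :: "(real^2) set" where "S = cball 0 (1/4)"
  have SO: "x \<in> \<Omega>" if "x \<in> S" "x \<noteq> 0" for x using that by (auto simp: S_def)
  have half: "(1/2::real) > 0" by simp
  obtain K where K: "K \<ge> 0" "\<And>x s t. norm x \<le> 1/4 \<Longrightarrow> 0 < s \<Longrightarrow> s \<le> t \<Longrightarrow> t \<le> 1/2 \<Longrightarrow>
    \<bar>avg (trunc u) x t - avg (trunc u) x s\<bar> \<le> K * t powr (2 - 1/2)"
    by (rule avg_error[OF z C]) auto
  have "\<exists>l. continuous_on S l \<and> (\<forall>x L. x \<in> S \<longrightarrow> ((\<lambda>t. avg (trunc u) x t) \<longlongrightarrow> L) (at_right 0) \<longrightarrow> l x = L)"
    by (rule uniform_approximation_continuous[OF half, of S "\<lambda>t x. avg (trunc u) x t" "\<lambda>t. K * t powr (2 - 1/2)"])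
      (use K(2) continuous_avg(1)[OF trunc_u_integrable] powr_tendsto_0_right[of "2 - 1/2" K] in \<open>auto simp: S_def\<close>)
  then obtain lu where lu: "continuous_on S lu" "\<And>x L. x \<in> S \<Longrightarrow> ((\<lambda>t. avg (trunc u) x t) \<longlongrightarrow> L) (at_right 0) \<Longrightarrow> lu x = L"
    by blast
  have lu_eq: "lu x = u x" if x: "x \<in> S" "x \<noteq> 0" for x
    using lu(2)[OF x(1) avg_tendsto[OF trunc_u_integrable trunc_isCont[OF cont_\<Omega>(1) SO[OF x]]]] SO[OF x]
    by (simp only: trunc_eq)
  obtain K' where K': "K' \<ge> 0" "\<And>i x s t. i \<in> Basis \<Longrightarrow> norm x \<le> 1/4 \<Longrightarrow> 0 < s \<Longrightarrow> s \<le> t \<Longrightarrow> t \<le> 1/2 \<Longrightarrow>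
    \<bar>davg i (trunc u) x t - davg i (trunc u) x s\<bar> \<le> K' * t powr (1/2)"
    using davg_error[OF z C] by blast
  have "\<exists>l. continuous_on S l \<and> (\<forall>x L. x \<in> S \<longrightarrow> ((\<lambda>t. davg i (trunc u) x t) \<longlongrightarrow> L) (at_right 0) \<longrightarrow> l x = L)"
    if i: "i \<in> Basis" for i
    by (rule uniform_approximation_continuous[OF half, of S "\<lambda>t x. davg i (trunc u) x t" "\<lambda>t. K' * t powr (1/2)"])
      (use K'(2)[OF i] continuous_avg(2)[OF trunc_u_integrable _ i] powr_tendsto_0_right[of "1/2" K'] in \<open>auto simp: S_def\<close>)
  then obtain l where l: "\<And>i. i \<in> Basis \<Longrightarrow> continuous_on S (l i) \<and>
      (\<forall>x L. x \<in> S \<longrightarrow> ((\<lambda>t. davg i (trunc u) x t) \<longlongrightarrow> L) (at_right 0) \<longrightarrow> l i x = L)"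
    using Basis_choice[where P="\<lambda>i l. continuous_on S l \<and>
      (\<forall>x L. x \<in> S \<longrightarrow> ((\<lambda>t. davg i (trunc u) x t) \<longlongrightarrow> L) (at_right 0) \<longrightarrow> l x = L)"] by blast
  have l_eq: "l i x = g x \<bullet> i" if x: "x \<in> S" "x \<noteq> 0" and i: "i \<in> Basis" for x i
    using l[OF i] x(1) davg_tendsto[OF SO[OF x] i] by blast
  define v where "v x = (if x = 0 then lu 0 else u x)" for x
  define G where "G x = (if x = 0 then (\<Sum>i\<in>Basis. l i 0 *\<^sub>R i) else g x)" for x
  have "continuous_on S (\<lambda>x. \<Sum>i\<in>Basis. l i x *\<^sub>R i)"
    using l by (intro continuous_intros) auto
  then have GS: "continuous_on S G"
    by (rule continuous_on_eq) (auto simp: G_def l_eq euclidean_representation)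
  have vS: "continuous_on S v"
    by (rule continuous_on_eq[OF lu(1)]) (auto simp: v_def lu_eq)
  have un: "(cball 0 1 - {0}) \<union> ball 0 (1/4) = (cball 0 1 :: (real^2) set)" by auto
  \<comment> \<open>Continuity is glued from two relatively open pieces: the given gradient off the
    origin and the uniform limit near it.\<close>
  have "continuous_on ((cball 0 1 - {0}) \<union> ball 0 (1/4)) G"
  proof (rule continuous_on_Un_local_open)
    show "openin (top_of_set ((cball 0 1 - {0}) \<union> ball 0 (1/4))) (cball 0 1 - {0 :: real^2})"
      unfolding un openin_open by (intro exI[of _ "- {0}"]) auto
    show "openin (top_of_set ((cball 0 1 - {0}) \<union> ball 0 (1/4))) (ball (0 :: real^2) (1/4))"
      unfolding un openin_open by (intro exI[of _ "ball 0 (1/4)"]) auto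
    show "continuous_on (cball 0 1 - {0}) G"
      by (rule continuous_on_eq[OF g_cont]) (auto simp: G_def)
    show "continuous_on (ball 0 (1/4)) G"
      by (rule continuous_on_subset[OF GS]) (auto simp: S_def)
  qed
  then have 1: "continuous_on (cball 0 1) G" unfolding un .
  have 2: "(v has_derivative (\<lambda>h. G 0 \<bullet> h)) (at 0)"
  proof (rule removable_derivative[of "1/4"])
    show "continuous_on (ball 0 (1/4)) v" "continuous_on (ball 0 (1/4)) G"
      by (rule continuous_on_subset[OF vS] continuous_on_subset[OF GS]; auto simp: S_def)+
    fix x :: "real^2" assume x: "x \<in> ball 0 (1/4) - {0}"
    then have "(u has_derivative (\<lambda>h. G x \<bullet> h)) (at x)"
      using u_deriv[of x] by (auto simp: G_def)
    then show "(v has_derivative (\<lambda>h. G x \<bullet> h)) (at x)"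
      by (rule has_derivative_transform_within_open[of _ _ _ _ "- {0}"]) (use x in \<open>auto simp: v_def\<close>)
  qed simp
  show thesis by (rule that[OF 1 _ 2]) (auto simp: v_def G_def)
qed

end

section \<open>From extensions by zero back to the distributional statement\<close>

lemma trunc_cong: "(\<And>y. y \<in> ball 0 1 - {0} \<Longrightarrow> h y = k y) \<Longrightarrow> trunc h = trunc k"
  unfolding trunc_def by (intro ext) (simp split: split_indicator)

text \<open>Restricting \<open>h\<close> to the disc changes \<open>trunc h\<close> at most at the
  origin, a null set.\<close>

lemma trunc_integral:
  assumes "integrable lborel (trunc h)"
  shows "set_integrable lborel (ball 0 1) h" "(LBINT y:ball 0 1. h y) = integral\<^sup>L lborel (trunc h)"
proof -
  have eq: "(\<lambda>y. indicator (ball 0 1) y *\<^sub>R h y) = (\<lambda>y. trunc h y + indicator {0} y * h 0)"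
    by (auto simp: trunc_def fun_eq_iff indicator_def)
  have int: "integrable lborel (\<lambda>y. indicator {0 :: real^2} y * h 0)"
    by (intro integrable_mult_left integrable_real_indicator) auto
  show "set_integrable lborel (ball 0 1) h"
    unfolding set_integrable_def eq using assms int by (rule Bochner_Integration.integrable_add)
  show "(LBINT y:ball 0 1. h y) = integral\<^sup>L lborel (trunc h)"
    unfolding set_lebesgue_integral_def eq using Bochner_Integration.integral_add[OF assms int] by simp
qed

text \<open>\<open>h\<close> may blow up at the boundary of \<open>\<Omega>\<close>, in particular
  at the puncture; the product lives on a compact subset of \<open>\<Omega>\<close>.\<close>

lemma test_function_set_integrable:
  fixes h :: "'a::euclidean_space \<Rightarrow> real"
  assumes "\<phi> \<in> test_functions \<Omega>" "continuous_on \<Omega> h"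
  shows "set_integrable lborel \<Omega> (\<lambda>y. h y * \<phi> y)"
proof -
  define K where "K = closure {x. \<phi> x \<noteq> 0}"
  have K: "compact K" "K \<subseteq> \<Omega>" and Ck: "Ck 0 \<phi>" using assms(1) unfolding test_functions_def K_def by blast+
  have "continuous_on K (\<lambda>y. h y * \<phi> y)"
    using Ck by (intro continuous_intros continuous_on_subset[OF assms(2) K(2)]) (auto intro: continuous_on_subset)
  from integrable_truncate[OF this K(1)]
  have "integrable lborel (\<lambda>y. indicator K y * (h y * \<phi> y))" .
  moreover have "indicator K y * (h y * \<phi> y) = indicator \<Omega> y *\<^sub>R (h y * \<phi> y)" for y
  proof (cases "\<phi> y = 0")
    case False
    then have "y \<in> K" using closure_subset[of "{x. \<phi> x \<noteq> 0}"] by (auto simp: K_def)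
    then show ?thesis using K(2) by auto
  qed simp
  ultimately show ?thesis unfolding set_integrable_def by simp
qed

lemma grad_eq:
  assumes "(u has_derivative (\<lambda>h. G \<bullet> h)) (at x)"
  shows "grad u x = G"
  unfolding grad_def
proof (rule the_equality)
  show "GDERIV u x :> G" using assms by (simp add: gderiv_def inner_commute)
  fix D assume "GDERIV u x :> D"
  then have "(\<lambda>h. h \<bullet> D) = (\<lambda>h. G \<bullet> h)"
    using has_derivative_unique assms unfolding gderiv_def by blast
  then have "D \<bullet> D = G \<bullet> D" "G \<bullet> D = G \<bullet> G" by (metis inner_commute)+
  then have "(D - G) \<bullet> (D - G) = 0" by (simp add: inner_diff_left inner_diff_right inner_commute)
  then show "D = G" by simp
qed

theorem theorem1:
  fixes m a b q :: real and u :: "real ^ 2 \<Rightarrow> real"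
  assumes "m > 0" and "a > 0" and "b > 0" and "1 < q" and "q < 2"
    and "C1_on (cball 0 1 - {0}) u"
    and "\<And>x. x \<in> cball 0 1 - {0} \<Longrightarrow> u x > 0"
    and "eq_distr (ball 0 1 - {0})
           (\<lambda>\<phi>. - distr_laplacian (distr_of (ball 0 1 - {0}) u) \<phi>
                + distr_of (ball 0 1 - {0}) (\<lambda>x. a * exp (b * u x)) \<phi>
                - distr_of (ball 0 1 - {0}) (\<lambda>x. m * norm (grad u x) powr q) \<phi>)
           (\<lambda>\<phi>. 0)"
  shows "\<exists>\<gamma>\<in>{0..2 / b}.
           ((\<lambda>x. u x / (- ln (norm x))) \<longlongrightarrow> \<gamma>) (at 0) \<and>
           set_integrable lborel (ball 0 1) (\<lambda>x. exp (b * u x)) \<and>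
           set_integrable lborel (ball 0 1) (\<lambda>x. norm (grad u x) powr q) \<and>
           u locally_integrable_on ball 0 1 \<and>
           eq_distr (ball 0 1)
             (\<lambda>\<phi>. - distr_laplacian (distr_of (ball 0 1) u) \<phi>
                  + distr_of (ball 0 1) (\<lambda>x. a * exp (b * u x)) \<phi>
                  - distr_of (ball 0 1) (\<lambda>x. m * norm (grad u x) powr q) \<phi>)
             (\<lambda>\<phi>. 2 * pi * \<gamma> * dirac 0 \<phi>) \<and>
           (\<gamma> = 0 \<longrightarrow>
             (\<exists>v. C1_on (cball 0 1) v \<and> (\<forall>x\<in>cball 0 1 - {0}. v x = u x)))"
proof -
  let ?\<Omega> = "ball 0 1 - {0} :: (real^2) set"
  obtain g where g: "continuous_on (cball 0 1 - {0}) g"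
    and gderiv: "\<And>x. x \<in> cball 0 1 - {0} \<Longrightarrow> (u has_derivative (\<lambda>h. g x \<bullet> h)) (at x within cball 0 1 - {0})"
    using assms(6) unfolding C1_on_def by blast
  have u_cont: "continuous_on (cball 0 1 - {0}) u"
    using gderiv has_derivative_continuous continuous_on_eq_continuous_within by blast
  have sub: "?\<Omega> \<subseteq> cball 0 1 - {0}" using ball_subset_cball by blast
  have u_deriv: "(u has_derivative (\<lambda>h. g x \<bullet> h)) (at x)" if "x \<in> ?\<Omega>" for x
    using has_derivative_subset[OF gderiv sub, of x] that sub at_within_open[OF that] by (auto simp: open_Diff)
  have grad: "grad u x = g x" if "x \<in> ?\<Omega>" for x
    by (rule grad_eq[OF u_deriv[OF that]])
  have gq: "continuous_on (cball 0 1 - {0}) (\<lambda>x. norm (g x) powr q)"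
    using assms(4) by (intro continuous_on_powr' continuous_intros g) auto
  have sol: "solves ?\<Omega> u (\<lambda>x. m * norm (g x) powr q - a * exp (b * u x))"
    unfolding solves_def
  proof
    fix \<phi> assume \<phi>: "\<phi> \<in> test_functions ?\<Omega>"
    have i1: "set_integrable lborel ?\<Omega> (\<lambda>y. (m * norm (g y) powr q) * \<phi> y)"
      and i2: "set_integrable lborel ?\<Omega> (\<lambda>y. (a * exp (b * u y)) * \<phi> y)"
      by (intro test_function_set_integrable[OF \<phi>] continuous_intros continuous_on_subset[OF gq sub]
          continuous_on_subset[OF u_cont sub])+
    have "(LBINT y:?\<Omega>. (m * norm (grad u y) powr q) * \<phi> y) = (LBINT y:?\<Omega>. (m * norm (g y) powr q) * \<phi> y)"
      by (rule set_lebesgue_integral_cong) (auto simp: grad)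
    moreover have "- (LBINT y:?\<Omega>. u y * laplacian \<phi> y) + (LBINT y:?\<Omega>. (a * exp (b * u y)) * \<phi> y)
        - (LBINT y:?\<Omega>. (m * norm (grad u y) powr q) * \<phi> y) = 0"
      using assms(8) \<phi> unfolding eq_distr_def distr_laplacian_def distr_of_def by blast
    moreover have "(LBINT y:?\<Omega>. (m * norm (g y) powr q - a * exp (b * u y)) * \<phi> y) =
        (LBINT y:?\<Omega>. (m * norm (g y) powr q) * \<phi> y) - (LBINT y:?\<Omega>. (a * exp (b * u y)) * \<phi> y)"
      unfolding left_diff_distrib by (rule set_integral_diff(2)[OF i1 i2])
    ultimately show "- (LBINT y:?\<Omega>. u y * laplacian \<phi> y) =
        (LBINT y:?\<Omega>. (m * norm (g y) powr q - a * exp (b * u y)) * \<phi> y)" by simp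
  qed
  interpret punctured_solution m a b q u g
    by unfold_locales (use assms(1-5,7) u_cont g u_deriv sol in auto)
  \<comment> \<open>At 0 the definite description in \<open>grad u 0\<close> may be meaningless;
    \<open>trunc\<close> ignores that point.\<close>
  have trunc_grad: "trunc (\<lambda>x. norm (grad u x) powr q) = trunc gradq"
    by (rule trunc_cong) (simp only: grad)
  have int_grad: "integrable lborel (trunc (\<lambda>x. norm (grad u x) powr q))"
    unfolding trunc_grad by (rule trunc_gradq_integrable)
  have "u locally_integrable_on ball 0 1"
    unfolding locally_integrable_on_def
  proof (intro allI impI)
    fix K :: "(real^2) set" assume K: "compact K" "K \<subseteq> ball 0 1"
    have "K \<in> sets lborel" using borel_closed[OF compact_imp_closed[OF K(1)]] by simp
    then show "set_integrable lborel K u"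
      using K(2) by (rule set_integrable_subset[OF trunc_integral(1)[OF trunc_u_integrable]])
  qed
  moreover have "eq_distr (ball 0 1)
     (\<lambda>\<phi>. - distr_laplacian (distr_of (ball 0 1) u) \<phi>
          + distr_of (ball 0 1) (\<lambda>x. a * exp (b * u x)) \<phi>
          - distr_of (ball 0 1) (\<lambda>x. m * norm (grad u x) powr q) \<phi>)
     (\<lambda>\<phi>. 2 * pi * \<gamma> * dirac 0 \<phi>)"
    unfolding eq_distr_def distr_laplacian_def distr_of_def dirac_def
  proof
    fix \<phi> :: "real^2 \<Rightarrow> real" assume \<phi>: "\<phi> \<in> test_functions (ball 0 1)"
    then have Ck: "Ck k \<phi>" for k by (simp add: test_functions_def)
    have c\<phi>: "continuous_on UNIV \<phi>" by (rule Ck_continuous_on[OF Ck])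
    have cl: "continuous_on UNIV (laplacian \<phi>)"
      unfolding laplacian_def
      by (intro continuous_intros Ck_continuous_on[OF Ck_partial_deriv[OF Ck_partial_deriv[OF Ck]]])
    have mult: "trunc (\<lambda>y. h y * k y) = (\<lambda>y. trunc h y * k y)" for h k
      by (simp add: fun_eq_iff trunc_def mult.assoc)
    have I: "(LBINT y:ball 0 1. h y * k y) = (LBINT y. trunc h y * k y)"
      if "integrable lborel (trunc h)" "continuous_on UNIV k" for h k
      using trunc_integral(2)[of "\<lambda>y. h y * k y"] integrable_trunc_mult[OF that] by (simp add: mult)
    have cmult: "trunc (\<lambda>y. c * h y) = (\<lambda>y. c * trunc h y)" for c h
      by (simp add: fun_eq_iff trunc_def mult_ac)
    have ia: "integrable lborel (trunc (\<lambda>x. a * exp (b * u x)))" and im: "integrable lborel (trunc (\<lambda>x. m * norm (grad u x) powr q))"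
      unfolding cmult using trunc_expu_integrable int_grad by auto
    have "(LBINT y. trunc f y * \<phi> y) =
        (LBINT y. trunc (\<lambda>x. m * norm (grad u x) powr q) y * \<phi> y - trunc (\<lambda>x. a * exp (b * u x)) y * \<phi> y)"
      by (simp add: trunc_f cmult trunc_grad left_diff_distrib)
    also have "\<dots> = (LBINT y. trunc (\<lambda>x. m * norm (grad u x) powr q) y * \<phi> y)
        - (LBINT y. trunc (\<lambda>x. a * exp (b * u x)) y * \<phi> y)"
      by (intro Bochner_Integration.integral_diff integrable_trunc_mult ia im c\<phi>)
    finally show "- (LBINT y:ball 0 1. u y * laplacian \<phi> y) + (LBINT y:ball 0 1. a * exp (b * u y) * \<phi> y)
        - (LBINT y:ball 0 1. m * norm (grad u y) powr q * \<phi> y) = 2 * pi * \<gamma> * \<phi> 0"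
      using dirac_equation[OF \<phi>] unfolding I[OF trunc_u_integrable cl] I[OF ia c\<phi>] I[OF im c\<phi>] by linarith
  qed
  moreover have "\<exists>v. C1_on (cball 0 1) v \<and> (\<forall>x\<in>cball 0 1 - {0}. v x = u x)" if z: "\<gamma> = 0"
  proof -
    obtain v G where G: "continuous_on (cball 0 1) G" and eq: "\<And>x. x \<in> cball 0 1 - {0} \<Longrightarrow> v x = u x \<and> G x = g x"
      and v0: "(v has_derivative (\<lambda>h. G 0 \<bullet> h)) (at 0)"
      by (rule C1_extension[OF z]) (rule that)
    have "(v has_derivative (\<lambda>h. G x \<bullet> h)) (at x within cball 0 1)" if x: "x \<in> cball 0 1" for x
    proof (cases "x = 0")
      case False
      then have x': "x \<in> cball 0 1 - {0}" using x by simp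
      have "(v has_derivative (\<lambda>h. g x \<bullet> h)) (at x within cball 0 1 - {0})"
        by (rule has_derivative_transform[OF x' _ gderiv[OF x']]) (use eq in auto)
      \<comment> \<open>Removing the origin does not affect the neighbourhood filter at a nonzero
        \<open>x\<close>, so the derivative within the punctured disc carries over, boundary circle
        included.\<close>
      moreover have "at x within cball 0 1 - {0} = at x within cball 0 1"
        by (rule at_within_nhd[of _ "- {0}"]) (use False in auto)
      ultimately show ?thesis using eq[OF x'] by simp
    qed (use v0 in \<open>auto intro: has_derivative_at_withinI\<close>)
    then have "C1_on (cball 0 1) v" unfolding C1_on_def using G by blast
    then show ?thesis using eq by blast
  qed
  ultimately show ?thesis
    using \<gamma>_bounds u_limit trunc_integral(1)[OF trunc_expu_integrable] trunc_integral(1)[OF int_grad]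
    by (intro bexI[of _ \<gamma>]) auto
qed

end
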